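(* Let $M$ be a spacelike cyclic surface in $\mathbf{E}_1^3$ such that the circles of the foliation of $M$ lie in parallel planes. If $M$ is a linear Weingarten surface, then $M$ is a surface of revolution, or $H=0$ on $M$, or $K=0$ on $M$.
   Context: $\mathbf{E}_1^3$ is Minkowski three-space, i.e. $\mathbb{R}^3$ with the scalar product $\langle,\rangle=(dx_1)^2+(dx_2)^2-(dx_3)^2$. An immersed surface $M$ is spacelike if the induced metric is Riemannian. A vector $v$ is spacelike if $\langle v,v\rangle>0$ or $v=0$, timelike if $\langle v,v\rangle<0$, lightlike if $\langle v,v\rangle=0$ and $v\neq 0$. A plane is spacelike, timelike or lightlike if the induced metric on it is positive definite, of index $1$, or degenerate, respectively. Curvatures: let $\mathbf{G}$ be a (necessarily timelike) unit normal field, $\langle \mathbf{G},\mathbf{G}\rangle=-1$, of the spacelike surface $M$. Then $H=\frac12\,\mathrm{trace}(d\mathbf{G})$ is the mean curvature and $K=\det(-d\mathbf{G})$ is the Gauss curvature (reversing $\mathbf{G}$ changes only the sign of $H$). $M$ is a linear Weingarten surface if there are real constants $a,b,c$ with $a^2+b^2\neq 0$ such that $aH+bK=c$ on $M$. Circles: a (spacelike) circle in $\mathbf{E}_1^3$ is a spacelike planar curve with constant curvature; concretely, up to an isometry of $\mathbf{E}_1^3$, it is (a piece of) one of the following, with $r>0$: $s\mapsto r(\cos(s/r),\sin(s/r),0)$ (in a spacelike plane); $s\mapsto r(0,\sinh(s/r),\cosh(s/r))$ (in a timelike plane); $s\mapsto (s, r s^2/2, r s^2/2)$ (in a lightlike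 plane). A cyclic surface (surface foliated by circles) is a surface determined by a smooth one-parameter family of (pieces of) circles; thus there is a one-parameter family of planes each of which meets $M$ in one of these (pieces of) circles. On a spacelike surface these circles are spacelike curves, but the planes may be of any causal type. A surface of revolution (rotational surface) is a surface for which there is a straight line $l$ such that the surface is invariant under the rotations of $\mathbf{E}_1^3$ (isometries) that leave $l$ pointwise fixed. Since only pieces of circles are considered, "is a surface of revolution" is understood as being an open part of such a surface. *)

theory Defs
  imports "HOL-Analysis.Analysis"
begin

section \<open>Minkowski three-space\<close>

definition mink :: "real^3 \<Rightarrow> real^3 \<Rightarrow> real" where
  "mink x y = x$1 * y$1 + x$2 * y$2 - x$3 * y$3"

definition mink_isometry :: "(real^3 \<Rightarrow> real^3) \<Rightarrow> bool" where
  "mink_isometry \<phi> \<longleftrightarrow>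
     (\<exists>f b. linear f \<and> (\<forall>x y. mink (f x) (f y) = mink x y) \<and> \<phi> = (\<lambda>x. f x + b))"

definition line :: "(real^3) set \<Rightarrow> bool" where
  "line l \<longleftrightarrow> affine l \<and> aff_dim l = 1"

definition plane :: "(real^3) set \<Rightarrow> bool" where
  "plane P \<longleftrightarrow> affine P \<and> aff_dim P = 2"

text \<open>The three normal forms are the full orbits, with plane of the circle spacelike,
  timelike and lightlike, respectively.\<close>

definition is_circle :: "(real^3) set \<Rightarrow> bool" where
  "is_circle C \<longleftrightarrow>
     (\<exists>\<phi> r. mink_isometry \<phi> \<and> r > 0 \<and>
        (C = \<phi> ` range (\<lambda>s. vector [r * cos (s / r), r * sin (s / r), 0]) \<or>
         C = \<phi> ` range (\<lambda>s. vector [0, r * sinh (s / r), r * cosh (s / r)]) \<or>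
         C = \<phi> ` range (\<lambda>s. vector [s, r * s\<^sup>2 / 2, r * s\<^sup>2 / 2])))"


section \<open>Smooth maps and surfaces\<close>

text \<open>For open \<open>U\<close>, all iterated partial derivatives up to order \<open>k\<close> exist and are continuous
  (and those of order less than \<open>k\<close> are Frechet differentiable).\<close>

fun Ck_on :: "nat \<Rightarrow> ('a::euclidean_space \<Rightarrow> 'b::real_normed_vector) \<Rightarrow> 'a set \<Rightarrow> bool" where
  "Ck_on 0 f U \<longleftrightarrow> continuous_on U f"
| "Ck_on (Suc k) f U \<longleftrightarrow>
     (\<forall>x\<in>U. f differentiable (at x)) \<and>
     (\<forall>i\<in>Basis. Ck_on k (\<lambda>x. frechet_derivative f (at x) i) U)"

definition smooth_map_on :: "('a::euclidean_space \<Rightarrow> 'b::real_normed_vector) \<Rightarrow> 'a set \<Rightarrow> bool" where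
  "smooth_map_on f U \<longleftrightarrow> (\<forall>k. Ck_on k f U)"

definition immersion_on :: "(real^2 \<Rightarrow> real^3) \<Rightarrow> (real^2) set \<Rightarrow> bool" where
  "immersion_on X D \<longleftrightarrow> smooth_map_on X D \<and> (\<forall>p\<in>D. inj (frechet_derivative X (at p)))"

text \<open>An immersed surface is given by an immersion \<open>X\<close> of an open parameter domain \<open>D\<close>; it is not
  required to be injective, so that, for example, a periodic parameter may run through
  complete circles.\<close>

definition spacelike_surface :: "(real^2 \<Rightarrow> real^3) \<Rightarrow> (real^2) set \<Rightarrow> bool" where
  "spacelike_surface X D \<longleftrightarrow> open D \<and> immersion_on X D \<and>
     (\<forall>p\<in>D. \<forall>w. w \<noteq> 0 \<longrightarrow>
        mink (frechet_derivative X (at p) w) (frechet_derivative X (at p) w) > 0)"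

text \<open>Embedded surfaces: every point has a neighbourhood in \<open>S\<close> that is homeomorphically
  parametrized by an immersion of an open subset of the plane.\<close>

definition regular_surface :: "(real^3) set \<Rightarrow> bool" where
  "regular_surface S \<longleftrightarrow>
     (\<forall>p\<in>S. \<exists>U V Y Z. open U \<and> open V \<and> p \<in> V \<and>
        immersion_on Y U \<and> homeomorphism U (S \<inter> V) Y Z)"


section \<open>Curvatures\<close>

definition unit_normal_field ::
    "(real^2 \<Rightarrow> real^3) \<Rightarrow> (real^2) set \<Rightarrow> (real^2 \<Rightarrow> real^3) \<Rightarrow> bool" where
  "unit_normal_field X D G \<longleftrightarrow> smooth_map_on G D \<and>
     (\<forall>p\<in>D. mink (G p) (G p) = -1 \<and> (\<forall>w. mink (G p) (frechet_derivative X (at p) w) = 0))"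

text \<open>The differential of the Gauss map, as an endomorphism of the tangent plane
  \<open>dX\<^sub>p(\<real>\<^sup>2)\<close>, written as a matrix in the coordinate basis \<open>X\<^sub>u, X\<^sub>v\<close>: it is the matrix \<open>S\<close>
  with \<open>dG\<^sub>p = dX\<^sub>p \<circ> S\<close>.\<close>

definition dgauss :: "(real^2 \<Rightarrow> real^3) \<Rightarrow> (real^2 \<Rightarrow> real^3) \<Rightarrow> real^2 \<Rightarrow> real^2^2" where
  "dgauss X G p =
     (THE S. \<forall>w. frechet_derivative G (at p) w = frechet_derivative X (at p) (S *v w))"

definition mean_curvature :: "(real^2 \<Rightarrow> real^3) \<Rightarrow> (real^2 \<Rightarrow> real^3) \<Rightarrow> real^2 \<Rightarrow> real" where
  "mean_curvature X G p = trace (dgauss X G p) / 2"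

definition gauss_curvature :: "(real^2 \<Rightarrow> real^3) \<Rightarrow> (real^2 \<Rightarrow> real^3) \<Rightarrow> real^2 \<Rightarrow> real" where
  "gauss_curvature X G p = det (- dgauss X G p)"

definition linear_weingarten ::
    "(real^2 \<Rightarrow> real^3) \<Rightarrow> (real^2) set \<Rightarrow> (real^2 \<Rightarrow> real^3) \<Rightarrow> bool" where
  "linear_weingarten X D G \<longleftrightarrow>
     (\<exists>a b c. a\<^sup>2 + b\<^sup>2 \<noteq> 0 \<and>
        (\<forall>p\<in>D. a * mean_curvature X G p + b * gauss_curvature X G p = c))"


section \<open>Cyclic surfaces and surfaces of revolution\<close>

definition leaf_params :: "(real^2) set \<Rightarrow> real set" where
  "leaf_params D = {u. \<exists>v. vector [u, v] \<in> D}"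

text \<open>The leaves are the curves \<open>v \<mapsto> X(u,v)\<close>; since \<open>X\<close> is an immersion, each is a regularly
  parametrized piece of the circle \<open>C u\<close>. The parameter \<open>u\<close> ranges over an interval, \<open>v\<close> over an
  interval that may depend on \<open>u\<close>. Smoothness of the family is smoothness of \<open>X\<close>.\<close>

definition foliated_by_circles ::
    "(real^2 \<Rightarrow> real^3) \<Rightarrow> (real^2) set \<Rightarrow> (real \<Rightarrow> (real^3) set) \<Rightarrow> bool" where
  "foliated_by_circles X D C \<longleftrightarrow>
     connected (leaf_params D) \<and>
     (\<forall>u. connected {v. vector [u, v] \<in> D}) \<and>
     (\<forall>u\<in>leaf_params D. is_circle (C u)) \<and>
     (\<forall>u v. vector [u, v] \<in> D \<longrightarrow> X (vector [u, v]) \<in> C u)"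

definition in_parallel_planes :: "(real^2) set \<Rightarrow> (real \<Rightarrow> (real^3) set) \<Rightarrow> bool" where
  "in_parallel_planes D C \<longleftrightarrow>
     (\<exists>P. (\<forall>u\<in>leaf_params D. plane (P u) \<and> C u \<subseteq> P u) \<and>
          (\<forall>u\<in>leaf_params D. \<forall>u'\<in>leaf_params D. affine_parallel (P u) (P u')))"

definition surface_of_revolution :: "(real^3) set \<Rightarrow> bool" where
  "surface_of_revolution S \<longleftrightarrow> regular_surface S \<and>
     (\<exists>l. line l \<and> (\<forall>\<phi>. mink_isometry \<phi> \<and> (\<forall>x\<in>l. \<phi> x = x) \<longrightarrow> \<phi> ` S = S))"

definition part_of_surface_of_revolution :: "(real^3) set \<Rightarrow> bool" where
  "part_of_surface_of_revolution M \<longleftrightarrow>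
     (\<exists>S. surface_of_revolution S \<and> openin (top_of_set S) M)"

end

theory Submission
  imports Defs "HOL-Computational_Algebra.Polynomial"
begin

text \<open>
After an isometry, the parallel planes are \<open>x\<^sub>3 = const\<close>, \<open>x\<^sub>1 = const\<close> or \<open>x\<^sub>2 - x\<^sub>3 = const\<close>
(\<open>circles_in_standard_planes\<close>), and each leaf is a Euclidean circle, a hyperbola or a parabola in its plane, whose centre and radius, or
coefficients, are smooth functions of the leaf parameter \<open>u\<close>.

The curvatures can be computed from any normal vector \<open>n\<close>. In the squared relation
\<open>(a H)\<^sup>2 = (c - b K)\<^sup>2\<close> all square roots disappear, and on a single leaf it becomes a
polynomial identity in the position on the conic, with coefficients that are constant on the leaf
(\<open>linear_weingarten_squared\<close>). It holds on an arc, hence identically, and its coefficients can be compared.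
This is done leaf by leaf.

Circles and hyperbolas are treated together, with a sign \<open>\<epsilon>\<close> in the metric \<open>dx\<^sup>2 + \<epsilon> dy\<^sup>2 - \<epsilon> dt\<^sup>2\<close>. Let \<open>e\<close> be the
unit vector from the centre to the point, and let \<open>h\<close> be the derivative of the height \<open>t\<close>. With the squared length \<open>W\<close> of a
normal vector, which is quadratic in \<open>e\<close>, and functions \<open>L\<close> and \<open>M\<close> that are affine in \<open>e\<close>, the identity reads
\<open>a\<^sup>2 L\<^sup>2 W = 4 (c r W\<^sup>2 + b h M)\<^sup>2\<close>. If the centre moves, \<open>W\<close> has degree 2. Then \<open>c \<noteq> 0\<close> is impossible,
because the right-hand side has degree 8 and the left-hand side degree at most 4. If \<open>c = 0\<close> and \<open>a\<close>, \<open>b\<close>, \<open>h\<close> are nonzero, it follows that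
\<open>L = 0\<close> and \<open>M = 0\<close>, which contradicts that \<open>r M - L\<close> is \<open>h\<close> times a positive quantity. So the centre stays on a line, and the surface is rotational
(\<open>centre_stationary\<close>), unless \<open>c = 0\<close> and \<open>h\<close> has a zero. In that case the identity bounds the derivative of \<open>h\<close> by a multiple of
\<open>\<bar>h\<bar>\<close> near the zero, \<open>h\<close> vanishes identically, and the surface lies in a plane (\<open>height_speed_dichotomy\<close>).

A parabola is a graph \<open>z = A x\<^sup>2 + B x + C\<close> in null coordinates, where \<open>A\<close>, \<open>B\<close>, \<open>C\<close> are functions of \<open>y\<close>. The comparison of
coefficients yields \<open>A' = A\<^sup>2\<close> and \<open>B' = A B\<close> (\<open>curvature_law\<close>, \<open>vertex_law\<close>), which integrate to
\<open>A = - 1 / (y - y0)\<close> and \<open>B / A = const\<close>: the leaves are orbits of the rotations about a lightlike line.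

In the rotational cases, the ambient surface of revolution consists of all points that have the same products with the axis
direction and with themselves, relative to a point of the axis, as some point of the given surface. It is regular because it
is locally a graph over a plane along a direction that is not spacelike (\<open>part_of_surface_of_revolutionI\<close>).
\<close>

section \<open>Partial derivatives and smooth maps\<close>

definition pd :: "2 \<Rightarrow> (real^2 \<Rightarrow> 'b::real_normed_vector) \<Rightarrow> real^2 \<Rightarrow> 'b" where
  "pd i f p = frechet_derivative f (at p) (axis i 1)"

lemma Ck_on_Suc_imp: "Ck_on (Suc k) f U \<Longrightarrow> Ck_on k f U"
proof (induction k arbitrary: f)
  case 0
  then show ?case
    using continuous_at_imp_continuous_on[of U f] differentiable_imp_continuous_within[of f _ UNIV]
    by auto
qed auto

lemma frechet_derivative_eq_on_open:
  assumes "open U" "x \<in> U" "\<And>x. x \<in> U \<Longrightarrow> f x = g x"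
  shows "frechet_derivative f (at x) = frechet_derivative g (at x)"
proof -
  have "(f has_derivative D) (at x) \<longleftrightarrow> (g has_derivative D) (at x)" for D
    using has_derivative_transform_within_open[of f D x UNIV U g]
      has_derivative_transform_within_open[of g D x UNIV U f] assms by auto
  then show ?thesis unfolding frechet_derivative_def by simp
qed

lemma Ck_on_has_derivative:
  "Ck_on (Suc k) f U \<Longrightarrow> x \<in> U \<Longrightarrow> (f has_derivative frechet_derivative f (at x)) (at x)"
  unfolding frechet_derivative_works[symmetric] by simp

lemma Ck_on_cong:
  assumes "open U" "\<And>x. x \<in> U \<Longrightarrow> f x = g x"
  shows "Ck_on k f U \<longleftrightarrow> Ck_on k g U"
  using assms(2)
proof (induction k arbitrary: f g)
  case 0
  then show ?case by (simp cong: continuous_on_cong)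
next
  case (Suc k)
  have "f differentiable (at x) \<longleftrightarrow> g differentiable (at x)" if "x \<in> U" for x
    using has_derivative_transform_within_open[of f _ x UNIV U g]
      has_derivative_transform_within_open[of g _ x UNIV U f] that assms(1) Suc.prems
    unfolding differentiable_def by auto
  moreover have "Ck_on k (\<lambda>x. frechet_derivative f (at x) i) U
      \<longleftrightarrow> Ck_on k (\<lambda>x. frechet_derivative g (at x) i) U" for i
    by (rule Suc.IH) (simp add: frechet_derivative_eq_on_open[OF assms(1) _ Suc.prems])
  ultimately show ?case by simp
qed

lemma Ck_on_subset: "Ck_on k f U \<Longrightarrow> V \<subseteq> U \<Longrightarrow> Ck_on k f V"
proof (induction k arbitrary: f)
  case 0
  then show ?case using continuous_on_subset by auto
next
  case (Suc k)
  then show ?case by (auto simp: subset_eq)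
qed

lemma Ck_on_const: "Ck_on k (\<lambda>x. c) U"
  by (induction k arbitrary: c) auto

text \<open>The Frechet derivative is defined by a choice operator. This rule replaces it by a formula \<open>F\<close>
obtained from the calculus of derivatives, so that the closure properties below become inductions
on the order of differentiability.\<close>

lemma Ck_on_SucI:
  assumes "open U" "\<And>x. x \<in> U \<Longrightarrow> (f has_derivative F x) (at x)"
    and "\<And>i. i \<in> Basis \<Longrightarrow> Ck_on k (\<lambda>x. F x i) U"
  shows "Ck_on (Suc k) f U"
proof -
  have "frechet_derivative f (at x) = F x" if "x \<in> U" for x
    using frechet_derivative_at[OF assms(2)[OF that]] by simp
  then have "Ck_on k (\<lambda>x. frechet_derivative f (at x) i) U \<longleftrightarrow> Ck_on k (\<lambda>x. F x i) U" for i
    by (intro Ck_on_cong[OF assms(1)]) simp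
  then show ?thesis using assms(2,3) unfolding differentiable_def Ck_on.simps by blast
qed

lemma Ck_on_frechet:
  "Ck_on (Suc k) f U \<Longrightarrow> i \<in> Basis \<Longrightarrow> Ck_on k (\<lambda>x. frechet_derivative f (at x) i) U"
  by simp

lemma Ck_on_linear:
  assumes "open U" "bounded_linear L" "Ck_on k f U"
  shows "Ck_on k (\<lambda>x. L (f x)) U"
  using assms(3)
proof (induction k arbitrary: f)
  case 0
  then show ?case using assms(2) bounded_linear.continuous_on by auto
next
  case (Suc k)
  then show ?case
    by (intro Ck_on_SucI[OF assms(1) bounded_linear.has_derivative[OF assms(2)
          Ck_on_has_derivative[OF Suc.prems]]] Suc.IH Ck_on_frechet)
qed

lemma Ck_on_add:
  assumes "open U" "Ck_on k f U" "Ck_on k g U"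
  shows "Ck_on k (\<lambda>x. f x + g x) U"
  using assms(2,3)
proof (induction k arbitrary: f g)
  case 0
  then show ?case by (auto intro: continuous_on_add)
next
  case (Suc k)
  then show ?case
    by (intro Ck_on_SucI[OF assms(1) has_derivative_add[OF Ck_on_has_derivative[OF Suc.prems(1)]
          Ck_on_has_derivative[OF Suc.prems(2)]]] Suc.IH Ck_on_frechet)
qed

lemma Ck_on_mult:
  fixes f g :: "'a::euclidean_space \<Rightarrow> real"
  assumes "open U" "Ck_on k f U" "Ck_on k g U"
  shows "Ck_on k (\<lambda>x. f x * g x) U"
  using assms(2,3)
proof (induction k arbitrary: f g)
  case 0
  then show ?case by (auto intro: continuous_on_mult)
next
  case (Suc k)
  note lower = Ck_on_Suc_imp[OF Suc.prems(1)] Ck_on_Suc_imp[OF Suc.prems(2)]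
  show ?case using Suc.prems lower
    by (intro Ck_on_SucI[OF assms(1) has_derivative_mult[OF Ck_on_has_derivative[OF Suc.prems(1)]
          Ck_on_has_derivative[OF Suc.prems(2)]]] Suc.IH Ck_on_frechet Ck_on_add[OF assms(1)])
qed

lemma Ck_on_inverse:
  fixes f :: "'a::euclidean_space \<Rightarrow> real"
  assumes "open U" "Ck_on k f U" "\<And>x. x \<in> U \<Longrightarrow> f x \<noteq> 0"
  shows "Ck_on k (\<lambda>x. inverse (f x)) U"
  using assms(2)
proof (induction k)
  case 0
  then show ?case using assms(3) by (auto intro: continuous_on_inverse)
next
  case (Suc k)
  have d: "((\<lambda>x. inverse (f x)) has_derivative
      (\<lambda>h. - 1 * (inverse (f x) * frechet_derivative f (at x) h * inverse (f x)))) (at x)"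
    if "x \<in> U" for x
    using Deriv.has_derivative_inverse[OF assms(3)[OF that] Ck_on_has_derivative[OF Suc.prems that]]
    by simp
  show ?case
    using Suc.IH[OF Ck_on_Suc_imp[OF Suc.prems]] Suc.prems
    by (intro Ck_on_SucI[OF assms(1) d] Ck_on_mult[OF assms(1)] Ck_on_const Ck_on_frechet)
qed

lemma Ck_on_sqrt:
  fixes f :: "'a::euclidean_space \<Rightarrow> real"
  assumes "open U" "Ck_on k f U" "\<And>x. x \<in> U \<Longrightarrow> f x > 0"
  shows "Ck_on k (\<lambda>x. sqrt (f x)) U"
  using assms(2)
proof (induction k)
  case 0
  then show ?case by (auto intro: continuous_on_real_sqrt)
next
  case (Suc k)
  have d: "((\<lambda>x. sqrt (f x)) has_derivative
      (\<lambda>h. frechet_derivative f (at x) h * ((1/2) * inverse (sqrt (f x))))) (at x)"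
    if "x \<in> U" for x
    using has_derivative_real_sqrt[OF assms(3)[OF that] Ck_on_has_derivative[OF Suc.prems that]]
    by (simp add: field_simps)
  have "sqrt (f x) \<noteq> 0" if "x \<in> U" for x using assms(3)[OF that] by simp
  then show ?case
    using Suc.IH[OF Ck_on_Suc_imp[OF Suc.prems]] Suc.prems
    by (intro Ck_on_SucI[OF assms(1) d] Ck_on_mult[OF assms(1)] Ck_on_const Ck_on_frechet
        Ck_on_inverse[OF assms(1)])
qed

lemma smooth_subset: "smooth_map_on f U \<Longrightarrow> V \<subseteq> U \<Longrightarrow> smooth_map_on f V"
  unfolding smooth_map_on_def using Ck_on_subset by blast

lemma smooth_cong:
  "open U \<Longrightarrow> (\<And>x. x \<in> U \<Longrightarrow> f x = g x) \<Longrightarrow> smooth_map_on f U \<longleftrightarrow> smooth_map_on g U"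
  unfolding smooth_map_on_def using Ck_on_cong by blast

lemma smooth_const: "smooth_map_on (\<lambda>x. c) U"
  by (simp add: smooth_map_on_def Ck_on_const)

lemma smooth_linear:
  "open U \<Longrightarrow> bounded_linear L \<Longrightarrow> smooth_map_on f U \<Longrightarrow> smooth_map_on (\<lambda>x. L (f x)) U"
  by (simp add: smooth_map_on_def Ck_on_linear)

lemma smooth_add:
  "open U \<Longrightarrow> smooth_map_on f U \<Longrightarrow> smooth_map_on g U \<Longrightarrow> smooth_map_on (\<lambda>x. f x + g x) U"
  by (simp add: smooth_map_on_def Ck_on_add)

lemma smooth_mult:
  fixes f g :: "'a::euclidean_space \<Rightarrow> real"
  shows "open U \<Longrightarrow> smooth_map_on f U \<Longrightarrow> smooth_map_on g U \<Longrightarrow> smooth_map_on (\<lambda>x. f x * g x) U"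
  by (simp add: smooth_map_on_def Ck_on_mult)

lemma smooth_minus:
  fixes f :: "'a::euclidean_space \<Rightarrow> 'b::real_normed_vector"
  shows "open U \<Longrightarrow> smooth_map_on f U \<Longrightarrow> smooth_map_on (\<lambda>x. - f x) U"
  using smooth_linear[OF _ bounded_linear_minus[OF bounded_linear_ident]] by blast

lemma smooth_diff:
  fixes f :: "'a::euclidean_space \<Rightarrow> 'b::real_normed_vector"
  assumes "open U" "smooth_map_on f U" "smooth_map_on g U"
  shows "smooth_map_on (\<lambda>x. f x - g x) U"
  using smooth_add[OF assms(1,2) smooth_minus[OF assms(1,3)]] by simp

lemma smooth_divide:
  fixes f g :: "'a::euclidean_space \<Rightarrow> real"
  assumes "open U" "smooth_map_on f U" "smooth_map_on g U" "\<And>x. x \<in> U \<Longrightarrow> g x \<noteq> 0"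
  shows "smooth_map_on (\<lambda>x. f x / g x) U"
  unfolding divide_inverse using assms
  by (intro smooth_mult) (auto simp: smooth_map_on_def intro!: Ck_on_inverse)

lemma smooth_sqrt:
  fixes f :: "'a::euclidean_space \<Rightarrow> real"
  shows "open U \<Longrightarrow> smooth_map_on f U \<Longrightarrow> (\<And>x. x \<in> U \<Longrightarrow> f x > 0) \<Longrightarrow> smooth_map_on (\<lambda>x. sqrt (f x)) U"
  by (simp add: smooth_map_on_def Ck_on_sqrt)

lemma smooth_nth:
  fixes f :: "'a::euclidean_space \<Rightarrow> real^'n"
  shows "open U \<Longrightarrow> smooth_map_on f U \<Longrightarrow> smooth_map_on (\<lambda>x. f x $ k) U"
  using smooth_linear[OF _ bounded_linear_vec_nth] by blast

lemma smooth_power2: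
  fixes f :: "'a::euclidean_space \<Rightarrow> real"
  shows "open U \<Longrightarrow> smooth_map_on f U \<Longrightarrow> smooth_map_on (\<lambda>x. (f x)\<^sup>2) U"
  unfolding power2_eq_square by (rule smooth_mult)

lemma smooth_pd: "smooth_map_on f U \<Longrightarrow> smooth_map_on (pd i f) U"
  unfolding smooth_map_on_def
proof
  fix k assume "\<forall>k. Ck_on k f U"
  then have "Ck_on (Suc k) f U" by blast
  moreover have "axis i 1 \<in> (Basis :: (real^2) set)" by (simp add: axis_in_Basis_iff)
  ultimately show "Ck_on k (pd i f) U" by (simp add: pd_def[abs_def])
qed

lemma smooth_differentiable: "smooth_map_on f U \<Longrightarrow> p \<in> U \<Longrightarrow> f differentiable (at p)"
  unfolding smooth_map_on_def using Ck_on.simps(2)[of 0 f U] by blast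

lemma smooth_continuous: "smooth_map_on f U \<Longrightarrow> continuous_on U f"
  unfolding smooth_map_on_def using Ck_on.simps(1)[of f U] by blast

lemmas smooth_intros = smooth_const smooth_add smooth_mult smooth_minus smooth_diff smooth_divide
  smooth_sqrt smooth_nth smooth_power2 smooth_pd

lemma frechet_pd:
  fixes f :: "real^2 \<Rightarrow> 'b::real_normed_vector"
  assumes "f differentiable (at p)"
  shows "frechet_derivative f (at p) w = w$1 *\<^sub>R pd 1 f p + w$2 *\<^sub>R pd 2 f p"
proof -
  interpret linear "frechet_derivative f (at p)"
    using assms by (simp add: linear_frechet_derivative)
  have "w = w$1 *\<^sub>R axis 1 1 + w$2 *\<^sub>R axis 2 1"
    by (simp add: vec_eq_iff forall_2 axis_def)
  then have "frechet_derivative f (at p) w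
      = frechet_derivative f (at p) (w$1 *\<^sub>R axis 1 1 + w$2 *\<^sub>R axis 2 1)" by simp
  then show ?thesis unfolding pd_def by (simp only: add scaleR)
qed

lemma has_derivative_pd:
  fixes f :: "real^2 \<Rightarrow> 'b::real_normed_vector"
  assumes "f differentiable (at p)"
  shows "(f has_derivative (\<lambda>w. w$1 *\<^sub>R pd 1 f p + w$2 *\<^sub>R pd 2 f p)) (at p)"
proof -
  have "frechet_derivative f (at p) = (\<lambda>w. w$1 *\<^sub>R pd 1 f p + w$2 *\<^sub>R pd 2 f p)"
    using frechet_pd[OF assms] by auto
  then show ?thesis using assms by (simp add: frechet_derivative_works)
qed

lemma pd_eqI: "(f has_derivative f') (at p) \<Longrightarrow> pd i f p = f' (axis i 1)"
  unfolding pd_def using frechet_derivative_at[of f f' p] by simp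

lemma pd_cong: "open U \<Longrightarrow> p \<in> U \<Longrightarrow> (\<And>x. x \<in> U \<Longrightarrow> f x = g x) \<Longrightarrow> pd i f p = pd i g p"
  unfolding pd_def using frechet_derivative_eq_on_open by metis

lemma pd_const [simp]: "pd i (\<lambda>p. c) p = 0"
  by (simp add: pd_def)

lemma pd_add: "f differentiable (at p) \<Longrightarrow> g differentiable (at p) \<Longrightarrow>
    pd i (\<lambda>p. f p + g p) p = pd i f p + pd i g p"
  unfolding pd_def[of i f] pd_def[of i g] frechet_derivative_works
  by (rule pd_eqI) (auto intro!: derivative_eq_intros)

lemma pd_diff: "f differentiable (at p) \<Longrightarrow> g differentiable (at p) \<Longrightarrow>
    pd i (\<lambda>p. f p - g p) p = pd i f p - pd i g p"
  unfolding pd_def[of i f] pd_def[of i g] frechet_derivative_works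
  by (rule pd_eqI) (auto intro!: derivative_eq_intros)

lemma pd_mult:
  fixes f g :: "real^2 \<Rightarrow> real"
  shows "f differentiable (at p) \<Longrightarrow> g differentiable (at p) \<Longrightarrow>
    pd i (\<lambda>p. f p * g p) p = f p * pd i g p + pd i f p * g p"
  unfolding pd_def[of i f] pd_def[of i g] frechet_derivative_works
  by (rule pd_eqI) (auto intro!: has_derivative_mult)

lemma pd_power2:
  fixes f :: "real^2 \<Rightarrow> real"
  shows "f differentiable (at p) \<Longrightarrow> pd i (\<lambda>p. (f p)\<^sup>2) p = 2 * f p * pd i f p"
  unfolding power2_eq_square by (simp add: pd_mult)

lemma pd_linear: "bounded_linear L \<Longrightarrow> f differentiable (at p) \<Longrightarrow>
    pd i (\<lambda>p. L (f p)) p = L (pd i f p)"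
  unfolding pd_def[of i f] frechet_derivative_works
  by (rule pd_eqI) (rule bounded_linear.has_derivative)

lemma pd_nth:
  fixes f :: "real^2 \<Rightarrow> real^'n"
  shows "f differentiable (at p) \<Longrightarrow> pd i (\<lambda>p. f p $ k) p = pd i f p $ k"
  by (rule pd_linear[OF bounded_linear_vec_nth])

lemma pd_mink:
  assumes "f differentiable (at p)" "g differentiable (at p)"
  shows "pd i (\<lambda>p. mink (f p) (g p)) p = mink (pd i f p) (g p) + mink (f p) (pd i g p)"
proof -
  have d: "(\<lambda>p. f p $ k) differentiable (at p)" "(\<lambda>p. g p $ k) differentiable (at p)" for k
    by (rule differentiable_compose[OF bounded_linear_imp_differentiable[OF bounded_linear_vec_nth]],
        rule assms)+
  show ?thesis unfolding mink_def
    by (simp add: pd_add pd_diff pd_mult pd_nth d assms differentiable_add differentiable_mult)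
qed

section \<open>Curvatures from an arbitrary normal vector\<close>

lemma mink_commute: "mink x y = mink y x"
  by (simp add: mink_def algebra_simps)

lemma mink_simps:
  "mink (x + y) z = mink x z + mink y z" "mink z (x + y) = mink z x + mink z y"
  "mink (x - y) z = mink x z - mink y z" "mink z (x - y) = mink z x - mink z y"
  "mink (- x) z = - mink x z" "mink z (- x) = - mink z x"
  "mink (c *\<^sub>R x) z = c * mink x z" "mink z (c *\<^sub>R x) = c * mink z x"
  "mink 0 z = 0" "mink z 0 = 0"
  by (simp_all add: mink_def algebra_simps)

text \<open>The Gram determinant of three vectors is minus the square of their determinant, since the metric
has determinant \<open>-1\<close>; for \<open>g\<close> orthogonal to \<open>x\<close> and \<open>y\<close> it splits off the factor \<open>\<langle>g, g\<rangle>\<close>.\<close>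

lemma mink_gram_det:
  fixes x y g :: "real^3"
  defines "d \<equiv> x$1 * (y$2 * g$3 - y$3 * g$2) - x$2 * (y$1 * g$3 - y$3 * g$1)
      + x$3 * (y$1 * g$2 - y$2 * g$1)"
  assumes "mink g x = 0" "mink g y = 0"
  shows "d\<^sup>2 = - (mink x x * mink y y - (mink x y)\<^sup>2) * mink g g"
proof -
  have "- d\<^sup>2 = mink x x * mink y y * mink g g + 2 * mink x y * mink g y * mink g x
      - mink x x * (mink g y)\<^sup>2 - mink y y * (mink g x)\<^sup>2 - mink g g * (mink x y)\<^sup>2"
    unfolding d_def mink_def by algebra
  then show ?thesis using assms by (simp add: algebra_simps)
qed

text \<open>By the Gram determinant, \<open>x\<close>, \<open>y\<close>, \<open>g\<close> are linearly independent, and the metric is nondegenerate.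
The three equations for \<open>m\<close> are solved by Cramer's rule.\<close>

lemma mink_orthogonal_basis_zero:
  fixes x y g m :: "real^3"
  assumes "mink x x * mink y y - (mink x y)\<^sup>2 > 0" "mink g g = -1"
    and "mink g x = 0" "mink g y = 0"
    and m: "mink m x = 0" "mink m y = 0" "mink m g = 0"
  shows "m = 0"
proof -
  define d where "d = x$1 * (y$2 * g$3 - y$3 * g$2) - x$2 * (y$1 * g$3 - y$3 * g$1)
      + x$3 * (y$1 * g$2 - y$2 * g$1)"
  have "d\<^sup>2 > 0"
    using mink_gram_det[OF assms(3,4)] assms(1,2) unfolding d_def by simp
  then have "d \<noteq> 0" by auto
  moreover have "m$1 * d = 0" "m$2 * d = 0" "m$3 * d = 0"
    using m unfolding d_def mink_def by algebra+
  ultimately show ?thesis by (simp add: vec_eq_iff forall_3)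
qed

locale surface_with_normal =
  fixes X G :: "real^2 \<Rightarrow> real^3" and D :: "(real^2) set"
  assumes spacelike: "spacelike_surface X D"
    and normal: "unit_normal_field X D G"
begin

lemma open_D: "open D"
  using spacelike by (simp add: spacelike_surface_def)

lemma smooth_X: "smooth_map_on X D"
  using spacelike by (simp add: spacelike_surface_def immersion_on_def)

lemma smooth_G: "smooth_map_on G D"
  using normal by (simp add: unit_normal_field_def)

lemma diff_X: "p \<in> D \<Longrightarrow> X differentiable (at p)"
  using smooth_differentiable[OF smooth_X] .

lemma diff_G: "p \<in> D \<Longrightarrow> G differentiable (at p)"
  using smooth_differentiable[OF smooth_G] .

lemma diff_pd_X: "p \<in> D \<Longrightarrow> pd i X differentiable (at p)"
  using smooth_differentiable[OF smooth_pd[OF smooth_X]] .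

lemma first_form_pos:
  fixes w :: "real^2"
  assumes "p \<in> D" "w \<noteq> 0"
  shows "mink (w$1 *\<^sub>R pd 1 X p + w$2 *\<^sub>R pd 2 X p) (w$1 *\<^sub>R pd 1 X p + w$2 *\<^sub>R pd 2 X p) > 0"
proof -
  have "mink (frechet_derivative X (at p) w) (frechet_derivative X (at p) w) > 0"
    using spacelike assms unfolding spacelike_surface_def by blast
  then show ?thesis by (simp only: frechet_pd[OF diff_X[OF assms(1)]])
qed

lemma first_form_diag_pos:
  assumes "p \<in> D" shows "mink (pd i X p) (pd i X p) > 0"
  using first_form_pos[OF assms, of "axis i 1"] exhaust_2[of i]
  by (auto simp: axis_def vec_eq_iff)

lemma first_form_det_pos:
  assumes "p \<in> D"
  shows "mink (pd 1 X p) (pd 1 X p) * mink (pd 2 X p) (pd 2 X p) - (mink (pd 1 X p) (pd 2 X p))\<^sup>2 > 0"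
proof -
  let ?x = "pd 1 X p" and ?y = "pd 2 X p"
  define w :: "real^2" where "w = vector [mink ?y ?y, - mink ?x ?y]"
  have y: "mink ?y ?y > 0" using first_form_diag_pos[OF assms] .
  then have "w \<noteq> 0" by (auto simp: w_def vec_eq_iff forall_2)
  from first_form_pos[OF assms this]
  have "mink ?y ?y * (mink ?x ?x * mink ?y ?y - (mink ?x ?y)\<^sup>2) > 0"
    by (simp add: w_def mink_simps mink_commute[of ?y ?x] power2_eq_square algebra_simps)
  then show ?thesis using y by (simp add: zero_less_mult_iff)
qed

lemma mink_G_G: "p \<in> D \<Longrightarrow> mink (G p) (G p) = -1"
  using normal by (simp add: unit_normal_field_def)

lemma mink_G_pd_X: "p \<in> D \<Longrightarrow> mink (G p) (pd i X p) = 0"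
  using normal by (simp add: unit_normal_field_def pd_def)

lemma mink_G_pd_G:
  assumes "p \<in> D" shows "mink (pd i G p) (G p) = 0"
proof -
  have "pd i (\<lambda>p. mink (G p) (G p)) p = pd i (\<lambda>p. -1) p"
    by (rule pd_cong[OF open_D assms]) (simp add: mink_G_G)
  then show ?thesis using assms by (simp add: pd_mink diff_G mink_commute)
qed

text \<open>The derivative of \<open>\<langle>G, X\<^sub>j\<rangle> = 0\<close>. It moves the derivatives from the normal field to the
parametrization, which is what the explicit form of the leaves gives access to.\<close>

lemma weingarten_equation:
  assumes "p \<in> D" shows "mink (pd i G p) (pd j X p) = - mink (G p) (pd i (pd j X) p)"
proof -
  have "pd i (\<lambda>p. mink (G p) (pd j X p)) p = pd i (\<lambda>p. 0) p"
    by (rule pd_cong[OF open_D assms]) (simp add: mink_G_pd_X)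
  then show ?thesis using assms by (simp add: pd_mink diff_G diff_pd_X)
qed

lemma normal_space_line:
  assumes "p \<in> D" "mink n (pd 1 X p) = 0" "mink n (pd 2 X p) = 0"
  shows "n = (- mink n (G p)) *\<^sub>R G p"
proof -
  have "n + mink n (G p) *\<^sub>R G p = 0"
    by (rule mink_orthogonal_basis_zero[OF first_form_det_pos[OF assms(1)] mink_G_G[OF assms(1)]])
       (simp_all add: mink_G_pd_X mink_G_G assms mink_simps)
  then show ?thesis by (simp add: eq_neg_iff_add_eq_0)
qed

lemma dgauss_eq:
  assumes p: "p \<in> D"
    and S: "\<And>j. pd j G p = S$1$j *\<^sub>R pd 1 X p + S$2$j *\<^sub>R pd 2 X p"
  shows "dgauss X G p = S"
  unfolding dgauss_def
proof (rule the_equality)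
  show eq: "\<forall>w. frechet_derivative G (at p) w = frechet_derivative X (at p) (S *v w)"
    by (simp add: frechet_pd[OF diff_G[OF p]] frechet_pd[OF diff_X[OF p]] S
        matrix_vector_mult_def sum_2 algebra_simps)
  fix S' assume "\<forall>w. frechet_derivative G (at p) w = frechet_derivative X (at p) (S' *v w)"
  then have "\<forall>w. frechet_derivative X (at p) (S' *v w) = frechet_derivative X (at p) (S *v w)"
    using eq by simp
  moreover have "inj (frechet_derivative X (at p))"
    using spacelike p by (simp add: spacelike_surface_def immersion_on_def)
  ultimately have "\<forall>w. S' *v w = S *v w" by (simp add: inj_def)
  then show "S' = S" by (simp add: matrix_eq)
qed

text \<open>Any normal vector \<open>n\<close> may serve for the second fundamental form: \<open>n = c G\<close> multiplies the
coefficients \<open>L\<close> by \<open>c\<close>, while \<open>\<omega> = c\<^sup>2\<close>. Squaring the formula for \<open>H\<close> removes both the square root of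
\<open>\<omega>\<close> and the sign of the normal, so that all formulas are polynomial in the derivatives of \<open>X\<close>.\<close>

lemma curvatures_from_normal:
  assumes p: "p \<in> D" and n: "mink n (pd 1 X p) = 0" "mink n (pd 2 X p) = 0"
  defines "E \<equiv> mink (pd 1 X p) (pd 1 X p)" and "F \<equiv> mink (pd 1 X p) (pd 2 X p)"
    and "N \<equiv> mink (pd 2 X p) (pd 2 X p)" and "L \<equiv> (\<lambda>i j. mink n (pd i (pd j X) p))"
    and "\<omega> \<equiv> - mink n n"
  shows "(2 * mean_curvature X G p * (E * N - F\<^sup>2))\<^sup>2 * \<omega> = (N * L 1 1 - F * (L 1 2 + L 2 1) + E * L 2 2)\<^sup>2"
    and "gauss_curvature X G p * (E * N - F\<^sup>2) * \<omega> = L 1 1 * L 2 2 - L 1 2 * L 2 1"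
    and "\<omega> \<ge> 0"
proof -
  define d where "d = E * N - F\<^sup>2"
  have d: "d > 0" using first_form_det_pos[OF p] by (simp add: d_def E_def F_def N_def)
  define B where "B = (\<lambda>i j. mink (pd i G p) (pd j X p))"
  \<comment> \<open>The inverse of the matrix of the first fundamental form, applied to \<open>B\<close>.\<close>
  define S :: "real^2^2" where
    "S = vector [vector [(B 1 1 * N - B 1 2 * F) / d, (B 2 1 * N - B 2 2 * F) / d],
                 vector [(B 1 2 * E - B 1 1 * F) / d, (B 2 2 * E - B 2 1 * F) / d]]"
  have S: "pd j G p = S$1$j *\<^sub>R pd 1 X p + S$2$j *\<^sub>R pd 2 X p" for j
  proof -
    have s1: "S$1$j = (B j 1 * N - B j 2 * F) / d" and s2: "S$2$j = (B j 2 * E - B j 1 * F) / d"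
      using exhaust_2[of j] by (auto simp: S_def)
    have "pd j G p - (S$1$j *\<^sub>R pd 1 X p + S$2$j *\<^sub>R pd 2 X p) = 0"
    proof (rule mink_orthogonal_basis_zero[OF first_form_det_pos[OF p] mink_G_G[OF p]])
      have "S$1$j * E + S$2$j * F = B j 1"
        unfolding s1 s2 using d by (simp add: field_simps) (simp add: d_def algebra_simps power2_eq_square)
      then show "mink (pd j G p - (S$1$j *\<^sub>R pd 1 X p + S$2$j *\<^sub>R pd 2 X p)) (pd 1 X p) = 0"
        by (simp add: mink_simps B_def E_def F_def mink_commute[of "pd 2 X p" "pd 1 X p"])
      have "S$1$j * F + S$2$j * N = B j 2"
        unfolding s1 s2 using d by (simp add: field_simps) (simp add: d_def algebra_simps power2_eq_square)
      then show "mink (pd j G p - (S$1$j *\<^sub>R pd 1 X p + S$2$j *\<^sub>R pd 2 X p)) (pd 2 X p) = 0"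
        by (simp add: mink_simps B_def N_def F_def)
      show "mink (pd j G p - (S$1$j *\<^sub>R pd 1 X p + S$2$j *\<^sub>R pd 2 X p)) (G p) = 0"
        using mink_G_pd_X[OF p] mink_G_pd_G[OF p]
        by (simp add: mink_simps mink_commute[of "pd _ X p" "G p"])
    qed (simp_all add: mink_G_pd_X p)
    then show ?thesis by simp
  qed
  have dg: "dgauss X G p = S" by (rule dgauss_eq[OF p S])
  have H: "2 * mean_curvature X G p * d = B 1 1 * N - (B 1 2 + B 2 1) * F + B 2 2 * E"
    using d unfolding mean_curvature_def dg
    by (simp add: trace_def sum_2 S_def field_simps)
  have "gauss_curvature X G p * d * d = (B 1 1 * B 2 2 - B 1 2 * B 2 1) * d"
    using d unfolding gauss_curvature_def dg
    by (simp add: det_2 S_def field_simps) (simp add: d_def algebra_simps power2_eq_square)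
  then have K: "gauss_curvature X G p * d = B 1 1 * B 2 2 - B 1 2 * B 2 1"
    using d by simp
  define c where "c = - mink n (G p)"
  have nG: "n = c *\<^sub>R G p" using normal_space_line[OF p n] by (simp add: c_def)
  have L: "L i j = - c * B i j" for i j
    by (simp add: L_def nG mink_simps B_def weingarten_equation[OF p])
  have w: "\<omega> = c\<^sup>2" by (simp add: \<omega>_def nG mink_simps mink_G_G[OF p] power2_eq_square)
  show "(2 * mean_curvature X G p * (E * N - F\<^sup>2))\<^sup>2 * \<omega> = (N * L 1 1 - F * (L 1 2 + L 2 1) + E * L 2 2)\<^sup>2"
    unfolding L w d_def[symmetric] H by algebra
  show "gauss_curvature X G p * (E * N - F\<^sup>2) * \<omega> = L 1 1 * L 2 2 - L 1 2 * L 2 1"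
    unfolding L w d_def[symmetric] K by algebra
  show "\<omega> \<ge> 0" by (simp add: w)
qed

text \<open>The Weingarten relation in the form \<open>(a H)\<^sup>2 = (c - b K)\<^sup>2\<close>, multiplied by \<open>4 \<Delta>\<^sup>2 \<omega>\<^sup>2\<close> with
\<open>\<Delta> = E N - F\<^sup>2\<close>. This is the only form in which it is used.\<close>

lemma linear_weingarten_squared:
  assumes p: "p \<in> D" and n: "mink n (pd 1 X p) = 0" "mink n (pd 2 X p) = 0"
    and lw: "a * mean_curvature X G p + b * gauss_curvature X G p = c"
  defines "E \<equiv> mink (pd 1 X p) (pd 1 X p)" and "F \<equiv> mink (pd 1 X p) (pd 2 X p)"
    and "N \<equiv> mink (pd 2 X p) (pd 2 X p)" and "L \<equiv> (\<lambda>i j. mink n (pd i (pd j X) p))"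
    and "\<omega> \<equiv> - mink n n"
  shows "a\<^sup>2 * (N * L 1 1 - F * (L 1 2 + L 2 1) + E * L 2 2)\<^sup>2 * \<omega>
    = 4 * (c * (E * N - F\<^sup>2) * \<omega> - b * (L 1 1 * L 2 2 - L 1 2 * L 2 1))\<^sup>2"
proof -
  define H K where "H = mean_curvature X G p" and "K = gauss_curvature X G p"
  have cur: "(2 * H * (E * N - F\<^sup>2))\<^sup>2 * \<omega> = (N * L 1 1 - F * (L 1 2 + L 2 1) + E * L 2 2)\<^sup>2"
    "K * (E * N - F\<^sup>2) * \<omega> = L 1 1 * L 2 2 - L 1 2 * L 2 1"
    unfolding H_def K_def E_def F_def N_def L_def \<omega>_def
    by (rule curvatures_from_normal[OF p n])+
  have "a * H = c - b * K" using lw by (simp add: H_def K_def)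
  then have "(a * H)\<^sup>2 = (c - b * K)\<^sup>2" by simp
  then show ?thesis
    unfolding cur(1,2)[symmetric] by algebra
qed

end

section \<open>Functions that are constant on leaves\<close>

lemma vector_2_eq: "(vector [u, v] :: real^2) = u *\<^sub>R axis 1 1 + v *\<^sub>R axis 2 1"
  by (simp add: vec_eq_iff forall_2 axis_def)

lemma vector_2_nth: "vector [p$1, p$2] = (p :: real^2)"
  by (simp add: vec_eq_iff forall_2)

lemma continuous_on_vector_2:
  "continuous_on S (\<lambda>u. vector [u, v] :: real^2)" "continuous_on S (\<lambda>v. vector [u, v] :: real^2)"
  unfolding vector_2_eq by (intro continuous_intros)+

text \<open>Each leaf lies on one side of a separation of \<open>D\<close>, so the two sides project to disjoint open sets
that would separate the set of leaf parameters.\<close>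

lemma connected_from_leaves:
  fixes D :: "(real^2) set"
  assumes "open D" "connected (leaf_params D)" "\<And>u. connected {v. vector [u, v] \<in> D}"
  shows "connected D"
proof (rule connectedI)
  fix A B :: "(real^2) set"
  assume AB: "open A" "open B" "A \<inter> D \<noteq> {}" "B \<inter> D \<noteq> {}" "A \<inter> B \<inter> D = {}" "D \<subseteq> A \<union> B"
  define pr where "pr = (\<lambda>S::(real^2) set. \<Union>v. (\<lambda>u. vector [u, v] :: real^2) -` (S \<inter> D))"
  have pr_iff: "u \<in> pr S \<longleftrightarrow> (\<exists>v. vector [u, v] \<in> S \<inter> D)" for u S
    by (auto simp: pr_def)
  have op: "open (pr S)" if "open S" for S
    unfolding pr_def using that assms(1)
    by (auto intro!: open_vimage open_Int continuous_on_vector_2)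
  have "pr A \<inter> pr B \<inter> leaf_params D = {}"
  proof (rule ccontr)
    assume "pr A \<inter> pr B \<inter> leaf_params D \<noteq> {}"
    then obtain u where u: "u \<in> pr A" "u \<in> pr B" by blast
    have "connected {v. vector [u, v] \<in> D}" by (rule assms(3))
    moreover have "open ((\<lambda>v. vector [u, v] :: real^2) -` A)" "open ((\<lambda>v. vector [u, v] :: real^2) -` B)"
      using AB by (auto intro!: open_vimage continuous_on_vector_2)
    ultimately show False
      using connectedD[of "{v. vector [u, v] \<in> D}"
          "(\<lambda>v. vector [u, v] :: real^2) -` A" "(\<lambda>v. vector [u, v] :: real^2) -` B"]
        u AB(5,6) unfolding pr_iff by blast
  qed
  moreover have "leaf_params D \<subseteq> pr A \<union> pr B" 
  proof
    fix u assume "u \<in> leaf_params D"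
    then obtain v where v: "vector [u, v] \<in> D" unfolding leaf_params_def by blast
    then have "vector [u, v] \<in> A \<or> vector [u, v] \<in> B" using AB(6) by blast
    then show "u \<in> pr A \<union> pr B" using v unfolding Un_iff pr_iff by blast
  qed
  moreover have "pr S \<inter> leaf_params D \<noteq> {}" if "S \<inter> D \<noteq> {}" for S
  proof -
    obtain p where "p \<in> S \<inter> D" using \<open>S \<inter> D \<noteq> {}\<close> by blast
    then have "vector [p$1, p$2] \<in> S \<inter> D" by (simp only: vector_2_nth)
    then have "p$1 \<in> pr S" "p$1 \<in> leaf_params D" unfolding leaf_params_def pr_iff by blast+
    then show ?thesis by blast
  qed
  ultimately show False
    using connectedD[OF assms(2) op[OF AB(1)] op[OF AB(2)]] AB(3,4) by metis
qed

lemma has_real_derivative_along: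
  fixes f :: "real^2 \<Rightarrow> real"
  assumes "f differentiable (at (p + s *\<^sub>R axis i 1))"
  shows "((\<lambda>s. f (p + s *\<^sub>R axis i 1)) has_real_derivative pd i f (p + s *\<^sub>R axis i 1)) (at s)"
proof -
  have "((\<lambda>s. p + s *\<^sub>R axis i 1 :: real^2) has_derivative (\<lambda>s. s *\<^sub>R axis i 1)) (at s)"
    by (auto intro!: derivative_eq_intros)
  from has_derivative_compose[OF this, of f "frechet_derivative f (at (p + s *\<^sub>R axis i 1))"]
  have "((\<lambda>s. f (p + s *\<^sub>R axis i 1)) has_derivative
      (\<lambda>s'. frechet_derivative f (at (p + s *\<^sub>R axis i 1)) (s' *\<^sub>R axis i 1))) (at s)"
    using assms by (simp add: frechet_derivative_works)
  moreover have "frechet_derivative f (at (p + s *\<^sub>R axis i 1)) (s' *\<^sub>R axis i 1)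
      = pd i f (p + s *\<^sub>R axis i 1) * s'" for s'
    using linear.scaleR[OF linear_frechet_derivative[OF assms]] by (simp add: pd_def)
  ultimately show ?thesis by (simp add: has_field_derivative_def)
qed

lemma eventually_in_open_along:
  fixes p :: "'a::real_normed_vector"
  assumes "open U" "p \<in> U" shows "eventually (\<lambda>s::real. p + s *\<^sub>R e \<in> U) (nhds 0)"
proof -
  have "((\<lambda>s::real. p + s *\<^sub>R e) \<longlongrightarrow> p + 0 *\<^sub>R e) (nhds 0)"
    by (intro tendsto_intros filterlim_ident)
  then show ?thesis using assms by (auto dest!: topological_tendstoD)
qed

lemma pd_eq_along:
  fixes f g :: "real^2 \<Rightarrow> real"
  assumes "f differentiable (at p)" "g differentiable (at q)"
    and "eventually (\<lambda>s. f (p + s *\<^sub>R axis i 1) = g (q + s *\<^sub>R axis i 1)) (nhds 0)"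
  shows "pd i f p = pd i g q"
proof -
  have "((\<lambda>s. f (p + s *\<^sub>R axis i 1)) has_real_derivative pd i f p) (at 0)"
    using has_real_derivative_along[of f p 0 i] assms(1) by simp
  moreover have "((\<lambda>s. g (q + s *\<^sub>R axis i 1)) has_real_derivative pd i g q) (at 0)"
    using has_real_derivative_along[of g q 0 i] assms(2) by simp
  ultimately show ?thesis
    using DERIV_cong_ev[OF refl assms(3) refl] DERIV_unique by blast
qed

definition leafwise :: "(real^2) set \<Rightarrow> (real^2 \<Rightarrow> 'b) \<Rightarrow> bool" where
  "leafwise D f \<longleftrightarrow> (\<forall>p\<in>D. \<forall>q\<in>D. p$1 = q$1 \<longrightarrow> f p = f q)"

lemma leafwise_pd_2:
  fixes f :: "real^2 \<Rightarrow> real"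
  assumes "open D" "leafwise D f" "p \<in> D" "f differentiable (at p)"
  shows "pd 2 f p = 0"
proof -
  have "eventually (\<lambda>s. f (p + s *\<^sub>R axis 2 1) = f p) (nhds 0)"
    using eventually_in_open_along[OF assms(1,3), of "axis 2 1"]
  proof eventually_elim
    case (elim s)
    moreover have "(p + s *\<^sub>R axis 2 1 :: real^2) $ 1 = p $ 1" by (simp add: axis_def)
    ultimately show ?case using assms(2,3) unfolding leafwise_def by blast
  qed
  then have "pd 2 f p = pd 2 (\<lambda>_. f p) p"
    by (intro pd_eq_along assms) auto
  then show ?thesis by simp
qed

text \<open>At two points of one leaf, the difference quotients in direction \<open>u\<close> are eventually equal.\<close>

lemma leafwise_pd_1:
  fixes f :: "real^2 \<Rightarrow> real"
  assumes "open D" "leafwise D f" "\<And>p. p \<in> D \<Longrightarrow> f differentiable (at p)"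
  shows "leafwise D (pd 1 f)"
  unfolding leafwise_def
proof (intro ballI impI)
  fix p q :: "real^2" assume pq: "p \<in> D" "q \<in> D" "p$1 = q$1"
  show "pd 1 f p = pd 1 f q"
  proof (intro pd_eq_along assms pq)
    show "eventually (\<lambda>s. f (p + s *\<^sub>R axis 1 1) = f (q + s *\<^sub>R axis 1 1)) (nhds 0)"
      using eventually_in_open_along[OF assms(1) pq(1), of "axis 1 1"]
        eventually_in_open_along[OF assms(1) pq(2), of "axis 1 1"]
    proof eventually_elim
      case (elim s)
      moreover have "(p + s *\<^sub>R axis 1 1 :: real^2) $ 1 = (q + s *\<^sub>R axis 1 1) $ 1" using pq by simp
      ultimately show ?case using assms(2) unfolding leafwise_def by blast
    qed
  qed
qed

text \<open>The leaf is connected; a finite image of it would be a single point, and the derivative along the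
leaf would vanish. This provides the infinitely many points at which polynomial identities are
compared.\<close>

lemma infinite_on_leaf:
  fixes f :: "real^2 \<Rightarrow> real"
  assumes "open D" "\<And>u. connected {v. vector [u, v] \<in> D}" "p \<in> D"
    and df: "\<And>q. q \<in> D \<Longrightarrow> f differentiable (at q)" and nz: "pd 2 f p \<noteq> 0"
  shows "infinite (f ` {q \<in> D. q$1 = p$1})"
proof
  assume fin: "finite (f ` {q \<in> D. q$1 = p$1})"
  have "q \<in> (\<lambda>v. vector [p$1, v]) ` {v. vector [p$1, v] \<in> D}" if "q \<in> D" "q$1 = p$1" for q
  proof (rule image_eqI[of _ _ "q$2"])
    have "vector [p$1, q$2] = q" using that vector_2_nth[of q] by simp
    then show "q = vector [p$1, q$2]" "q$2 \<in> {v. vector [p$1, v] \<in> D}" using that by simp_all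
  qed
  then have "{q \<in> D. q$1 = p$1} = (\<lambda>v. vector [p$1, v]) ` {v. vector [p$1, v] \<in> D}"
    by auto
  moreover have "connected ((\<lambda>v. vector [p$1, v] :: real^2) ` {v. vector [p$1, v] \<in> D})"
    by (intro connected_continuous_image continuous_on_vector_2 assms(2))
  ultimately have "connected {q \<in> D. q$1 = p$1}" by simp
  moreover have "continuous_on {q \<in> D. q$1 = p$1} f"
    using df by (intro continuous_at_imp_continuous_on) (auto intro: differentiable_imp_continuous_within)
  ultimately have "connected (f ` {q \<in> D. q$1 = p$1})"
    by (intro connected_continuous_image)
  then obtain c where c: "f ` {q \<in> D. q$1 = p$1} \<subseteq> {c}"
    using fin connected_finite_iff_sing[of "f ` {q \<in> D. q$1 = p$1}"] by auto
  have "eventually (\<lambda>s. f (p + s *\<^sub>R axis 2 1) = c) (nhds 0)"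
    using eventually_in_open_along[OF assms(1,3), of "axis 2 1"]
    by eventually_elim (use c in \<open>auto simp: axis_def image_subset_iff\<close>)
  then have "pd 2 f p = pd 2 (\<lambda>_. c) p"
    by (intro pd_eq_along df assms) auto
  then show False using nz by simp
qed

lemma constant_if_pd_zero:
  fixes f :: "real^2 \<Rightarrow> real"
  assumes "open D" "connected D" "\<And>p. p \<in> D \<Longrightarrow> f differentiable (at p)"
    and "\<And>p i. p \<in> D \<Longrightarrow> pd i f p = 0" and "p \<in> D" "q \<in> D"
  shows "f p = f q"
proof (rule has_derivative_zero_unique_connected[OF assms(1,2) _ assms(5,6)])
  fix x assume "x \<in> D"
  then show "(f has_derivative (\<lambda>x. 0)) (at x)"
    using has_derivative_pd[OF assms(3)] assms(4) by simp
qed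

text \<open>The function descends to the interval of leaf parameters, where Rolle's theorem excludes equal values
at different parameters.\<close>

lemma leafwise_injective:
  fixes f :: "real^2 \<Rightarrow> real"
  assumes "open D" "connected (leaf_params D)" "leafwise D f"
    and df: "\<And>p. p \<in> D \<Longrightarrow> f differentiable (at p)" and nz: "\<And>p. p \<in> D \<Longrightarrow> pd 1 f p \<noteq> 0"
    and pq: "p \<in> D" "q \<in> D" "f p = f q"
  shows "p$1 = q$1"
proof -
  define k where "k = (\<lambda>u. f (SOME p. p \<in> D \<and> p$1 = u))"
  have k: "k (x$1) = f x" if "x \<in> D" for x
  proof -
    have "(SOME p. p \<in> D \<and> p$1 = x$1) \<in> D \<and> (SOME p. p \<in> D \<and> p$1 = x$1) $ 1 = x$1"
      by (rule someI[of "\<lambda>p. p \<in> D \<and> p$1 = x$1" x]) (simp add: that)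
    then show ?thesis using that assms(3) unfolding k_def leafwise_def by blast
  qed
  have lp: "u \<in> leaf_params D \<longleftrightarrow> (\<exists>p\<in>D. p$1 = u)" for u
  proof
    assume "u \<in> leaf_params D"
    then obtain v where "vector [u, v] \<in> D" by (auto simp: leaf_params_def)
    then show "\<exists>p\<in>D. p$1 = u" by (intro bexI[of _ "vector [u, v]"]) simp_all
  next
    assume "\<exists>p\<in>D. p$1 = u"
    then obtain p where "p \<in> D" "p$1 = u" by blast
    then have "vector [u, p$2] \<in> D" using vector_2_nth[of p] by simp
    then show "u \<in> leaf_params D" unfolding leaf_params_def by blast
  qed
  have dk: "\<exists>m. (k has_real_derivative m) (at u) \<and> m \<noteq> 0" if "u \<in> leaf_params D" for u
  proof -
    obtain x where x: "x \<in> D" "x$1 = u" using \<open>u \<in> leaf_params D\<close> lp by blast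
    have "((\<lambda>s. f (x + s *\<^sub>R axis 1 1)) has_real_derivative pd 1 f x) (at 0)"
      using has_real_derivative_along[of f x 0 1] df x by simp
    moreover have "eventually (\<lambda>s. f (x + s *\<^sub>R axis 1 1) = k (u + s)) (nhds 0)"
      using eventually_in_open_along[OF assms(1) x(1), of "axis 1 1"]
    proof eventually_elim
      case (elim s)
      have "(x + s *\<^sub>R axis 1 1)$1 = u + s" using x by (simp add: axis_def)
      then show ?case using k[OF elim] by simp
    qed
    ultimately have "((\<lambda>s. k (u + s)) has_real_derivative pd 1 f x) (at 0)"
      using DERIV_cong_ev[of 0 0 "\<lambda>s. f (x + s *\<^sub>R axis 1 1)" "\<lambda>s. k (u + s)"] by simp
    then have "(k has_real_derivative pd 1 f x) (at u)"
      using DERIV_shift[of k "pd 1 f x" 0 u] by (simp add: add.commute)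
    then show ?thesis using nz x by blast
  qed
  have False if "u < u'" "u \<in> leaf_params D" "u' \<in> leaf_params D" "k u = k u'" for u u'
  proof -
    have sub: "{u..u'} \<subseteq> leaf_params D"
      using assms(2) that connected_contains_Icc by blast
    have "\<exists>z. u < z \<and> z < u' \<and> DERIV k z :> 0"
    proof (rule Rolle[OF that(1,4)])
      show "continuous_on {u..u'} k"
      proof (rule continuous_at_imp_continuous_on, rule ballI)
        fix x assume "x \<in> {u..u'}"
        then show "isCont k x" using dk[of x] sub DERIV_isCont by blast
      qed
      show "k differentiable (at x)" if "u < x" "x < u'" for x
      proof -
        have "x \<in> leaf_params D" using sub that by auto
        then show ?thesis using dk[of x] unfolding real_differentiable_def by blast
      qed
    qed
    then obtain z where z: "u < z" "z < u'" "DERIV k z :> 0" by blast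
    then have "z \<in> leaf_params D" using sub by auto
    then show False using dk[of z] z(3) DERIV_unique by blast
  qed
  moreover have "p$1 \<in> leaf_params D" "q$1 \<in> leaf_params D" "k (p$1) = k (q$1)"
    using pq k lp by auto
  ultimately show ?thesis using linorder_less_linear[of "p$1" "q$1"] by metis
qed

section \<open>Polynomial identities on lines and conics\<close>

lemma poly_eq_on_infinite:
  fixes P Q :: "'a::idom poly"
  assumes "infinite Z" "\<And>x. x \<in> Z \<Longrightarrow> poly P x = poly Q x"
  shows "P = Q"
proof (rule ccontr)
  assume "P \<noteq> Q"
  then have "finite {x. poly (P - Q) x = 0}" by (intro poly_roots_finite) simp
  moreover have "Z \<subseteq> {x. poly (P - Q) x = 0}" using assms(2) by auto
  ultimately show False using assms(1) finite_subset by blast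
qed

text \<open>With \<open>C \<noteq> 0\<close>, the right-hand side would have degree 16, while the left-hand side has degree at
most 12.\<close>

lemma quadratic_leading_coeff_cancel:
  fixes P M L :: "'a::{idom,ring_char_0} poly"
  assumes P: "degree P = 2" and L: "degree L \<le> 2" and M: "degree M \<le> 2"
    and eq: "smult k (L\<^sup>2 * (P\<^sup>2 - smult h [:0, 0, 1:]) * [:0, 0, 0, 0, 1:])
      = (smult C ((P\<^sup>2 - smult h [:0, 0, 1:])\<^sup>2) + smult B ([:0, 0, 0, 1:] * M))\<^sup>2"
  shows "C = 0"
proof (rule ccontr)
  assume C: "C \<noteq> 0"
  define W where "W = P\<^sup>2 - smult h [:0, 0, 1:]"
  have "P \<noteq> 0" using P by auto
  have h2: "degree (smult h [:0, 0, 1:]) \<le> 2" by (rule order_trans[OF degree_smult_le]) simp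
  have "degree (P\<^sup>2) = 4" using P \<open>P \<noteq> 0\<close> by (simp add: degree_power_eq)
  moreover have "W = P\<^sup>2 + - smult h [:0, 0, 1:]" by (simp only: W_def diff_conv_add_uminus)
  moreover have "degree (- smult h [:0, 0, 1:]) < 4" using h2 by (simp only: degree_minus)
  ultimately have W: "degree W = 4" by (simp only: degree_add_eq_left)
  then have "W \<noteq> 0" by auto
  have l: "degree (smult k (L\<^sup>2 * W * [:0, 0, 0, 0, 1:])) \<le> 12"
  proof -
    have "degree (L\<^sup>2) \<le> 4" using degree_power_le[of L 2] L by simp
    then have "degree (L\<^sup>2 * W) \<le> 8" using degree_mult_le[of "L\<^sup>2" W] W by simp
    then have "degree (L\<^sup>2 * W * [:0, 0, 0, 0, 1:]) \<le> 12"
      using degree_mult_le[of "L\<^sup>2 * W" "[:0, 0, 0, 0, 1:]"] by simp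
    then show ?thesis using degree_smult_le order_trans by blast
  qed
  have "degree (smult C (W\<^sup>2)) = 8" using C W \<open>W \<noteq> 0\<close> by (simp add: degree_power_eq)
  moreover have "degree (smult B ([:0, 0, 0, 1:] * M)) \<le> 5"
  proof -
    have "degree ([:0, 0, 0, 1:] * M) \<le> 5" using degree_mult_le[of "[:0, 0, 0, 1:]" M] M by simp
    then show ?thesis using degree_smult_le order_trans by blast
  qed
  ultimately have r: "degree (smult C (W\<^sup>2) + smult B ([:0, 0, 0, 1:] * M)) = 8"
    by (subst degree_add_eq_left) auto
  then have "smult C (W\<^sup>2) + smult B ([:0, 0, 0, 1:] * M) \<noteq> 0" by auto
  then have "degree ((smult C (W\<^sup>2) + smult B ([:0, 0, 0, 1:] * M))\<^sup>2) = 16"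
    using r by (simp add: degree_power_eq)
  then show False using l unfolding eq[folded W_def, symmetric] by linarith
qed

text \<open>For lightlike planes, \<open>x\<close> is the coordinate along the leaf, translated such that the quadratic
polynomial \<open>D = \<delta> x\<^sup>2 + \<kappa>\<close> (the squared length of the normal vector, up to a factor) has no linear
term. Degree 8 gives \<open>c = 0\<close> if \<open>\<delta> \<noteq> 0\<close>; degree 6 then gives \<open>n2 = 0\<close>. If also \<open>n1 = 0\<close>, the
remaining coefficients force \<open>\<delta> = - A\<^sup>2\<close> and \<open>\<kappa> = 0\<close>, against \<open>D > 0\<close>; if \<open>n1 \<noteq> 0\<close>, they are
inconsistent.\<close>

lemma lightlike_leading:
  fixes A a b c n0 n1 n2 \<delta> \<kappa> :: real
  assumes Z: "infinite Z" and A: "A \<noteq> 0" and nt: "c \<noteq> 0 \<or> (a \<noteq> 0 \<and> b \<noteq> 0)"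
    and pos: "\<And>x. x \<in> Z \<Longrightarrow> \<delta> * x\<^sup>2 + \<kappa> > 0"
    and eq: "\<And>x. x \<in> Z \<Longrightarrow> a\<^sup>2 * (n2 * x\<^sup>2 + n1 * x + n0)\<^sup>2 * (\<delta> * x\<^sup>2 + \<kappa>)
      = (4 * c * (\<delta> * x\<^sup>2 + \<kappa>)\<^sup>2
          - b * (2 * A * (n2 * x\<^sup>2 + n1 * x + n0) - 4 * A\<^sup>2 * (\<delta> * x\<^sup>2 + \<kappa>) - (2 * \<delta> * x)\<^sup>2))\<^sup>2"
  shows "\<delta> = 0"
proof (rule ccontr)
  assume d: "\<delta> \<noteq> 0"
  define p0 p2 p4 where "p0 = 4*c*\<kappa>\<^sup>2 - b*(2*A*n0 - 4*A\<^sup>2*\<kappa>)"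
    and "p2 = 8*c*\<delta>*\<kappa> - b*(2*A*n2 - 4*A\<^sup>2*\<delta> - 4*\<delta>\<^sup>2)" and "p4 = 4*c*\<delta>\<^sup>2"
  define q1 where "q1 = - 2*b*A*n1"
  define PL where "PL = smult (a\<^sup>2) ([:n0, n1, n2:]\<^sup>2 * [:\<kappa>, 0, \<delta>:])"
  define PR where "PR = [:p0, q1, p2, 0, p4:]\<^sup>2"
  have "PL = PR"
  proof (rule poly_eq_on_infinite[OF Z])
    fix x assume "x \<in> Z"
    show "poly PL x = poly PR x"
      using eq[OF \<open>x \<in> Z\<close>] unfolding PL_def PR_def p0_def p2_def p4_def q1_def
      by (simp add: power2_eq_square algebra_simps)
  qed
  then have cf: "poly.coeff PL i = poly.coeff PR i" for i by simp
  note ev = PL_def PR_def power2_eq_square coeff_pCons numeral_eq_Suc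
  have c8: "p4 * p4 = 0" using cf[of 8] by (simp add: ev)
  have c: "c = 0" using c8 d by (simp add: p4_def)
  then have ab: "a \<noteq> 0" "b \<noteq> 0" using nt by auto
  have p4: "p4 = 0" using c8 by simp
  have "a\<^sup>2 * (n2\<^sup>2 * \<delta>) = 0" using cf[of 6] by (auto simp: ev p4)
  then have n2: "n2 = 0" using ab d by simp
  define h where "h = 4 * \<delta> * (A\<^sup>2 + \<delta>)"
  define m where "m = 2*A*n0 - 4*A\<^sup>2*\<kappa>"
  have pp: "p0 = - b * m" "p2 = b * h" "q1 = - 2*b*A*n1"
    by (simp_all add: p0_def p2_def q1_def m_def h_def c n2 power2_eq_square algebra_simps)
  have x4: "a\<^sup>2 * n1\<^sup>2 * \<delta> = b\<^sup>2 * h\<^sup>2"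
    using cf[of 4] by (simp add: ev p4 n2 pp algebra_simps)
  have x3: "a\<^sup>2 * n1 * n0 * \<delta> = - 2 * b\<^sup>2 * A * n1 * h"
    using cf[of 3] by (simp add: ev p4 n2 pp algebra_simps)
  have x2: "a\<^sup>2 * (n0\<^sup>2 * \<delta> + n1\<^sup>2 * \<kappa>) = b\<^sup>2 * (4 * A\<^sup>2 * n1\<^sup>2 - 2 * m * h)"
    using cf[of 2] by (simp add: ev p4 n2 pp algebra_simps)
  have x1: "a\<^sup>2 * n0 * n1 * \<kappa> = 2 * b\<^sup>2 * A * n1 * m"
    using cf[of 1] by (simp add: ev p4 n2 pp algebra_simps)
  have x0: "a\<^sup>2 * n0\<^sup>2 * \<kappa> = b\<^sup>2 * m\<^sup>2"
    using cf[of 0] by (simp add: ev p4 n2 pp algebra_simps)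
  obtain z where "z \<in> Z" using Z by fastforce
  show False
  proof (cases "n1 = 0")
    case True
    then have h: "h = 0" using x4 ab by simp
    then have dA: "\<delta> = - A\<^sup>2" using d by (simp add: h_def)
    have "n0 = 0" using x2 True h d ab by simp
    then have "m = 0" using x0 ab by simp
    then have "\<kappa> = 0" using \<open>n0 = 0\<close> A by (simp add: m_def)
    then have "\<delta> * z\<^sup>2 + \<kappa> = - ((A * z)\<^sup>2)" using dA by (simp add: power_mult_distrib)
    then show False using pos[OF \<open>z \<in> Z\<close>] zero_le_power2[of "A * z"] by linarith
  next
    case False
    have "b\<^sup>2 * h\<^sup>2 \<noteq> 0" using x4[symmetric] False ab d by simp
    then have h: "h \<noteq> 0" by simp
    have x3': "a\<^sup>2 * n0 * \<delta> = - 2 * b\<^sup>2 * A * h"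
    proof -
      have "n1 * (a\<^sup>2 * n0 * \<delta> - - 2 * b\<^sup>2 * A * h) = 0" using x3 by algebra
      then show ?thesis using False unfolding mult_eq_0_iff by simp
    qed
    then have n0: "n0 \<noteq> 0" using ab A h by auto
    have x1': "a\<^sup>2 * n0 * \<kappa> = 2 * b\<^sup>2 * A * m"
    proof -
      have "n1 * (a\<^sup>2 * n0 * \<kappa> - 2 * b\<^sup>2 * A * m) = 0" using x1 by algebra
      then show ?thesis using False unfolding mult_eq_0_iff by simp
    qed
    have "m * (m - 2 * A * n0) = 0"
    proof -
      have "b\<^sup>2 * (m * (m - 2 * A * n0)) = 0" using x0 x1' by algebra
      then show ?thesis using ab by simp
    qed
    then have "\<kappa> = 0"
    proof (cases "m = 0")
      case True
      then show ?thesis using x1' ab n0 by simp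
    next
      case False
      then have "m = 2 * A * n0" using \<open>m * (m - 2 * A * n0) = 0\<close> by simp
      then show ?thesis using A by (simp add: m_def)
    qed
    then have "m = 0" using x1' ab A by simp
    then show False using \<open>\<kappa> = 0\<close> n0 A by (simp add: m_def)
  qed
qed

text \<open>The same comparison when \<open>D\<close> and the mean curvature polynomial are linear: \<open>x\<close> is translated such
that \<open>D = \<delta> x\<close>. Degrees 4, 3 and 2 give in turn \<open>c = 0\<close>, \<open>n1 = 0\<close> and a contradiction.\<close>

lemma lightlike_linear:
  fixes A a b c n0 n1 \<delta> :: real
  assumes Z: "infinite Z" and A: "A \<noteq> 0" and nt: "c \<noteq> 0 \<or> (a \<noteq> 0 \<and> b \<noteq> 0)"
    and eq: "\<And>x. x \<in> Z \<Longrightarrow> a\<^sup>2 * (n1 * x + n0)\<^sup>2 * (\<delta> * x)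
      = (4 * c * (\<delta> * x)\<^sup>2 - b * (2 * A * (n1 * x + n0) - 4 * A\<^sup>2 * (\<delta> * x) - \<delta>\<^sup>2))\<^sup>2"
  shows "\<delta> = 0"
proof (rule ccontr)
  assume d: "\<delta> \<noteq> 0"
  define p0 p1 p2 where "p0 = - b*(2*A*n0 - \<delta>\<^sup>2)" and "p1 = - b*(2*A*n1 - 4*A\<^sup>2*\<delta>)"
    and "p2 = 4*c*\<delta>\<^sup>2"
  define PL where "PL = smult (a\<^sup>2) ([:n0, n1:]\<^sup>2 * [:0, \<delta>:])"
  define PR where "PR = [:p0, p1, p2:]\<^sup>2"
  have "PL = PR"
  proof (rule poly_eq_on_infinite[OF Z])
    fix x assume "x \<in> Z"
    show "poly PL x = poly PR x"
      using eq[OF \<open>x \<in> Z\<close>] unfolding PL_def PR_def p0_def p1_def p2_def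
      by (simp add: power2_eq_square algebra_simps)
  qed
  then have cf: "poly.coeff PL i = poly.coeff PR i" for i by simp
  note ev = PL_def PR_def power2_eq_square coeff_pCons numeral_eq_Suc
  have p2: "p2 = 0" using cf[of 4] by (simp add: ev)
  then have c: "c = 0" using d by (simp add: p2_def)
  then have ab: "a \<noteq> 0" "b \<noteq> 0" using nt by auto
  have "a\<^sup>2 * (n1\<^sup>2 * \<delta>) = 0" using cf[of 3] by (auto simp: ev p2)
  then have n1: "n1 = 0" using ab d by simp
  have "p1 = 0" using cf[of 2] by (simp add: ev p2 n1)
  then show False using n1 ab A d by (simp add: p1_def)
qed

text \<open>With \<open>\<iota>\<^sup>2 = - \<epsilon>\<close>, the conic \<open>x\<^sup>2 + \<epsilon> y\<^sup>2 = \<epsilon>\<close> has the rational parameter \<open>z = x + \<iota> y\<close>, for which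
\<open>x - \<iota> y = \<epsilon> / z\<close>. Here \<open>\<iota>\<close> is the imaginary unit for the circle (\<open>\<epsilon> = 1\<close>), and \<open>1\<close> or \<open>-1\<close> for
the hyperbola. The polynomial is \<open>z (f0 + f1 x + f2 y)\<close>, written in \<open>z\<close>.\<close>

definition conic_poly :: "'a::real_field \<Rightarrow> real \<Rightarrow> real \<Rightarrow> real \<Rightarrow> real \<Rightarrow> 'a poly" where
  "conic_poly \<iota> \<epsilon> f0 f1 f2 = [: of_real \<epsilon> * (of_real f1 - of_real f2 / \<iota>) / 2, of_real f0,
      (of_real f1 + of_real f2 / \<iota>) / 2 :]"

lemma poly_conic_poly:
  assumes i: "\<iota>\<^sup>2 = - of_real \<epsilon>" and e: "\<epsilon>\<^sup>2 = 1" and c: "x\<^sup>2 + \<epsilon> * y\<^sup>2 = \<epsilon>"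
  shows "poly (conic_poly \<iota> \<epsilon> f0 f1 f2) (of_real x + \<iota> * of_real y)
    = (of_real x + \<iota> * of_real y) * of_real (f0 + f1 * x + f2 * y)"
proof -
  have "\<epsilon> \<noteq> 0" using e by auto
  then have i0: "\<iota> \<noteq> 0" using i by auto
  define z w where "z = of_real x + \<iota> * of_real y" and "w = of_real x - \<iota> * of_real y"
  have "z * w = of_real (x\<^sup>2) - \<iota>\<^sup>2 * of_real (y\<^sup>2)"
    unfolding z_def w_def by (simp add: power2_eq_square algebra_simps)
  also have "\<dots> = of_real (x\<^sup>2 + \<epsilon> * y\<^sup>2)" unfolding i by simp
  finally have zw: "of_real \<epsilon> = z * w" using c by simp
  have x: "of_real x = (z + w) / 2" and y: "of_real y = (z - w) / (2 * \<iota>)"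
    using i0 by (simp_all add: z_def w_def)
  have "poly (conic_poly \<iota> \<epsilon> f0 f1 f2) z = z * (of_real f0 + of_real f1 * ((z + w) / 2)
      + of_real f2 * ((z - w) / (2 * \<iota>)))"
    unfolding conic_poly_def zw using i0 by (simp add: field_simps)
  then show ?thesis unfolding x[symmetric] y[symmetric] z_def[symmetric] by simp
qed

text \<open>The parameter \<open>z\<close> determines the point, because \<open>x - \<iota> y = \<epsilon> / z\<close>.\<close>

lemma infinite_conic_parameters:
  fixes \<iota> :: "'a::real_field"
  assumes i: "\<iota>\<^sup>2 = - of_real \<epsilon>" and e: "\<epsilon>\<^sup>2 = 1" and "infinite Z"
    and c: "\<And>x y. (x, y) \<in> Z \<Longrightarrow> x\<^sup>2 + \<epsilon> * y\<^sup>2 = \<epsilon>"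
  shows "infinite ((\<lambda>(x, y). of_real x + \<iota> * of_real y) ` Z)"
proof -
  have "\<epsilon> \<noteq> 0" using e by auto
  then have i0: "\<iota> \<noteq> 0" using i by auto
  have "inj_on (\<lambda>(x, y). of_real x + \<iota> * of_real y) Z"
  proof (rule inj_onI, clarify)
    fix x y x' y' assume Z: "(x, y) \<in> Z" "(x', y') \<in> Z"
      and eq: "of_real x + \<iota> * of_real y = of_real x' + \<iota> * of_real y'"
    have prod: "(of_real s + \<iota> * of_real t) * (of_real s - \<iota> * of_real t) = of_real \<epsilon>"
      if "(s, t) \<in> Z" for s t
    proof -
      have "(of_real s + \<iota> * of_real t) * (of_real s - \<iota> * of_real t)
          = of_real (s\<^sup>2) - \<iota>\<^sup>2 * of_real (t\<^sup>2)"
        by (simp add: power2_eq_square algebra_simps)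
      also have "\<dots> = of_real (s\<^sup>2 + \<epsilon> * t\<^sup>2)" unfolding i by simp
      finally show ?thesis using c[OF that] by simp
    qed
    have "of_real x + \<iota> * of_real y \<noteq> 0" using prod[OF Z(1)] \<open>\<epsilon> \<noteq> 0\<close> by auto
    then have "of_real x - \<iota> * of_real y = of_real x' - \<iota> * of_real y'"
      using prod[OF Z(1)] prod[OF Z(2)] eq by (metis mult_left_cancel)
    with eq have "2 * of_real x = (2 * of_real x' :: 'a)" "2 * \<iota> * of_real y = 2 * \<iota> * of_real y'"
      by algebra+
    then show "x = x' \<and> y = y'" using i0 by simp
  qed
  then show ?thesis using assms(3) finite_imageD by blast
qed

text \<open>Here \<open>L\<close>, \<open>p\<close>, \<open>M\<close> are affine functions on the conic and \<open>W = \<epsilon> (p\<^sup>2 - h\<^sup>2)\<close>. The term \<open>c r W\<^sup>2\<close> has the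
highest degree in \<open>z\<close> unless the coefficient of \<open>z\<^sup>2\<close> in \<open>z p\<close> vanishes.\<close>

lemma conic_leading_zero:
  fixes \<epsilon> a b c r h r1 p1 p2 l0 l1 l2 m0 m1 m2 :: real and \<iota> :: "'a::real_field"
  assumes i: "\<iota>\<^sup>2 = - of_real \<epsilon>" and e: "\<epsilon>\<^sup>2 = 1" and Z: "infinite Z"
    and cn: "\<And>x y. (x, y) \<in> Z \<Longrightarrow> x\<^sup>2 + \<epsilon> * y\<^sup>2 = \<epsilon>"
    and eq: "\<And>x y. (x, y) \<in> Z \<Longrightarrow>
      a\<^sup>2 * (l0 + l1 * x + l2 * y)\<^sup>2 * (\<epsilon> * ((r1 + p1 * x + p2 * y)\<^sup>2 - h\<^sup>2))
      = 4 * (c * r * (\<epsilon> * ((r1 + p1 * x + p2 * y)\<^sup>2 - h\<^sup>2))\<^sup>2 + b * h * (m0 + m1 * x + m2 * y))\<^sup>2"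
    and cr: "c * r \<noteq> 0"
  shows "of_real p1 + of_real p2 / \<iota> = 0"
proof (rule ccontr)
  assume nz: "of_real p1 + of_real p2 / \<iota> \<noteq> 0"
  define P L M where "P = conic_poly \<iota> \<epsilon> r1 p1 p2" and "L = conic_poly \<iota> \<epsilon> l0 l1 l2"
    and "M = conic_poly \<iota> \<epsilon> m0 m1 m2"
  have "degree P = 2" using nz by (simp add: P_def conic_poly_def)
  moreover have "degree L \<le> 2" "degree M \<le> 2" by (simp_all add: L_def M_def conic_poly_def)
  moreover have "smult (of_real (a\<^sup>2 * \<epsilon>)) (L\<^sup>2 * (P\<^sup>2 - smult (of_real (h\<^sup>2)) [:0, 0, 1:]) * [:0, 0, 0, 0, 1:])
      = (smult (of_real (2 * c * r)) ((P\<^sup>2 - smult (of_real (h\<^sup>2)) [:0, 0, 1:])\<^sup>2)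
         + smult (of_real (2 * b * h)) ([:0, 0, 0, 1:] * M))\<^sup>2"
  proof (rule poly_eq_on_infinite[OF infinite_conic_parameters[OF i e Z cn]])
    fix z assume "z \<in> (\<lambda>(x, y). of_real x + \<iota> * of_real y) ` Z"
    then obtain x y where xy: "(x, y) \<in> Z" and z: "z = of_real x + \<iota> * of_real y" by auto
    define l p m where "l = l0 + l1 * x + l2 * y" and "p = r1 + p1 * x + p2 * y"
      and "m = m0 + m1 * x + m2 * y"
    have ev: "poly P z = z * of_real p" "poly L z = z * of_real l" "poly M z = z * of_real m"
      unfolding P_def L_def M_def z l_def p_def m_def by (rule poly_conic_poly[OF i e cn[OF xy]])+
    have "a\<^sup>2 * l\<^sup>2 * (\<epsilon> * (p\<^sup>2 - h\<^sup>2)) = (2 * c * r * (p\<^sup>2 - h\<^sup>2)\<^sup>2 + 2 * b * h * m)\<^sup>2"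
      using eq[OF xy, folded l_def p_def m_def] e by algebra
    then have "of_real (a\<^sup>2 * l\<^sup>2 * (\<epsilon> * (p\<^sup>2 - h\<^sup>2)))
        = (of_real ((2 * c * r * (p\<^sup>2 - h\<^sup>2)\<^sup>2 + 2 * b * h * m)\<^sup>2) :: 'a)" by simp
    then have "of_real (a\<^sup>2 * \<epsilon>) * ((z * of_real l)\<^sup>2 * ((z * of_real p)\<^sup>2 - of_real (h\<^sup>2) * z\<^sup>2) * z^4)
        = (of_real (2 * c * r) * ((z * of_real p)\<^sup>2 - of_real (h\<^sup>2) * z\<^sup>2)\<^sup>2
          + of_real (2 * b * h) * (z^3 * (z * of_real m)))\<^sup>2"
      unfolding of_real_mult of_real_add of_real_diff of_real_power by algebra
    then show "poly (smult (of_real (a\<^sup>2 * \<epsilon>)) (L\<^sup>2 * (P\<^sup>2 - smult (of_real (h\<^sup>2)) [:0, 0, 1:]) * [:0, 0, 0, 0, 1:])) z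
      = poly ((smult (of_real (2 * c * r)) ((P\<^sup>2 - smult (of_real (h\<^sup>2)) [:0, 0, 1:])\<^sup>2)
         + smult (of_real (2 * b * h)) ([:0, 0, 0, 1:] * M))\<^sup>2) z"
      by (simp add: ev power2_eq_square power3_eq_cube power4_eq_xxxx algebra_simps)
  qed
  ultimately have "of_real (2 * c * r) = (0::'a)" by (rule quadratic_leading_coeff_cancel)
  then show False using cr by simp
qed

text \<open>The case \<open>c = 0\<close> of the relation, as an identity of polynomials in \<open>z\<close>.\<close>

lemma conic_poly_homogeneous:
  fixes \<epsilon> a k h r1 p1 p2 l0 l1 l2 m0 m1 m2 :: real and \<iota> :: "'a::real_field"
  assumes i: "\<iota>\<^sup>2 = - of_real \<epsilon>" and e: "\<epsilon>\<^sup>2 = 1" and Z: "infinite Z"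
    and cn: "\<And>x y. (x, y) \<in> Z \<Longrightarrow> x\<^sup>2 + \<epsilon> * y\<^sup>2 = \<epsilon>"
    and eq: "\<And>x y. (x, y) \<in> Z \<Longrightarrow>
      a\<^sup>2 * (l0 + l1 * x + l2 * y)\<^sup>2 * (\<epsilon> * ((r1 + p1 * x + p2 * y)\<^sup>2 - h\<^sup>2))
      = k * (m0 + m1 * x + m2 * y)\<^sup>2"
  defines "P \<equiv> conic_poly \<iota> \<epsilon> r1 p1 p2" and "L \<equiv> conic_poly \<iota> \<epsilon> l0 l1 l2"
    and "M \<equiv> conic_poly \<iota> \<epsilon> m0 m1 m2"
  shows "smult (of_real (a\<^sup>2 * \<epsilon>)) (L * L * (P * P - [:0, 0, of_real (h\<^sup>2):]))
      = smult (of_real k) ([:0, 0, 1:] * (M * M))"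
proof (rule poly_eq_on_infinite[OF infinite_conic_parameters[OF i e Z cn]])
  fix z assume "z \<in> (\<lambda>(x, y). of_real x + \<iota> * of_real y) ` Z"
  then obtain x y where xy: "(x, y) \<in> Z" and z: "z = of_real x + \<iota> * of_real y" by auto
  define l p m where "l = l0 + l1 * x + l2 * y" and "p = r1 + p1 * x + p2 * y"
    and "m = m0 + m1 * x + m2 * y"
  have ev: "poly P z = z * of_real p" "poly L z = z * of_real l" "poly M z = z * of_real m"
    unfolding P_def L_def M_def z l_def p_def m_def by (rule poly_conic_poly[OF i e cn[OF xy]])+
  have "of_real (a\<^sup>2 * l\<^sup>2 * (\<epsilon> * (p\<^sup>2 - h\<^sup>2))) = (of_real (k * m\<^sup>2) :: 'a)"
    using eq[OF xy, folded l_def p_def m_def] by simp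
  then have "of_real (a\<^sup>2 * \<epsilon>) * ((z * of_real l) * (z * of_real l) * ((z * of_real p) * (z * of_real p)
      - of_real (h\<^sup>2) * z\<^sup>2)) = of_real k * (z\<^sup>2 * ((z * of_real m) * (z * of_real m)))"
    unfolding of_real_mult of_real_add of_real_diff of_real_power by algebra
  then show "poly (smult (of_real (a\<^sup>2 * \<epsilon>)) (L * L * (P * P - [:0, 0, of_real (h\<^sup>2):]))) z
      = poly (smult (of_real k) ([:0, 0, 1:] * (M * M))) z"
    by (simp add: ev power2_eq_square algebra_simps)
qed

text \<open>On the circle, degree 8 makes the affine function \<open>l\<close> constant. The next coefficients then say that
\<open>a l p\<close> and \<open>M\<close> agree up to a constant real factor, and the term \<open>h\<^sup>2\<close> that is left over must
vanish unless \<open>l = 0\<close>. The comparison is made on real and imaginary parts, because \<open>k\<close> and the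
coefficients are real.\<close>

lemma conic_zero_spacelike:
  fixes a k h r1 p1 p2 l0 l1 l2 m0 m1 m2 :: real
  assumes Z: "infinite Z" and cn: "\<And>x y. (x, y) \<in> Z \<Longrightarrow> x\<^sup>2 + y\<^sup>2 = 1"
    and eq: "\<And>x y. (x, y) \<in> Z \<Longrightarrow>
      a\<^sup>2 * (l0 + l1 * x + l2 * y)\<^sup>2 * ((r1 + p1 * x + p2 * y)\<^sup>2 - h\<^sup>2) = k * (m0 + m1 * x + m2 * y)\<^sup>2"
    and a: "a \<noteq> 0" and h: "h \<noteq> 0" and k: "k > 0" and nz: "p1 \<noteq> 0 \<or> p2 \<noteq> 0"
  shows "l0 = 0 \<and> l1 = 0 \<and> l2 = 0"
proof -
  define la lc ma mc pa pc where "la = Complex (l1/2) (l2/2)" and "lc = Complex (l1/2) (-l2/2)"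
    and "ma = Complex (m1/2) (m2/2)" and "mc = Complex (m1/2) (-m2/2)"
    and "pa = Complex (p1/2) (p2/2)" and "pc = Complex (p1/2) (-p2/2)"
  have cp: "conic_poly \<i> 1 f0 f1 f2 = [:Complex (f1/2) (f2/2), of_real f0, Complex (f1/2) (-f2/2):]" for f0 f1 f2
    by (simp add: conic_poly_def complex_eq_iff)
  have "smult (of_real (a\<^sup>2 * 1)) (conic_poly \<i> 1 l0 l1 l2 * conic_poly \<i> 1 l0 l1 l2
        * (conic_poly \<i> 1 r1 p1 p2 * conic_poly \<i> 1 r1 p1 p2 - [:0, 0, of_real (h\<^sup>2):]))
      = smult (of_real k) ([:0, 0, 1:] * (conic_poly \<i> 1 m0 m1 m2 * conic_poly \<i> 1 m0 m1 m2))"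
    by (rule conic_poly_homogeneous[OF _ _ Z]) (use cn eq in auto)
  then have PQ: "smult (of_real (a\<^sup>2)) ([:la, of_real l0, lc:] * [:la, of_real l0, lc:]
        * ([:pa, of_real r1, pc:] * [:pa, of_real r1, pc:] - [:0, 0, of_real (h\<^sup>2):]))
      = smult (of_real k) ([:0, 0, 1:] * ([:ma, of_real m0, mc:] * [:ma, of_real m0, mc:]))"
    unfolding cp la_def lc_def ma_def mc_def pa_def pc_def by simp
  have "pc \<noteq> 0" using nz by (auto simp: pc_def complex_eq_iff)
  have ev: "poly.coeff p n = poly.coeff q n" if "p = q" for p q :: "complex poly" and n using that by simp
  note sm = coeff_pCons numeral_eq_Suc
  have "lc = 0" using ev[OF PQ, of 8] a \<open>pc \<noteq> 0\<close> by (simp add: sm)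
  then have l12: "l1 = 0" "l2 = 0" by (auto simp: lc_def complex_eq_iff)
  then have la: "la = 0" by (simp add: la_def complex_eq_iff)
  define A where "A = a\<^sup>2 * l0\<^sup>2"
  have c6: "of_real A * pc\<^sup>2 = of_real k * mc\<^sup>2"
    using ev[OF PQ, of 6] \<open>lc = 0\<close> la by (simp add: sm A_def power2_eq_square algebra_simps)
  have c5: "of_real A * (pc * of_real r1) = of_real k * (mc * of_real m0)"
    using ev[OF PQ, of 5] \<open>lc = 0\<close> la by (simp add: sm A_def power2_eq_square algebra_simps)
  have c4: "of_real A * (of_real (r1\<^sup>2 - h\<^sup>2) + 2 * pa * pc) = of_real k * (of_real (m0\<^sup>2) + 2 * ma * mc)"
    using ev[OF PQ, of 4] \<open>lc = 0\<close> la by (simp add: sm A_def power2_eq_square algebra_simps)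
  have r6: "A * (p1\<^sup>2 - p2\<^sup>2) = k * (m1\<^sup>2 - m2\<^sup>2)" "A * (p1 * p2) = k * (m1 * m2)"
    using c6 by (simp_all add: pc_def mc_def complex_eq_iff power2_eq_square field_simps)
  have r5: "A * (p1 * r1) = k * (m1 * m0)" "A * (p2 * r1) = k * (m2 * m0)"
    using c5 by (simp_all add: pc_def mc_def complex_eq_iff field_simps)
  have r4: "A * (r1\<^sup>2 - h\<^sup>2 + (p1\<^sup>2 + p2\<^sup>2) / 2) = k * (m0\<^sup>2 + (m1\<^sup>2 + m2\<^sup>2) / 2)"
    using c4 by (simp add: pa_def pc_def ma_def mc_def complex_eq_iff power2_eq_square field_simps)
  have "(A * (p1\<^sup>2 + p2\<^sup>2))\<^sup>2 = (k * (m1\<^sup>2 + m2\<^sup>2))\<^sup>2"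
    using r6 by algebra
  then have s: "A * (p1\<^sup>2 + p2\<^sup>2) = k * (m1\<^sup>2 + m2\<^sup>2)"
  proof (rule power2_eq_imp_eq)
    show "0 \<le> A * (p1\<^sup>2 + p2\<^sup>2)" "0 \<le> k * (m1\<^sup>2 + m2\<^sup>2)"
      using k by (simp_all add: A_def)
  qed
  then have t: "A * (r1\<^sup>2 - h\<^sup>2) = k * m0\<^sup>2" using r4 by (simp add: algebra_simps)
  have "(A * r1)\<^sup>2 * (p1\<^sup>2 + p2\<^sup>2) = (k * m0\<^sup>2) * (A * (p1\<^sup>2 + p2\<^sup>2))"
    unfolding s using r5 by algebra
  then have "A * (A * h\<^sup>2) * (p1\<^sup>2 + p2\<^sup>2) = 0"
    unfolding t[symmetric] by algebra
  moreover have "p1\<^sup>2 + p2\<^sup>2 \<noteq> 0" using nz by (simp add: sum_power2_eq_zero_iff)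
  ultimately have "A = 0" using h by (simp only: mult_eq_0_iff power2_eq_square) blast
  then have "l0 = 0" using a by (simp add: A_def)
  then show ?thesis using l12 by simp
qed

text \<open>On the hyperbola, \<open>h\<^sup>2 - p\<^sup>2\<close> is negative near one of the ends \<open>z = \<infinity>\<close>, so the two sides of the identity have
opposite signs there. This shows up in the leading coefficients, each of which equates a
nonpositive with a nonnegative number.\<close>

lemma conic_zero_timelike:
  fixes a k h r1 p1 p2 l0 l1 l2 m0 m1 m2 :: real
  assumes Z: "infinite Z" and cn: "\<And>x y. (x, y) \<in> Z \<Longrightarrow> y\<^sup>2 - x\<^sup>2 = 1"
    and eq: "\<And>x y. (x, y) \<in> Z \<Longrightarrow>
      a\<^sup>2 * (l0 + l1 * x + l2 * y)\<^sup>2 * (h\<^sup>2 - (r1 + p1 * x + p2 * y)\<^sup>2) = k * (m0 + m1 * x + m2 * y)\<^sup>2"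
    and a: "a \<noteq> 0" and k: "k > 0" and nz: "p1 \<noteq> 0 \<or> p2 \<noteq> 0"
  shows "l0 = 0 \<and> l1 = 0 \<and> l2 = 0"
proof -
  \<comment> \<open>The two ends of a branch of the hyperbola; \<open>p\<close> is unbounded at one of them at least.\<close>
  have "\<exists>\<iota>::real. \<iota>\<^sup>2 = 1 \<and> p1 + p2 / \<iota> \<noteq> 0"
    using nz by (cases "p1 + p2 = 0") (auto intro: exI[of _ 1] exI[of _ "-1"])
  then obtain \<iota> :: real where i: "\<iota>\<^sup>2 = 1" and ne: "p1 + p2 / \<iota> \<noteq> 0" by blast
  have cp: "conic_poly \<iota> (-1) f0 f1 f2 = [:- (f1 - f2 / \<iota>) / 2, f0, (f1 + f2 / \<iota>) / 2:]" for f0 f1 f2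
    by (simp add: conic_poly_def)
  define la lc ma mc pa pc where "la = - (l1 - l2 / \<iota>) / 2" and "lc = (l1 + l2 / \<iota>) / 2"
    and "ma = - (m1 - m2 / \<iota>) / 2" and "mc = (m1 + m2 / \<iota>) / 2"
    and "pa = - (p1 - p2 / \<iota>) / 2" and "pc = (p1 + p2 / \<iota>) / 2"
  have "smult (of_real (a\<^sup>2 * -1)) (conic_poly \<iota> (-1) l0 l1 l2 * conic_poly \<iota> (-1) l0 l1 l2
        * (conic_poly \<iota> (-1) r1 p1 p2 * conic_poly \<iota> (-1) r1 p1 p2 - [:0, 0, of_real (h\<^sup>2):]))
      = smult (of_real k) ([:0, 0, 1:] * (conic_poly \<iota> (-1) m0 m1 m2 * conic_poly \<iota> (-1) m0 m1 m2))"
  proof (rule conic_poly_homogeneous[OF _ _ Z])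
    fix x y assume "(x, y) \<in> Z"
    then show "x\<^sup>2 + -1 * y\<^sup>2 = -1" using cn[of x y] by simp
    show "a\<^sup>2 * (l0 + l1 * x + l2 * y)\<^sup>2 * (-1 * ((r1 + p1 * x + p2 * y)\<^sup>2 - h\<^sup>2))
      = k * (m0 + m1 * x + m2 * y)\<^sup>2" using eq[OF \<open>(x, y) \<in> Z\<close>] by simp
  qed (use i in auto)
  then have PQ: "smult (- (a\<^sup>2)) ([:la, l0, lc:] * [:la, l0, lc:]
        * ([:pa, r1, pc:] * [:pa, r1, pc:] - [:0, 0, h\<^sup>2:]))
      = smult k ([:0, 0, 1:] * ([:ma, m0, mc:] * [:ma, m0, mc:]))"
    unfolding cp la_def lc_def ma_def mc_def pa_def pc_def by simp
  have pc: "pc \<noteq> 0" using ne by (simp add: pc_def)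
  have ev: "poly.coeff p n = poly.coeff q n" if "p = q" for p q :: "real poly" and n using that by simp
  note sm = coeff_pCons numeral_eq_Suc
  have sq: "s = 0 \<and> t = 0" if "- (a\<^sup>2 * s\<^sup>2 * pc\<^sup>2) = k * t\<^sup>2" for s t
  proof -
    have "a\<^sup>2 * s\<^sup>2 * pc\<^sup>2 \<ge> 0" "k * t\<^sup>2 \<ge> 0" using k by simp_all
    then have "a\<^sup>2 * s\<^sup>2 * pc\<^sup>2 = 0" "k * t\<^sup>2 = 0" using that by linarith+
    then show ?thesis using a k pc by simp
  qed
  have lc: "lc = 0" using ev[OF PQ, of 8] a pc by (simp add: sm)
  have "- (a\<^sup>2 * l0\<^sup>2 * pc\<^sup>2) = k * mc\<^sup>2"
    using ev[OF PQ, of 6] lc by (simp add: sm power2_eq_square algebra_simps)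
  then have l0: "l0 = 0" and mc: "mc = 0" using sq by blast+
  have "- (a\<^sup>2 * la\<^sup>2 * pc\<^sup>2) = k * m0\<^sup>2"
    using ev[OF PQ, of 4] lc l0 mc by (simp add: sm power2_eq_square algebra_simps)
  then have la: "la = 0" using sq by blast
  have "l1 + l2 / \<iota> = 0" "l1 - l2 / \<iota> = 0" using la lc by (simp_all add: la_def lc_def)
  then have "l1 = 0" "l2 / \<iota> = 0" by linarith+
  moreover have "\<iota> \<noteq> 0" using i by auto
  ultimately show ?thesis using l0 by simp
qed

section \<open>Leaves in spacelike or timelike planes\<close>

text \<open>On either side of \<open>0\<close>, the function \<open>g\<^sup>2\<close> times the exponential with rate \<open>\<plusminus> 2 K\<close> moves away from its
value \<open>0\<close> only downwards.\<close>
lemma gronwall_zero: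
  fixes g g' :: "real \<Rightarrow> real"
  assumes dg: "\<And>s. \<bar>s\<bar> < d \<Longrightarrow> (g has_real_derivative g' s) (at s)"
    and bd: "\<And>s. \<bar>s\<bar> < d \<Longrightarrow> \<bar>g' s\<bar> \<le> K * \<bar>g s\<bar>" and g0: "g 0 = 0" and s: "\<bar>s\<bar> < d"
  shows "g s = 0"
proof -
  have b: "\<bar>2 * g s * g' s\<bar> \<le> 2 * K * (g s)\<^sup>2" if "\<bar>s\<bar> < d" for s
    using mult_left_mono[OF bd[OF that], of "2 * \<bar>g s\<bar>"]
    by (simp add: abs_mult power2_eq_square algebra_simps)
  define f where "f = (\<lambda>k s. (g s)\<^sup>2 * exp (k * s))"
  have df: "(f k has_real_derivative (2 * g s * g' s + k * (g s)\<^sup>2) * exp (k * s)) (at s)" if "\<bar>s\<bar> < d" for k s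
    unfolding f_def by (auto intro!: derivative_eq_intros dg that simp: power2_eq_square algebra_simps)
  have "f k s \<le> 0" if "k = (if s \<ge> 0 then - 2 * K else 2 * K)" for k
  proof (cases "s \<ge> 0")
    case True
    have "f k s \<le> f k 0"
    proof (rule DERIV_nonpos_imp_nonincreasing[OF True])
      fix x assume "0 \<le> x" "x \<le> s"
      then have "\<bar>x\<bar> < d" using s by auto
      moreover have "(2 * g x * g' x + k * (g x)\<^sup>2) * exp (k * x) \<le> 0"
        using b[OF \<open>\<bar>x\<bar> < d\<close>] that True by (intro mult_nonpos_nonneg) auto
      ultimately show "\<exists>y. (f k has_real_derivative y) (at x) \<and> y \<le> 0" using df by blast
    qed
    then show ?thesis by (simp add: f_def g0)
  next
    case False
    then have s0: "s \<le> 0" by simp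
    have "f k s \<le> f k 0"
    proof (rule DERIV_nonneg_imp_nondecreasing[OF s0, where f = "f k"])
      fix x assume "s \<le> x" "x \<le> 0"
      then have "\<bar>x\<bar> < d" using s by auto
      moreover have "(2 * g x * g' x + k * (g x)\<^sup>2) * exp (k * x) \<ge> 0"
        using b[OF \<open>\<bar>x\<bar> < d\<close>] that False by (intro mult_nonneg_nonneg) auto
      ultimately show "\<exists>y. (f k has_real_derivative y) (at x) \<and> y \<ge> 0" using df by blast
    qed
    then show ?thesis by (simp add: f_def g0)
  qed
  then have "(g s)\<^sup>2 \<le> 0" by (force simp: f_def mult_le_0_iff not_le)
  then show ?thesis by simp
qed

text \<open>Ring identities for the frame \<open>e = (e1, e2)\<close>, \<open>J e = (- \<epsilon> e2, e1)\<close> of the plane with metric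
\<open>x\<^sup>2 + \<epsilon> y\<^sup>2\<close>, where \<open>\<langle>e, e\<rangle> = \<epsilon>\<close> and \<open>\<langle>J e, J e\<rangle> = 1\<close>: the components of the derivative of \<open>e\<close>, the
orthogonality and the length of the normal vector, and the first fundamental form.\<close>

lemma conic_frame_identities:
  fixes \<epsilon> e1 e2 :: real
  assumes e: "\<epsilon>\<^sup>2 = 1" and u: "e1\<^sup>2 + \<epsilon> * e2\<^sup>2 = \<epsilon>"
  shows "e1 * s + \<epsilon> * (e2 * t) = 0 \<Longrightarrow> s = - \<epsilon> * e2 * (\<epsilon> * (e1 * t - e2 * s))"
    and "e1 * s + \<epsilon> * (e2 * t) = 0 \<Longrightarrow> t = e1 * (\<epsilon> * (e1 * t - e2 * s))"
    and "h * e1 * (a + r' * e1 - r * \<epsilon> * e2 * w) + \<epsilon> * (h * e2 * (b + r' * e2 + r * e1 * w))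
      - \<epsilon> * ((r' + \<epsilon> * (a * e1 + \<epsilon> * (b * e2))) * h) = 0"
    and "- (h * e1 * (h * e1) + \<epsilon> * (h * e2 * (h * e2)) - \<epsilon> * (c * c)) = \<epsilon> * (c\<^sup>2 - h\<^sup>2)"
    and "- r * \<epsilon> * e2 * v * (- r * \<epsilon> * e2 * v) + \<epsilon> * (r * e1 * v * (r * e1 * v)) - \<epsilon> * (0 * 0) = r\<^sup>2 * v\<^sup>2"
    and "(a + r' * e1 - r * \<epsilon> * e2 * w) * (- r * \<epsilon> * e2 * v) + \<epsilon> * ((b + r' * e2 + r * e1 * w) * (r * e1 * v))
      - \<epsilon> * (h * 0) = r * v * (\<epsilon> * (b * e1 - a * e2) + r * w)"
    and "(a + r' * e1 - r * \<epsilon> * e2 * w) * (a + r' * e1 - r * \<epsilon> * e2 * w)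
      + \<epsilon> * ((b + r' * e2 + r * e1 * w) * (b + r' * e2 + r * e1 * w)) - \<epsilon> * (h * h)
      = \<epsilon> * ((r' + \<epsilon> * (a * e1 + \<epsilon> * (b * e2)))\<^sup>2 - h\<^sup>2) + (\<epsilon> * (b * e1 - a * e2) + r * w)\<^sup>2"
    and "\<epsilon> * ((r' + \<epsilon> * (a * e1 + \<epsilon> * (b * e2)))\<^sup>2 - h\<^sup>2) + (\<epsilon> * (b * e1 - a * e2))\<^sup>2
      = \<epsilon> * r'\<^sup>2 + a\<^sup>2 + \<epsilon> * b\<^sup>2 - \<epsilon> * h\<^sup>2 + 2 * r' * a * e1 + 2 * r' * \<epsilon> * b * e2"
  subgoal using e u by algebra
  subgoal using e u by algebra
  subgoal using e u by algebra
  subgoal using e u by algebra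
  subgoal using e u by algebra
  subgoal using e u by algebra
  subgoal using e u by algebra
  subgoal using e u by algebra
  done

lemma leafwise_second_pds:
  fixes f :: "real^2 \<Rightarrow> real"
  assumes "open D" "leafwise D f" "smooth_map_on f D" "p \<in> D"
  shows "pd 2 f p = 0" "pd 1 (pd 2 f) p = 0" "pd 2 (pd 2 f) p = 0" "pd 2 (pd 1 f) p = 0"
proof -
  have z: "pd 2 f q = 0" if "q \<in> D" for q
    using leafwise_pd_2[OF assms(1,2) that] smooth_differentiable[OF assms(3) that] by blast
  then show "pd 2 f p = 0" using assms(4) .
  have "pd i (pd 2 f) p = pd i (\<lambda>_. 0) p" for i by (rule pd_cong[OF assms(1,4) z])
  then show "pd 1 (pd 2 f) p = 0" "pd 2 (pd 2 f) p = 0" by simp_all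
  have "leafwise D (pd 1 f)"
    by (rule leafwise_pd_1[OF assms(1,2) smooth_differentiable[OF assms(3)]])
  then show "pd 2 (pd 1 f) p = 0"
    using leafwise_pd_2[OF assms(1) _ assms(4)] smooth_differentiable[OF smooth_pd[OF assms(3)] assms(4)]
    by blast
qed

lemma pd_pd_mult:
  fixes f g :: "real^2 \<Rightarrow> real"
  assumes "open D" "smooth_map_on f D" "smooth_map_on g D" "p \<in> D"
  shows "pd i (pd j (\<lambda>p. f p * g p)) p = f p * pd i (pd j g) p + pd i f p * pd j g p
    + (pd j f p * pd i g p + pd i (pd j f) p * g p)"
proof -
  note d = smooth_differentiable[OF assms(2)] smooth_differentiable[OF assms(3)]
    smooth_differentiable[OF smooth_pd[OF assms(2)]] smooth_differentiable[OF smooth_pd[OF assms(3)]]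
  have "pd i (pd j (\<lambda>p. f p * g p)) p = pd i (\<lambda>p. f p * pd j g p + pd j f p * g p) p"
    by (rule pd_cong[OF assms(1,4)]) (simp add: pd_mult d)
  then show ?thesis using assms(4) by (simp add: pd_add pd_mult d differentiable_mult)
qed

lemma pd_pd_add:
  fixes f g :: "real^2 \<Rightarrow> real"
  assumes "open D" "smooth_map_on f D" "smooth_map_on g D" "p \<in> D"
  shows "pd i (pd j (\<lambda>p. f p + g p)) p = pd i (pd j f) p + pd i (pd j g) p"
proof -
  note d = smooth_differentiable[OF assms(2)] smooth_differentiable[OF assms(3)]
    smooth_differentiable[OF smooth_pd[OF assms(2)]] smooth_differentiable[OF smooth_pd[OF assms(3)]]
  have "pd i (pd j (\<lambda>p. f p + g p)) p = pd i (\<lambda>p. pd j f p + pd j g p) p"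
    by (rule pd_cong[OF assms(1,4)]) (simp add: pd_add d)
  then show ?thesis using assms(4) by (simp add: pd_add d)
qed

context surface_with_normal begin

lemma smooth_coord: "smooth_map_on (\<lambda>p. X p $ k) D"
  by (rule smooth_nth[OF open_D smooth_X])

lemma pd_coord: "p \<in> D \<Longrightarrow> pd i X p $ k = pd i (\<lambda>p. X p $ k) p"
  by (simp add: pd_nth diff_X)

lemma pd_pd_coord: "p \<in> D \<Longrightarrow> pd i (pd j X) p $ k = pd i (pd j (\<lambda>p. X p $ k)) p"
proof -
  assume p: "p \<in> D"
  have "pd i (pd j (\<lambda>p. X p $ k)) p = pd i (\<lambda>p. pd j X p $ k) p"
    by (rule pd_cong[OF open_D p]) (simp add: pd_coord)
  then show ?thesis using p by (simp add: pd_nth diff_pd_X)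
qed

end

locale leaved_surface = surface_with_normal +
  assumes connected_params: "connected (leaf_params D)"
    and connected_leaf: "\<And>u. connected {v. vector [u, v] \<in> D}"
begin

lemma connected_D: "connected D"
  by (rule connected_from_leaves[OF open_D connected_params connected_leaf])

end

text \<open>One computation covers circles in spacelike planes and hyperbolas in timelike planes. The
coordinate \<open>t\<close> is constant on the leaves, and the metric is \<open>dx\<^sup>2 + \<epsilon> dy\<^sup>2 - \<epsilon> dt\<^sup>2\<close>, with \<open>\<epsilon> = 1\<close> for
spacelike planes (\<open>t = x\<^sub>3\<close>) and \<open>\<epsilon> = -1\<close> for timelike ones (\<open>t = x\<^sub>1\<close>). A leaf is the conic of
centre \<open>(ca, cb)\<close> and radius \<open>rr\<close>.\<close>

locale conic_leaves = leaved_surface +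
  fixes \<epsilon> :: real and kx ky kt :: 3 and ca cb rr :: "real^2 \<Rightarrow> real"
  assumes eps: "\<epsilon> = 1 \<or> \<epsilon> = -1"
    and mink_coords: "\<And>A B. mink A B = A$kx * B$kx + \<epsilon> * (A$ky * B$ky) - \<epsilon> * (A$kt * B$kt)"
    and distinct_coords: "kx \<noteq> ky" "kx \<noteq> kt" "ky \<noteq> kt"
    and leafwise_t: "leafwise D (\<lambda>p. X p $ kt)"
    and leafwise_c: "leafwise D ca" "leafwise D cb" "leafwise D rr"
    and rr_pos: "\<And>p. p \<in> D \<Longrightarrow> rr p > 0"
    and conic: "\<And>p. p \<in> D \<Longrightarrow> (X p $ kx - ca p)\<^sup>2 + \<epsilon> * (X p $ ky - cb p)\<^sup>2 = \<epsilon> * (rr p)\<^sup>2"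
begin

definition "x = (\<lambda>p. X p $ kx)"
definition "y = (\<lambda>p. X p $ ky)"
definition "t = (\<lambda>p. X p $ kt)"

lemma eps2: "\<epsilon>\<^sup>2 = 1" "\<epsilon> * \<epsilon> = 1" "\<epsilon> \<noteq> 0"
  using eps by auto

lemma rr_nz: "p \<in> D \<Longrightarrow> rr p \<noteq> 0"
  using rr_pos by force

lemma smooth_xyt: "smooth_map_on x D" "smooth_map_on y D" "smooth_map_on t D"
  unfolding x_def y_def t_def by (rule smooth_coord)+

lemmas diff_xyt = smooth_differentiable[OF smooth_xyt(1)] smooth_differentiable[OF smooth_xyt(2)]
  smooth_differentiable[OF smooth_xyt(3)]
lemmas diff_pd_xyt = smooth_differentiable[OF smooth_pd[OF smooth_xyt(1)]]
  smooth_differentiable[OF smooth_pd[OF smooth_xyt(2)]] smooth_differentiable[OF smooth_pd[OF smooth_xyt(3)]]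

lemmas t_v = leafwise_second_pds[OF open_D leafwise_t[folded t_def] smooth_xyt(3)]

lemma mink_pd: "p \<in> D \<Longrightarrow> mink (pd i X p) (pd j X p)
    = pd i x p * pd j x p + \<epsilon> * (pd i y p * pd j y p) - \<epsilon> * (pd i t p * pd j t p)"
  by (simp add: mink_coords pd_coord x_def y_def t_def)

lemma speed_pos:
  assumes "p \<in> D" shows "(pd 2 x p)\<^sup>2 + \<epsilon> * (pd 2 y p)\<^sup>2 > 0"
  using first_form_diag_pos[OF assms, of 2] t_v(1)[OF assms]
  by (simp add: mink_pd assms power2_eq_square)

text \<open>Centre and radius are constant along a leaf, so the equation of the conic can be differentiated
along it before anything is known about their dependence on \<open>u\<close>.\<close>

lemma conic_derivs:
  assumes p: "p \<in> D"
  shows "(x p - ca p) * pd 2 x p + \<epsilon> * ((y p - cb p) * pd 2 y p) = 0"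
    and "(x p - ca p) * pd 2 (pd 2 x) p + \<epsilon> * ((y p - cb p) * pd 2 (pd 2 y) p)
      = - ((pd 2 x p)\<^sup>2 + \<epsilon> * (pd 2 y p)\<^sup>2)"
proof -
  have along: "eventually (\<lambda>s. p + s *\<^sub>R axis 2 1 \<in> D \<and> ca (p + s *\<^sub>R axis 2 1) = ca p
      \<and> cb (p + s *\<^sub>R axis 2 1) = cb p \<and> rr (p + s *\<^sub>R axis 2 1) = rr p) (nhds 0)" if "p \<in> D" for p
    using eventually_in_open_along[OF open_D that, of "axis 2 1"]
  proof eventually_elim
    case (elim s)
    have "(p + s *\<^sub>R axis 2 1 :: real^2) $ 1 = p $ 1" by (simp add: axis_def)
    then show ?case using elim that leafwise_c unfolding leafwise_def by blast
  qed
  have one: "(x p - ca p) * pd 2 x p + \<epsilon> * ((y p - cb p) * pd 2 y p) = 0" if p: "p \<in> D" for p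
  proof -
    have "pd 2 (\<lambda>q. (x q - ca p)\<^sup>2 + \<epsilon> * (y q - cb p)\<^sup>2) p = pd 2 (\<lambda>_. \<epsilon> * (rr p)\<^sup>2) p"
    proof (rule pd_eq_along)
      show "eventually (\<lambda>s. (x (p + s *\<^sub>R axis 2 1) - ca p)\<^sup>2 + \<epsilon> * (y (p + s *\<^sub>R axis 2 1) - cb p)\<^sup>2
          = \<epsilon> * (rr p)\<^sup>2) (nhds 0)"
        using along[OF p] by eventually_elim (use conic x_def y_def in metis)
    qed (use p diff_xyt in \<open>auto intro!: derivative_intros\<close>)
    then have "2 * (x p - ca p) * pd 2 x p + \<epsilon> * (2 * (y p - cb p) * pd 2 y p) = 0"
      using p diff_xyt by (simp add: pd_add pd_mult pd_power2 pd_diff)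
    then show ?thesis by algebra
  qed
  show "(x p - ca p) * pd 2 x p + \<epsilon> * ((y p - cb p) * pd 2 y p) = 0" by (rule one[OF p])
  have "pd 2 (\<lambda>q. (x q - ca p) * pd 2 x q + \<epsilon> * ((y q - cb p) * pd 2 y q)) p = pd 2 (\<lambda>_. 0) p"
  proof (rule pd_eq_along)
    show "eventually (\<lambda>s. (x (p + s *\<^sub>R axis 2 1) - ca p) * pd 2 x (p + s *\<^sub>R axis 2 1)
          + \<epsilon> * ((y (p + s *\<^sub>R axis 2 1) - cb p) * pd 2 y (p + s *\<^sub>R axis 2 1)) = 0) (nhds 0)"
      using along[OF p] by eventually_elim (use one in metis)
  qed (use p diff_xyt diff_pd_xyt in \<open>auto intro!: derivative_intros\<close>)
  then show "(x p - ca p) * pd 2 (pd 2 x) p + \<epsilon> * ((y p - cb p) * pd 2 (pd 2 y) p)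
      = - ((pd 2 x p)\<^sup>2 + \<epsilon> * (pd 2 y p)\<^sup>2)"
    using p diff_xyt diff_pd_xyt
    by (simp add: pd_add pd_mult pd_diff power2_eq_square algebra_simps)
qed

text \<open>The two equations above are linear in the position relative to the centre. Their determinant
vanishes only with the speed along the leaf, so Cramer's rule expresses the centre through
derivatives of \<open>X\<close>.\<close>

lemma smooth_centre_radius:
  "smooth_map_on ca D" "smooth_map_on cb D" "smooth_map_on rr D"
proof -
  define d where "d = (\<lambda>p. pd 2 x p * pd 2 (pd 2 y) p - pd 2 y p * pd 2 (pd 2 x) p)"
  define E where "E = (\<lambda>p. (pd 2 x p)\<^sup>2 + \<epsilon> * (pd 2 y p)\<^sup>2)"
  have eq: "(x p - ca p) * d p = E p * pd 2 y p" "(y p - cb p) * d p = - \<epsilon> * (E p * pd 2 x p)"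
    if "p \<in> D" for p
    unfolding d_def E_def using conic_derivs[OF that] eps2 by algebra+
  have d: "d p \<noteq> 0" if "p \<in> D" for p
  proof
    assume "d p = 0"
    then have "pd 2 y p = 0" "pd 2 x p = 0"
      using eq[OF that] speed_pos[OF that] eps2 by (auto simp: E_def)
    then show False using speed_pos[OF that] by simp
  qed
  have ca: "ca p = x p - E p * pd 2 y p / d p" and cb: "cb p = y p - - \<epsilon> * (E p * pd 2 x p) / d p"
    if "p \<in> D" for p using eq[OF that] d[OF that] by (simp_all add: field_simps)
  note sm = smooth_intros smooth_xyt
  have "smooth_map_on (\<lambda>p. x p - E p * pd 2 y p / d p) D"
    unfolding E_def d_def by (intro sm open_D) (use d d_def in auto)
  then show sca: "smooth_map_on ca D" using smooth_cong[OF open_D ca] by simp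
  have "smooth_map_on (\<lambda>p. y p - - \<epsilon> * (E p * pd 2 x p) / d p) D"
    unfolding E_def d_def by (intro sm open_D) (use d d_def in auto)
  then show scb: "smooth_map_on cb D" using smooth_cong[OF open_D cb] by simp
  have r2: "\<epsilon> * ((x p - ca p)\<^sup>2 + \<epsilon> * (y p - cb p)\<^sup>2) = (rr p)\<^sup>2" if "p \<in> D" for p
    using conic[OF that] eps2 unfolding x_def y_def by simp
  have "smooth_map_on (\<lambda>p. \<epsilon> * ((x p - ca p)\<^sup>2 + \<epsilon> * (y p - cb p)\<^sup>2)) D"
    by (intro sm sca scb open_D)
  then have "smooth_map_on (\<lambda>p. (rr p)\<^sup>2) D"
    using smooth_cong[OF open_D, of "\<lambda>p. \<epsilon> * ((x p - ca p)\<^sup>2 + \<epsilon> * (y p - cb p)\<^sup>2)" "\<lambda>p. (rr p)\<^sup>2"] r2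
    by blast
  then have "smooth_map_on (\<lambda>p. sqrt ((rr p)\<^sup>2)) D"
    by (rule smooth_sqrt[OF open_D]) (simp add: rr_nz)
  moreover have "sqrt ((rr p)\<^sup>2) = rr p" if "p \<in> D" for p
    using rr_pos[OF that] by simp
  ultimately show "smooth_map_on rr D"
    using smooth_cong[OF open_D, of "\<lambda>p. sqrt ((rr p)\<^sup>2)" rr] by blast
qed

lemmas ca_v = leafwise_second_pds[OF open_D leafwise_c(1) smooth_centre_radius(1)]
lemmas cb_v = leafwise_second_pds[OF open_D leafwise_c(2) smooth_centre_radius(2)]
lemmas rr_v = leafwise_second_pds[OF open_D leafwise_c(3) smooth_centre_radius(3)]

definition "e1 = (\<lambda>p. (x p - ca p) / rr p)"
definition "e2 = (\<lambda>p. (y p - cb p) / rr p)"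

lemma smooth_e: "smooth_map_on e1 D" "smooth_map_on e2 D"
  unfolding e1_def e2_def
  by (intro smooth_divide smooth_diff smooth_xyt smooth_centre_radius open_D; simp add: rr_nz)+

lemma unit_e: "p \<in> D \<Longrightarrow> (e1 p)\<^sup>2 + \<epsilon> * (e2 p)\<^sup>2 = \<epsilon>"
  using conic[of p] rr_pos[of p] unfolding e1_def e2_def x_def y_def
  by (simp add: power_divide field_simps)

lemma xy_polar: "p \<in> D \<Longrightarrow> x p = ca p + rr p * e1 p" "p \<in> D \<Longrightarrow> y p = cb p + rr p * e2 p"
  using rr_pos[of p] by (simp_all add: e1_def e2_def)

lemma pd_polar:
  assumes p: "p \<in> D"
  shows "pd i x p = pd i ca p + (rr p * pd i e1 p + pd i rr p * e1 p)"
    and "pd i y p = pd i cb p + (rr p * pd i e2 p + pd i rr p * e2 p)"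
proof -
  note d = smooth_differentiable[OF smooth_centre_radius(1) p]
    smooth_differentiable[OF smooth_centre_radius(2) p] smooth_differentiable[OF smooth_centre_radius(3) p]
    smooth_differentiable[OF smooth_e(1) p] smooth_differentiable[OF smooth_e(2) p]
  have "pd i x p = pd i (\<lambda>p. ca p + rr p * e1 p) p" "pd i y p = pd i (\<lambda>p. cb p + rr p * e2 p) p"
    by (rule pd_cong[OF open_D p], erule xy_polar)+
  then show "pd i x p = pd i ca p + (rr p * pd i e1 p + pd i rr p * e1 p)"
    "pd i y p = pd i cb p + (rr p * pd i e2 p + pd i rr p * e2 p)"
    using d by (simp_all add: pd_add pd_mult differentiable_mult)
qed

lemma pd_pd_polar:
  assumes p: "p \<in> D"
  shows "pd i (pd j x) p = pd i (pd j ca) p + (rr p * pd i (pd j e1) p + pd i rr p * pd j e1 p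
      + (pd j rr p * pd i e1 p + pd i (pd j rr) p * e1 p))"
    and "pd i (pd j y) p = pd i (pd j cb) p + (rr p * pd i (pd j e2) p + pd i rr p * pd j e2 p
      + (pd j rr p * pd i e2 p + pd i (pd j rr) p * e2 p))"
proof -
  have "pd j x q = pd j (\<lambda>p. ca p + rr p * e1 p) q" "pd j y q = pd j (\<lambda>p. cb p + rr p * e2 p) q"
    if "q \<in> D" for q
    by (rule pd_cong[OF open_D that], erule xy_polar)+
  then have "pd i (pd j x) p = pd i (pd j (\<lambda>p. ca p + rr p * e1 p)) p"
    "pd i (pd j y) p = pd i (pd j (\<lambda>p. cb p + rr p * e2 p)) p"
    by (auto intro!: pd_cong[OF open_D p])
  then show "pd i (pd j x) p = pd i (pd j ca) p + (rr p * pd i (pd j e1) p + pd i rr p * pd j e1 p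
      + (pd j rr p * pd i e1 p + pd i (pd j rr) p * e1 p))"
    "pd i (pd j y) p = pd i (pd j cb) p + (rr p * pd i (pd j e2) p + pd i rr p * pd j e2 p
      + (pd j rr p * pd i e2 p + pd i (pd j rr) p * e2 p))"
    using p by (simp_all add: pd_pd_add[OF open_D] pd_pd_mult[OF open_D] open_D smooth_centre_radius smooth_e smooth_mult)
qed

lemma unit_e_derivs:
  assumes p: "p \<in> D"
  shows "e1 p * pd i e1 p + \<epsilon> * (e2 p * pd i e2 p) = 0"
    and "e1 p * pd i (pd j e1) p + pd i e1 p * pd j e1 p
      + \<epsilon> * (e2 p * pd i (pd j e2) p + pd i e2 p * pd j e2 p) = 0"
proof -
  note d = smooth_differentiable[OF smooth_e(1)] smooth_differentiable[OF smooth_e(2)]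
    smooth_differentiable[OF smooth_pd[OF smooth_e(1)]] smooth_differentiable[OF smooth_pd[OF smooth_e(2)]]
  have one: "e1 p * pd i e1 p + \<epsilon> * (e2 p * pd i e2 p) = 0" if p: "p \<in> D" for p i
  proof -
    have "pd i (\<lambda>p. (e1 p)\<^sup>2 + \<epsilon> * (e2 p)\<^sup>2) p = pd i (\<lambda>_. \<epsilon>) p"
      by (rule pd_cong[OF open_D p unit_e])
    then show ?thesis using d[OF p] by (simp add: pd_add pd_mult pd_power2 differentiable_mult)
  qed
  then show "e1 p * pd i e1 p + \<epsilon> * (e2 p * pd i e2 p) = 0" using p .
  have "pd i (\<lambda>p. e1 p * pd j e1 p + \<epsilon> * (e2 p * pd j e2 p)) p = pd i (\<lambda>_. 0) p"
    by (rule pd_cong[OF open_D p one])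
  then show "e1 p * pd i (pd j e1) p + pd i e1 p * pd j e1 p
      + \<epsilon> * (e2 p * pd i (pd j e2) p + pd i e2 p * pd j e2 p) = 0"
    using d[OF p] by (simp add: pd_add pd_mult differentiable_mult)
qed

text \<open>The coefficient in \<open>e\<^sub>i = angular_speed i \<cdot> J e\<close>, where \<open>e = (e1, e2)\<close> and \<open>J e = (- \<epsilon> e2, e1)\<close>.\<close>

definition "angular_speed i p = \<epsilon> * (e1 p * pd i e2 p - e2 p * pd i e1 p)"

lemma pd_e:
  assumes "p \<in> D"
  shows "pd i e1 p = - \<epsilon> * e2 p * angular_speed i p" "pd i e2 p = e1 p * angular_speed i p"
  unfolding angular_speed_def
  by (rule conic_frame_identities(1,2)[OF eps2(1) unit_e[OF assms] unit_e_derivs(1)[OF assms]])+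

text \<open>Let \<open>c\<close> be the centre, \<open>r\<close> the radius, and let primes denote derivatives with respect to \<open>u\<close>. With the
unit vectors \<open>e\<close> and \<open>J e\<close>, the velocity of the leaves at a fixed angle is
\<open>c' + r' e + t' \<partial>\<^sub>t = radial_speed \<cdot> e + drift \<cdot> J e + t' \<partial>\<^sub>t\<close>. Therefore \<open>normal_vec = t' e + radial_speed \<cdot> \<partial>\<^sub>t\<close> is
orthogonal to the surface, and \<open>- normal_sq\<close> is its square. Its products with \<open>c'' + r'' e\<close> and with the whole acceleration at a
fixed angle are \<open>t' \<cdot> plane_accel\<close> and \<open>normal_accel\<close>.\<close>

definition "radial_speed p = pd 1 rr p + \<epsilon> * (pd 1 ca p * e1 p + \<epsilon> * (pd 1 cb p * e2 p))"
definition "drift p = \<epsilon> * (pd 1 cb p * e1 p - pd 1 ca p * e2 p)"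
definition "normal_sq p = \<epsilon> * ((radial_speed p)\<^sup>2 - (pd 1 t p)\<^sup>2)"
definition "plane_accel p = pd 1 (pd 1 ca) p * e1 p + \<epsilon> * (pd 1 (pd 1 cb) p * e2 p) + \<epsilon> * pd 1 (pd 1 rr) p"
definition "normal_accel p = pd 1 t p * plane_accel p - \<epsilon> * (radial_speed p * pd 1 (pd 1 t) p)"
definition "normal_vec p = (\<chi> k. if k = kx then pd 1 t p * e1 p else if k = ky then pd 1 t p * e2 p else radial_speed p)"

lemma normal_vec_nth: "normal_vec p $ kx = pd 1 t p * e1 p" "normal_vec p $ ky = pd 1 t p * e2 p" "normal_vec p $ kt = radial_speed p"
  using distinct_coords by (auto simp: normal_vec_def)

lemma mink_normal_pd: "p \<in> D \<Longrightarrow> mink (normal_vec p) (pd i X p)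
    = pd 1 t p * e1 p * pd i x p + \<epsilon> * (pd 1 t p * e2 p * pd i y p) - \<epsilon> * (radial_speed p * pd i t p)"
  by (simp add: mink_coords normal_vec_nth pd_coord x_def y_def t_def)

lemma mink_normal_pd_pd: "p \<in> D \<Longrightarrow> mink (normal_vec p) (pd i (pd j X) p)
    = pd 1 t p * e1 p * pd i (pd j x) p + \<epsilon> * (pd 1 t p * e2 p * pd i (pd j y) p) - \<epsilon> * (radial_speed p * pd i (pd j t) p)"
  by (simp add: mink_coords normal_vec_nth pd_pd_coord x_def y_def t_def)

context
  fixes p assumes p: "p \<in> D"
begin

lemma velocity_v: "pd 2 x p = - rr p * \<epsilon> * e2 p * angular_speed 2 p" "pd 2 y p = rr p * e1 p * angular_speed 2 p"
  by (simp_all add: pd_polar[OF p] pd_e[OF p] ca_v[OF p] cb_v[OF p] rr_v[OF p])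

lemma velocity_u: "pd 1 x p = pd 1 ca p + pd 1 rr p * e1 p - rr p * \<epsilon> * e2 p * angular_speed 1 p"
   "pd 1 y p = pd 1 cb p + pd 1 rr p * e2 p + rr p * e1 p * angular_speed 1 p"
  by (simp_all add: pd_polar[OF p] pd_e[OF p])

lemma normal_vec_orthogonal: "mink (normal_vec p) (pd 1 X p) = 0" "mink (normal_vec p) (pd 2 X p) = 0"
  unfolding mink_normal_pd[OF p] velocity_u velocity_v t_v[OF p] radial_speed_def
  by (rule conic_frame_identities(3)[OF eps2(1) unit_e[OF p]]) (simp add: algebra_simps)

lemma normal_vec_norm: "- mink (normal_vec p) (normal_vec p) = normal_sq p"
  unfolding mink_coords normal_vec_nth normal_sq_def by (rule conic_frame_identities(4)[OF eps2(1) unit_e[OF p]])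

lemma first_form:
  "mink (pd 2 X p) (pd 2 X p) = (rr p)\<^sup>2 * (angular_speed 2 p)\<^sup>2"
  "mink (pd 1 X p) (pd 2 X p) = rr p * angular_speed 2 p * (drift p + rr p * angular_speed 1 p)"
  "mink (pd 1 X p) (pd 1 X p) = normal_sq p + (drift p + rr p * angular_speed 1 p)\<^sup>2"
  unfolding mink_pd[OF p] velocity_u velocity_v t_v[OF p] radial_speed_def drift_def normal_sq_def
  by (rule conic_frame_identities(5-7)[OF eps2(1) unit_e[OF p]])+

text \<open>Since \<open>\<langle>e, e\<rangle>\<close> is constant, \<open>\<langle>e, e\<^sub>i\<^sub>j\<rangle> = - angular_speed i \<cdot> angular_speed j\<close>; all other terms of the second
derivatives of \<open>X\<close> are derivatives of functions of \<open>u\<close> or tangent to the conic.\<close>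

lemma second_form:
  "mink (normal_vec p) (pd 2 (pd 2 X) p) = - pd 1 t p * rr p * (angular_speed 2 p)\<^sup>2"
  "mink (normal_vec p) (pd 1 (pd 2 X) p) = - pd 1 t p * rr p * angular_speed 1 p * angular_speed 2 p"
  "mink (normal_vec p) (pd 2 (pd 1 X) p) = - pd 1 t p * rr p * angular_speed 1 p * angular_speed 2 p"
  "mink (normal_vec p) (pd 1 (pd 1 X) p) = normal_accel p - pd 1 t p * rr p * (angular_speed 1 p)\<^sup>2"
proof -
  have s: "e1 p * pd i (pd j e1) p + \<epsilon> * (e2 p * pd i (pd j e2) p) = - angular_speed i p * angular_speed j p" for i j
    using unit_e_derivs(2)[OF p, of i j] unit_e[OF p] eps2(1) unfolding pd_e[OF p] by algebra
  have n: "mink (normal_vec p) (pd i (pd j X) p) =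
      pd 1 t p * (e1 p * pd i (pd j ca) p + \<epsilon> * (e2 p * pd i (pd j cb) p)
        - rr p * (angular_speed i p * angular_speed j p) + \<epsilon> * pd i (pd j rr) p)
      - \<epsilon> * (radial_speed p * pd i (pd j t) p)" for i j
    unfolding mink_normal_pd_pd[OF p] pd_pd_polar[OF p]
    using s[of i j] unit_e_derivs(1)[OF p, of i] unit_e_derivs(1)[OF p, of j] unit_e[OF p] eps2
    by algebra
  show "mink (normal_vec p) (pd 2 (pd 2 X) p) = - pd 1 t p * rr p * (angular_speed 2 p)\<^sup>2"
    "mink (normal_vec p) (pd 1 (pd 2 X) p) = - pd 1 t p * rr p * angular_speed 1 p * angular_speed 2 p"
    "mink (normal_vec p) (pd 2 (pd 1 X) p) = - pd 1 t p * rr p * angular_speed 1 p * angular_speed 2 p"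
    "mink (normal_vec p) (pd 1 (pd 1 X) p) = normal_accel p - pd 1 t p * rr p * (angular_speed 1 p)\<^sup>2"
    by (simp_all add: n ca_v[OF p] cb_v[OF p] rr_v[OF p] t_v[OF p] normal_accel_def plane_accel_def
        power2_eq_square algebra_simps)
qed

lemma normal_sq_pos: "normal_sq p > 0" "angular_speed 2 p \<noteq> 0"
proof -
  have pos: "(rr p)\<^sup>2 * (angular_speed 2 p)\<^sup>2 * normal_sq p > 0"
  proof -
    have "(rr p)\<^sup>2 * (angular_speed 2 p)\<^sup>2 * normal_sq p = (normal_sq p + (drift p + rr p * angular_speed 1 p)\<^sup>2) * ((rr p)\<^sup>2 * (angular_speed 2 p)\<^sup>2)
        - (rr p * angular_speed 2 p * (drift p + rr p * angular_speed 1 p))\<^sup>2" by algebra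
    then show ?thesis using first_form_det_pos[OF p] unfolding first_form by simp
  qed
  then show o: "angular_speed 2 p \<noteq> 0" by auto
  then have "(rr p)\<^sup>2 * (angular_speed 2 p)\<^sup>2 > 0" using rr_nz[OF p] by simp
  then show "normal_sq p > 0" using pos zero_less_mult_pos by blast
qed

lemma gauss_curvature_zero:
  assumes "pd 1 t p = 0" shows "gauss_curvature X G p = 0"
proof -
  have "gauss_curvature X G p * ((rr p)\<^sup>2 * (angular_speed 2 p)\<^sup>2 * normal_sq p) * normal_sq p = 0"
    using curvatures_from_normal(2)[OF p normal_vec_orthogonal]
    unfolding normal_vec_norm first_form second_form using assms by algebra
  then show ?thesis using normal_sq_pos rr_pos[OF p] by simp
qed

text \<open>The Weingarten relation on a leaf. The angular speeds, which reflect the choice of the parameter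
on the leaf, cancel; what is left depends on \<open>v\<close> only through \<open>e\<close>.\<close>

lemma conic_identity:
  assumes lw: "a * mean_curvature X G p + b * gauss_curvature X G p = c"
  shows "a\<^sup>2 * (rr p * normal_accel p - pd 1 t p * (normal_sq p + (drift p)\<^sup>2))\<^sup>2 * normal_sq p
    = 4 * (c * rr p * (normal_sq p)\<^sup>2 + b * pd 1 t p * normal_accel p)\<^sup>2"
proof -
  have "(rr p * (angular_speed 2 p)\<^sup>2)\<^sup>2 * (a\<^sup>2 * (rr p * normal_accel p - pd 1 t p * (normal_sq p + (drift p)\<^sup>2))\<^sup>2 * normal_sq p)
    = (rr p * (angular_speed 2 p)\<^sup>2)\<^sup>2 * (4 * (c * rr p * (normal_sq p)\<^sup>2 + b * pd 1 t p * normal_accel p)\<^sup>2)"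
    using linear_weingarten_squared[OF p normal_vec_orthogonal lw]
    unfolding normal_vec_norm first_form second_form by algebra
  then show ?thesis using normal_sq_pos rr_pos[OF p] by simp
qed

end

text \<open>Quadratic terms in \<open>e\<close> cancel here, because \<open>\<epsilon> \<langle>c', e\<rangle>\<^sup>2 + drift\<^sup>2 = \<langle>c', c'\<rangle>\<close> is constant on the leaf.\<close>

lemma normal_sq_plus_drift:
  assumes "p \<in> D"
  shows "normal_sq p + (drift p)\<^sup>2 = \<epsilon> * (pd 1 rr p)\<^sup>2 + (pd 1 ca p)\<^sup>2 + \<epsilon> * (pd 1 cb p)\<^sup>2 - \<epsilon> * (pd 1 t p)\<^sup>2
    + 2 * pd 1 rr p * pd 1 ca p * e1 p + 2 * pd 1 rr p * \<epsilon> * pd 1 cb p * e2 p"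
  unfolding normal_sq_def drift_def radial_speed_def by (rule conic_frame_identities(8)[OF eps2(1) unit_e[OF assms]])

lemma infinite_leaf_directions:
  assumes "p \<in> D"
  shows "infinite ((\<lambda>q. (e1 q, e2 q)) ` {q \<in> D. q$1 = p$1})"
proof
  assume fin: "finite ((\<lambda>q. (e1 q, e2 q)) ` {q \<in> D. q$1 = p$1})"
  have "finite (e1 ` {q \<in> D. q$1 = p$1})" "finite (e2 ` {q \<in> D. q$1 = p$1})"
    using finite_imageI[OF fin, of fst] finite_imageI[OF fin, of snd] by (simp_all add: image_image)
  then have "pd 2 e1 p = 0" "pd 2 e2 p = 0"
    using infinite_on_leaf[OF open_D connected_leaf assms] smooth_differentiable[OF smooth_e(1)]
      smooth_differentiable[OF smooth_e(2)] by blast+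
  then have "e1 p = 0" "e2 p = 0" using normal_sq_pos[OF assms] eps2 by (auto simp: pd_e[OF assms])
  then show False using unit_e[OF assms] eps2 by simp
qed

text \<open>On one leaf, all quantities in the relation are functions of \<open>e\<close> with constant coefficients: affine
ones, and the quadratic \<open>normal_sq\<close>. If the centre moves, \<open>radial_speed\<close> is not constant. Then
\<open>c \<noteq> 0\<close> contradicts the comparison of degrees. For \<open>c = 0\<close>, the affine function
\<open>rr \<cdot> normal_accel - t' (normal_sq + drift\<^sup>2)\<close> vanishes, hence so does \<open>normal_accel\<close>, and
\<open>normal_sq + drift\<^sup>2 > 0\<close> is violated.\<close>

lemma centre_stationary:
  assumes lw: "\<And>p. p \<in> D \<Longrightarrow> a * mean_curvature X G p + b * gauss_curvature X G p = c"
    and nt: "c \<noteq> 0 \<or> (a \<noteq> 0 \<and> b \<noteq> 0 \<and> pd 1 t p \<noteq> 0)" and p: "p \<in> D"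
  shows "pd 1 ca p = 0 \<and> pd 1 cb p = 0"
proof (rule ccontr)
  assume ne: "\<not> (pd 1 ca p = 0 \<and> pd 1 cb p = 0)"
  define Z where "Z = (\<lambda>q. (e1 q, e2 q)) ` {q \<in> D. q$1 = p$1}"
  have Z: "infinite Z" unfolding Z_def by (rule infinite_leaf_directions[OF p])
  have cn: "s\<^sup>2 + \<epsilon> * t\<^sup>2 = \<epsilon>" if "(s, t) \<in> Z" for s t
    using that by (auto simp: Z_def unit_e)
  define r h r1 h2 where "r = rr p" and "h = pd 1 t p" and "r1 = pd 1 rr p" and "h2 = pd 1 (pd 1 t) p"
  \<comment> \<open>The coefficients of \<open>normal_accel\<close>, of \<open>rr \<cdot> normal_accel - t' (normal_sq + drift\<^sup>2)\<close> and of
    \<open>radial_speed\<close> as affine functions of \<open>e\<close>.\<close>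
  define m0 m1 m2 where "m0 = \<epsilon> * h * pd 1 (pd 1 rr) p - \<epsilon> * r1 * h2"
    and "m1 = h * pd 1 (pd 1 ca) p - pd 1 ca p * h2"
    and "m2 = \<epsilon> * (h * pd 1 (pd 1 cb) p - pd 1 cb p * h2)"
  define l0 l1 l2 where "l0 = r * m0 - h * (\<epsilon> * r1\<^sup>2 + (pd 1 ca p)\<^sup>2 + \<epsilon> * (pd 1 cb p)\<^sup>2 - \<epsilon> * h\<^sup>2)"
    and "l1 = r * m1 - h * (2 * r1 * pd 1 ca p)" and "l2 = r * m2 - h * (2 * r1 * \<epsilon> * pd 1 cb p)"
  define p1 p2 where "p1 = \<epsilon> * pd 1 ca p" and "p2 = pd 1 cb p"
  have leaf: "rr q = r \<and> pd 1 t q = h \<and> pd 1 rr q = r1 \<and> pd 1 (pd 1 t) q = h2 \<and> pd 1 ca q = pd 1 ca p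
      \<and> pd 1 cb q = pd 1 cb p \<and> pd 1 (pd 1 ca) q = pd 1 (pd 1 ca) p \<and> pd 1 (pd 1 cb) q = pd 1 (pd 1 cb) p
      \<and> pd 1 (pd 1 rr) q = pd 1 (pd 1 rr) p" if "q \<in> D" "q$1 = p$1" for q
  proof -
    have l1: "leafwise D (pd 1 f)" if "leafwise D f" "smooth_map_on f D" for f :: "real^2 \<Rightarrow> real"
      by (rule leafwise_pd_1[OF open_D that(1) smooth_differentiable[OF that(2)]])
    have l2: "leafwise D (pd 1 (pd 1 f))" if "leafwise D f" "smooth_map_on f D" for f :: "real^2 \<Rightarrow> real"
      by (rule l1[OF l1[OF that] smooth_pd[OF that(2)]])
    have e: "f q = f p" if "leafwise D f" for f :: "real^2 \<Rightarrow> real"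
      using that \<open>q \<in> D\<close> \<open>q$1 = p$1\<close> p unfolding leafwise_def by blast
    note lt = leafwise_t[folded t_def]
    show ?thesis unfolding r_def h_def r1_def h2_def
      using e[OF leafwise_c(3)] e[OF l1[OF lt smooth_xyt(3)]] e[OF l1[OF leafwise_c(3) smooth_centre_radius(3)]]
        e[OF l2[OF lt smooth_xyt(3)]] e[OF l1[OF leafwise_c(1) smooth_centre_radius(1)]]
        e[OF l1[OF leafwise_c(2) smooth_centre_radius(2)]] e[OF l2[OF leafwise_c(1) smooth_centre_radius(1)]]
        e[OF l2[OF leafwise_c(2) smooth_centre_radius(2)]] e[OF l2[OF leafwise_c(3) smooth_centre_radius(3)]]
      by blast
  qed
  have exp: "radial_speed q = r1 + p1 * e1 q + p2 * e2 q" "normal_sq q = \<epsilon> * ((r1 + p1 * e1 q + p2 * e2 q)\<^sup>2 - h\<^sup>2)"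
      "normal_accel q = m0 + m1 * e1 q + m2 * e2 q"
      "rr q * normal_accel q - pd 1 t q * (normal_sq q + (drift q)\<^sup>2) = l0 + l1 * e1 q + l2 * e2 q"
    if q: "q \<in> D" "q$1 = p$1" for q
  proof -
    note lf = leaf[OF q]
    show 1: "radial_speed q = r1 + p1 * e1 q + p2 * e2 q"
      using eps2 unfolding radial_speed_def p1_def p2_def by (simp add: lf) algebra
    show "normal_sq q = \<epsilon> * ((r1 + p1 * e1 q + p2 * e2 q)\<^sup>2 - h\<^sup>2)"
      unfolding normal_sq_def 1 by (simp add: lf)
    show 2: "normal_accel q = m0 + m1 * e1 q + m2 * e2 q"
      using eps2 unfolding normal_accel_def plane_accel_def radial_speed_def m0_def m1_def m2_def by (simp add: lf) algebra
    show "rr q * normal_accel q - pd 1 t q * (normal_sq q + (drift q)\<^sup>2) = l0 + l1 * e1 q + l2 * e2 q"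
      unfolding 2 normal_sq_plus_drift[OF q(1)] l0_def l1_def l2_def by (simp add: lf algebra_simps)
  qed
  have eq: "a\<^sup>2 * (l0 + l1 * s + l2 * w)\<^sup>2 * (\<epsilon> * ((r1 + p1 * s + p2 * w)\<^sup>2 - h\<^sup>2))
      = 4 * (c * r * (\<epsilon> * ((r1 + p1 * s + p2 * w)\<^sup>2 - h\<^sup>2))\<^sup>2 + b * h * (m0 + m1 * s + m2 * w))\<^sup>2"
    if sw: "(s, w) \<in> Z" for s w
  proof -
    obtain q where q: "q \<in> D" "q$1 = p$1" "s = e1 q" "w = e2 q" using sw by (auto simp: Z_def)
    have "rr q = r" "pd 1 t q = h" using leaf[OF q(1,2)] by simp_all
    then show ?thesis
      using conic_identity[OF q(1) lw[OF q(1)]] unfolding exp(2-4)[OF q(1,2)] q(3,4)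
      using exp(4)[OF q(1,2)] exp(2,3)[OF q(1,2)] by simp
  qed
  have pnz: "p1 \<noteq> 0 \<or> p2 \<noteq> 0" using ne eps2 by (auto simp: p1_def p2_def)
  show False
  proof (cases "c = 0")
    case False
    then have cr: "c * r \<noteq> 0" using rr_pos[OF p] by (simp add: r_def)
    obtain \<iota> :: complex where i: "\<iota>\<^sup>2 = - of_real \<epsilon>"
      using eps by (auto intro: that[of \<i>] that[of 1])
    have "of_real p1 + of_real p2 / \<iota> = 0"
      by (rule conic_leading_zero[OF i eps2(1) Z cn eq cr])
    moreover have "of_real p1 + of_real p2 / (- \<iota>) = 0"
      by (rule conic_leading_zero[OF _ eps2(1) Z cn eq cr]) (simp add: i)
    ultimately have "of_real p1 = (0 :: complex)" "of_real p2 / \<iota> = 0" by (auto simp: field_simps)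
    moreover have "\<iota> \<noteq> 0" using i eps2 by auto
    ultimately show False using pnz by simp
  next
    case True
    then have nz: "a \<noteq> 0" "b \<noteq> 0" "h \<noteq> 0" using nt by (auto simp: h_def)
    have k: "4 * b\<^sup>2 * h\<^sup>2 > 0" using nz by simp
    have eq': "a\<^sup>2 * (l0 + l1 * s + l2 * w)\<^sup>2 * (\<epsilon> * ((r1 + p1 * s + p2 * w)\<^sup>2 - h\<^sup>2))
        = (4 * b\<^sup>2 * h\<^sup>2) * (m0 + m1 * s + m2 * w)\<^sup>2" if "(s, w) \<in> Z" for s w
      using eq[OF that] True by (simp add: power_mult_distrib)
    have "l0 = 0 \<and> l1 = 0 \<and> l2 = 0"
      using eps
    proof
      assume e: "\<epsilon> = 1"
      show ?thesis
        by (rule conic_zero_spacelike[OF Z _ _ nz(1,3) k pnz]) (use cn eq' e in auto)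
    next
      assume e: "\<epsilon> = -1"
      show ?thesis
        by (rule conic_zero_timelike[OF Z _ _ nz(1) k pnz]) (use cn eq' e in \<open>force+\<close>)
    qed
    then have L: "rr p * normal_accel p - pd 1 t p * (normal_sq p + (drift p)\<^sup>2) = 0" using exp(4)[OF p] by simp
    then have "normal_accel p = 0" using conic_identity[OF p lw[OF p]] True nz by (simp add: h_def)
    then have "normal_sq p + (drift p)\<^sup>2 = 0" using L nz by (simp add: h_def)
    then show False using normal_sq_pos[OF p] by (smt (verit) zero_le_power2)
  qed
qed

text \<open>A leaf with \<open>t' = 0\<close> is one along which the surface is tangent to the plane of the leaf. For \<open>c = 0\<close>
the relation is homogeneous in \<open>(H, K)\<close>, and planes satisfy it. The second derivative of \<open>t\<close> enters it with a
coefficient that does not vanish near such a leaf, so \<open>\<bar>t''\<bar> \<le> K \<bar>t'\<bar>\<close> there. By uniqueness for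
this differential inequality, the set \<open>t' = 0\<close> is open as well as closed.\<close>

lemma height_speed_dichotomy:
  assumes e1: "\<epsilon> = 1" and ab: "a \<noteq> 0" "b \<noteq> 0"
    and lw: "\<And>p. p \<in> D \<Longrightarrow> a * mean_curvature X G p + b * gauss_curvature X G p = 0"
  shows "(\<forall>p\<in>D. pd 1 t p = 0) \<or> (\<forall>p\<in>D. pd 1 t p \<noteq> 0)"
proof -
  define Q where "Q = (\<lambda>q. normal_sq q + (drift q)\<^sup>2)"
  define \<kappa> where "\<kappa> = (\<lambda>q. (\<bar>plane_accel q\<bar> + 2 * Q q / rr q) / \<bar>radial_speed q\<bar>)"
  have radial_speed_nonzero: "radial_speed q \<noteq> 0" if "q \<in> D" for q
  proof
    assume "radial_speed q = 0"
    then have "normal_sq q = - (pd 1 t q)\<^sup>2" unfolding normal_sq_def using e1 by simp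
    then show False using normal_sq_pos(1)[OF that] zero_le_power2[of "pd 1 t q"] by linarith
  qed
  have bound: "\<bar>pd 1 (pd 1 t) q\<bar> \<le> \<kappa> q * \<bar>pd 1 t q\<bar>"
    if q: "q \<in> D" and small: "16 * b\<^sup>2 * (pd 1 t q)\<^sup>2 < a\<^sup>2 * normal_sq q * (rr q)\<^sup>2" for q
  proof -
    define h M r W where "h = pd 1 t q" and "M = normal_accel q" and "r = rr q" and "W = normal_sq q"
    have W: "W > 0" using normal_sq_pos[OF q] by (simp add: W_def)
    have r: "r > 0" using rr_pos[OF q] by (simp add: r_def)
    have Q: "Q q > 0" using W by (simp add: Q_def W_def add_pos_nonneg)
    have id: "a\<^sup>2 * W * (r * M - h * Q q)\<^sup>2 = 4 * b\<^sup>2 * h\<^sup>2 * M\<^sup>2"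
      using conic_identity[OF q lw[OF q]] unfolding Q_def h_def M_def r_def W_def by algebra
    \<comment> \<open>Solve the relation for \<open>M\<close>: its term with \<open>b\<close> is absorbed because \<open>h\<close> is small.\<close>
    have "(r * M)\<^sup>2 \<le> 2 * (r * M - h * Q q)\<^sup>2 + 2 * (h * Q q)\<^sup>2"
    proof -
      have "2 * (r * M - h * Q q)\<^sup>2 + 2 * (h * Q q)\<^sup>2 - (r * M)\<^sup>2 = (r * M - 2 * (h * Q q))\<^sup>2" by algebra
      then show ?thesis by (smt (verit) zero_le_power2)
    qed
    then have "a\<^sup>2 * W * (r * M)\<^sup>2 \<le> a\<^sup>2 * W * (2 * (r * M - h * Q q)\<^sup>2 + 2 * (h * Q q)\<^sup>2)"
      using W by (intro mult_left_mono) auto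
    also have "\<dots> = 8 * b\<^sup>2 * h\<^sup>2 * M\<^sup>2 + 2 * a\<^sup>2 * W * (h * Q q)\<^sup>2" using id by algebra
    also have "\<dots> \<le> a\<^sup>2 * W * (r * M)\<^sup>2 / 2 + 2 * a\<^sup>2 * W * (h * Q q)\<^sup>2"
    proof -
      have "16 * b\<^sup>2 * h\<^sup>2 * M\<^sup>2 \<le> a\<^sup>2 * W * r\<^sup>2 * M\<^sup>2"
        using small unfolding h_def W_def r_def by (intro mult_right_mono) auto
      then show ?thesis by (simp add: power_mult_distrib algebra_simps)
    qed
    finally have "(a\<^sup>2 * W) * (r * M)\<^sup>2 \<le> (a\<^sup>2 * W) * (2 * (h * Q q))\<^sup>2"
      by (simp add: power_mult_distrib)
    then have "(r * M)\<^sup>2 \<le> (2 * (h * Q q))\<^sup>2" using ab W by (simp add: mult_le_cancel_left)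
    then have "\<bar>r * M\<bar> \<le> \<bar>2 * (h * Q q)\<bar>" by (simp only: abs_le_square_iff)
    then have M: "\<bar>M\<bar> \<le> \<bar>h\<bar> * (2 * Q q / r)" using r Q by (simp add: abs_mult field_simps)
    have "radial_speed q \<noteq> 0" using radial_speed_nonzero[OF q] .
    then have radial_speed: "\<bar>radial_speed q\<bar> > 0" by simp
    have "radial_speed q * pd 1 (pd 1 t) q = h * plane_accel q - M" 
      unfolding M_def normal_accel_def h_def using e1 by simp
    then have "\<bar>radial_speed q\<bar> * \<bar>pd 1 (pd 1 t) q\<bar> \<le> \<bar>h\<bar> * \<bar>plane_accel q\<bar> + \<bar>M\<bar>"
      by (metis abs_mult abs_triangle_ineq4)
    also have "\<dots> \<le> \<bar>h\<bar> * (\<bar>plane_accel q\<bar> + 2 * Q q / r)" using M by (simp add: distrib_left)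
    finally show ?thesis using radial_speed by (simp add: \<kappa>_def h_def r_def field_simps)
  qed
  have cont: "isCont f p" if "smooth_map_on f D" "p \<in> D" for f :: "real^2 \<Rightarrow> real" and p
    using smooth_differentiable[OF that] by (rule differentiable_imp_continuous_within)
  have near: "\<exists>U. open U \<and> p \<in> U \<and> (\<forall>q\<in>U \<inter> D. pd 1 t q = 0)" if p: "p \<in> D" and z: "pd 1 t p = 0" for p
  proof -
    note sm = smooth_centre_radius smooth_xyt smooth_e
    note ct = cont[OF _ p]
    have c1: "isCont (\<lambda>q. a\<^sup>2 * normal_sq q * (rr q)\<^sup>2 - 16 * b\<^sup>2 * (pd 1 t q)\<^sup>2) p"
      unfolding normal_sq_def radial_speed_def by (intro continuous_intros ct sm smooth_pd)
    have "radial_speed p \<noteq> 0" using radial_speed_nonzero[OF p] .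
    then have c2: "isCont \<kappa> p"
      unfolding \<kappa>_def Q_def plane_accel_def normal_sq_def drift_def radial_speed_def
      by (intro continuous_intros ct sm smooth_pd) (auto simp: rr_nz[OF p])
    have "eventually (\<lambda>q. a\<^sup>2 * normal_sq q * (rr q)\<^sup>2 - 16 * b\<^sup>2 * (pd 1 t q)\<^sup>2 > 0) (nhds p)"
    proof (rule order_tendstoD(1))
      show "((\<lambda>q. a\<^sup>2 * normal_sq q * (rr q)\<^sup>2 - 16 * b\<^sup>2 * (pd 1 t q)\<^sup>2)
          \<longlongrightarrow> a\<^sup>2 * normal_sq p * (rr p)\<^sup>2 - 16 * b\<^sup>2 * (pd 1 t p)\<^sup>2) (nhds p)"
        using c1 by (simp add: isCont_def tendsto_nhds_iff)
      show "0 < a\<^sup>2 * normal_sq p * (rr p)\<^sup>2 - 16 * b\<^sup>2 * (pd 1 t p)\<^sup>2"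
        using z ab normal_sq_pos[OF p] rr_nz[OF p] by simp
    qed
    moreover have "eventually (\<lambda>q. \<kappa> q < \<kappa> p + 1) (nhds p)"
      by (rule order_tendstoD(2)[where y = "\<kappa> p"]) (use c2 in \<open>simp_all add: isCont_def tendsto_nhds_iff\<close>)
    moreover have "eventually (\<lambda>q. q \<in> D) (nhds p)" using open_D p eventually_nhds by blast
    ultimately have "eventually (\<lambda>q. q \<in> D \<and> \<bar>pd 1 (pd 1 t) q\<bar> \<le> (\<kappa> p + 1) * \<bar>pd 1 t q\<bar>) (nhds p)"
    proof eventually_elim
      case (elim q)
      then have "\<bar>pd 1 (pd 1 t) q\<bar> \<le> \<kappa> q * \<bar>pd 1 t q\<bar>" by (intro bound) auto
      also have "\<dots> \<le> (\<kappa> p + 1) * \<bar>pd 1 t q\<bar>" using elim by (intro mult_right_mono) auto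
      finally show ?case using elim by simp
    qed
    then obtain U where U: "open U" "p \<in> U"
      "\<And>q. q \<in> U \<Longrightarrow> q \<in> D \<and> \<bar>pd 1 (pd 1 t) q\<bar> \<le> (\<kappa> p + 1) * \<bar>pd 1 t q\<bar>"
      unfolding eventually_nhds by blast
    have "eventually (\<lambda>s. p + s *\<^sub>R axis 1 1 \<in> U) (nhds 0)" by (rule eventually_in_open_along[OF U(1,2)])
    then obtain d where d: "d > 0" "\<And>s. \<bar>s\<bar> < d \<Longrightarrow> p + s *\<^sub>R axis 1 1 \<in> U"
      unfolding eventually_nhds_metric by (auto simp: dist_real_def)
    have zero: "pd 1 t (p + s *\<^sub>R axis 1 1) = 0" if "\<bar>s\<bar> < d" for s
    proof (rule gronwall_zero[of d "\<lambda>s. pd 1 t (p + s *\<^sub>R axis 1 1)" "\<lambda>s. pd 1 (pd 1 t) (p + s *\<^sub>R axis 1 1)" "\<kappa> p + 1"])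
      fix s :: real assume "\<bar>s\<bar> < d"
      then have q: "p + s *\<^sub>R axis 1 1 \<in> D"
        "\<bar>pd 1 (pd 1 t) (p + s *\<^sub>R axis 1 1)\<bar> \<le> (\<kappa> p + 1) * \<bar>pd 1 t (p + s *\<^sub>R axis 1 1)\<bar>"
        using U(3) d(2) by blast+
      show "((\<lambda>s. pd 1 t (p + s *\<^sub>R axis 1 1)) has_real_derivative pd 1 (pd 1 t) (p + s *\<^sub>R axis 1 1)) (at s)"
        by (rule has_real_derivative_along[OF diff_pd_xyt(3)[OF q(1)]])
      show "\<bar>pd 1 (pd 1 t) (p + s *\<^sub>R axis 1 1)\<bar> \<le> (\<kappa> p + 1) * \<bar>pd 1 t (p + s *\<^sub>R axis 1 1)\<bar>" by (rule q(2))
    qed (use z that in auto)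
    have lw: "leafwise D (pd 1 t)"
      by (rule leafwise_pd_1[OF open_D leafwise_t[folded t_def] diff_xyt(3)])
    have "pd 1 t q = 0" if q: "q \<in> D" "\<bar>q$1 - p$1\<bar> < d" for q
    proof -
      have "p + (q$1 - p$1) *\<^sub>R axis 1 1 \<in> D" using U(3) d(2) q(2) by blast
      moreover have "(p + (q$1 - p$1) *\<^sub>R axis 1 1) $ 1 = q $ 1" by (simp add: axis_def)
      ultimately have "pd 1 t q = pd 1 t (p + (q$1 - p$1) *\<^sub>R axis 1 1)"
        using lw q(1) unfolding leafwise_def by metis
      then show ?thesis using zero[OF q(2)] by simp
    qed
    moreover have "\<bar>q$1 - p$1\<bar> < d" if "q \<in> ball p d" for q
      using that component_le_norm_cart[of "q - p" 1] by (simp add: dist_norm norm_minus_commute)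
    ultimately show ?thesis using d(1) by (intro exI[of _ "ball p d"]) auto
  qed
  define A where "A = {p \<in> D. pd 1 t p = 0}"
  have "open A"
    unfolding open_subopen[of A]
  proof
    fix p assume "p \<in> A"
    then obtain U where "open U" "p \<in> U" "\<forall>q\<in>U \<inter> D. pd 1 t q = 0" using near[of p] by (auto simp: A_def)
    then show "\<exists>T. open T \<and> p \<in> T \<and> T \<subseteq> A"
      using \<open>p \<in> A\<close> open_D by (intro exI[of _ "U \<inter> D"]) (auto simp: A_def)
  qed
  moreover have "open {p \<in> D. pd 1 t p \<noteq> 0}"
  proof -
    have "continuous_on D (pd 1 t)" by (rule smooth_continuous[OF smooth_pd[OF smooth_xyt(3)]])
    then have "open (D \<inter> pd 1 t -` (- {0}))"
      by (rule continuous_open_preimage[OF _ open_D]) (simp add: open_Compl)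
    moreover have "{p \<in> D. pd 1 t p \<noteq> 0} = D \<inter> pd 1 t -` (- {0})" by auto
    ultimately show ?thesis by simp
  qed
  ultimately have "A \<inter> D = {} \<or> {p \<in> D. pd 1 t p \<noteq> 0} \<inter> D = {}"
    by (intro connectedD[OF connected_D]) (auto simp: A_def)
  then show ?thesis by (auto simp: A_def)
qed

lemma centre_constant:
  assumes "\<And>p. p \<in> D \<Longrightarrow> pd 1 ca p = 0 \<and> pd 1 cb p = 0"
  shows "\<exists>A B. \<forall>p\<in>D. ca p = A \<and> cb p = B"
proof -
  have z: "pd i ca p = 0 \<and> pd i cb p = 0" if "p \<in> D" for i p
    using exhaust_2[of i] assms[OF that] ca_v[OF that] cb_v[OF that] by auto
  have "ca p = ca q \<and> cb p = cb q" if "p \<in> D" "q \<in> D" for p q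
    using constant_if_pd_zero[OF open_D connected_D, of ca, OF smooth_differentiable[OF smooth_centre_radius(1)] _ that]
      constant_if_pd_zero[OF open_D connected_D, of cb, OF smooth_differentiable[OF smooth_centre_radius(2)] _ that] z
    by blast
  then show ?thesis by metis
qed

end

section \<open>Leaves in lightlike planes\<close>

text \<open>The expressions built from the first and second fundamental forms of a surface \<open>z = A x\<^sup>2 + B x + C\<close> in
the metric \<open>dx\<^sup>2 + dy dz\<close>. Here \<open>s\<close> is the slope of \<open>z\<close> along the leaf, \<open>\<phi>\<close>, \<open>g\<close>, \<open>f\<close> stand for the derivatives of
\<open>z\<close> of types \<open>u\<close>, \<open>ux\<close>, \<open>uu\<close> at fixed \<open>x\<close>, and \<open>h\<close>, \<open>k\<close> for the first two derivatives of \<open>y\<close>. The common factor is the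
squared speed \<open>xv\<^sup>2\<close> along the leaf.\<close>
lemma parabola_form_identities:
  fixes A s h k xu xv \<phi> g f :: real
  defines "W \<equiv> h * \<phi> - h\<^sup>2 * s\<^sup>2 / 4"
    and "H \<equiv> h * f / 2 - \<phi> * k / 2 - h\<^sup>2 * s * g / 2 + h\<^sup>2 * \<phi> * A"
    and "K \<equiv> h * A * (h * f / 2 - \<phi> * k / 2) - h\<^sup>2 * g\<^sup>2 / 4"
  shows "(xu\<^sup>2 + h * (s * xu + \<phi>)) * xv\<^sup>2 - (xv * (xu + h * s / 2))\<^sup>2 = xv\<^sup>2 * W"
    and "xv\<^sup>2 * (h * (A * xu\<^sup>2 + g * xu + f / 2) - \<phi> * k / 2)
      - (xv * (xu + h * s / 2)) * (h * xv * (A * xu + g / 2) + h * xv * (A * xu + g / 2))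
      + (xu\<^sup>2 + h * (s * xu + \<phi>)) * (h * A * xv\<^sup>2) = xv\<^sup>2 * H"
    and "(h * (A * xu\<^sup>2 + g * xu + f / 2) - \<phi> * k / 2) * (h * A * xv\<^sup>2)
      - (h * xv * (A * xu + g / 2)) * (h * xv * (A * xu + g / 2)) = xv\<^sup>2 * K"
  unfolding W_def H_def K_def by (simp_all add: power2_eq_square field_simps)

text \<open>Passing from derivatives with respect to \<open>u\<close> to derivatives with respect to \<open>y\<close> only multiplies the
relation by a power of \<open>h = dy/du\<close>.\<close>

lemma parabola_scaling:
  fixes a b c h D N1 N2 xv :: real
  assumes "h \<noteq> 0" "xv \<noteq> 0"
    and "a\<^sup>2 * (xv\<^sup>2 * (h^3 * N1 / 2))\<^sup>2 * (h\<^sup>2 * D)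
      = 4 * (c * (xv\<^sup>2 * (h\<^sup>2 * D)) * (h\<^sup>2 * D) - b * (xv\<^sup>2 * (h^4 * N2 / 4)))\<^sup>2"
  shows "a\<^sup>2 * N1\<^sup>2 * D = (4 * c * D\<^sup>2 - b * N2)\<^sup>2"
proof -
  have l: "a\<^sup>2 * (xv\<^sup>2 * (h^3 * N1 / 2))\<^sup>2 * (h\<^sup>2 * D) = ((xv\<^sup>2 * h^4)\<^sup>2 / 4) * (a\<^sup>2 * N1\<^sup>2 * D)"
    by (simp add: power2_eq_square power3_eq_cube power4_eq_xxxx)
  have r: "4 * (c * (xv\<^sup>2 * (h\<^sup>2 * D)) * (h\<^sup>2 * D) - b * (xv\<^sup>2 * (h^4 * N2 / 4)))\<^sup>2
      = ((xv\<^sup>2 * h^4)\<^sup>2 / 4) * (4 * c * D\<^sup>2 - b * N2)\<^sup>2"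
    by (simp add: power2_eq_square power4_eq_xxxx field_simps)
  have "((xv\<^sup>2 * h^4)\<^sup>2 / 4) * (a\<^sup>2 * N1\<^sup>2 * D) = ((xv\<^sup>2 * h^4)\<^sup>2 / 4) * (4 * c * D\<^sup>2 - b * N2)\<^sup>2"
    using assms(3) unfolding l r .
  then show ?thesis using assms(1,2) by simp
qed

text \<open>For lightlike planes, null coordinates \<open>y = x\<^sub>2 - x\<^sub>3\<close> (constant on leaves) and \<open>z = x\<^sub>2 + x\<^sub>3\<close> are used; the
metric is \<open>dx\<^sup>2 + dy dz\<close>, and a leaf is a parabola over the \<open>x\<close>-axis.\<close>

locale parabola_leaves = leaved_surface +
  fixes qa qb qc :: "real^2 \<Rightarrow> real"
  assumes leafwise_y: "leafwise D (\<lambda>p. X p $ 2 - X p $ 3)"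
    and leafwise_q: "leafwise D qa" "leafwise D qb" "leafwise D qc"
    and qa_nz: "\<And>p. p \<in> D \<Longrightarrow> qa p \<noteq> 0"
    and parabola: "\<And>p. p \<in> D \<Longrightarrow> X p $ 2 + X p $ 3 = qa p * (X p $ 1)\<^sup>2 + qb p * X p $ 1 + qc p"
begin

definition "x = (\<lambda>p. X p $ 1)"
definition "y = (\<lambda>p. X p $ 2 - X p $ 3)"
definition "z = (\<lambda>p. X p $ 2 + X p $ 3)"

lemma smooth_xyz: "smooth_map_on x D" "smooth_map_on y D" "smooth_map_on z D"
  unfolding x_def y_def z_def by (intro smooth_add smooth_diff smooth_coord open_D)+

lemmas diff_xyz = smooth_differentiable[OF smooth_xyz(1)] smooth_differentiable[OF smooth_xyz(2)]
  smooth_differentiable[OF smooth_xyz(3)]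
lemmas diff_pd_xyz = smooth_differentiable[OF smooth_pd[OF smooth_xyz(1)]]
  smooth_differentiable[OF smooth_pd[OF smooth_xyz(2)]] smooth_differentiable[OF smooth_pd[OF smooth_xyz(3)]]

lemmas y_v = leafwise_second_pds[OF open_D leafwise_y[folded y_def] smooth_xyz(2)]

lemma mink_null: "mink a b = a$1 * b$1 + ((a$2 - a$3) * (b$2 + b$3) + (a$2 + a$3) * (b$2 - b$3)) / 2"
  by (simp add: mink_def field_simps)

lemma pd_null_coords:
  assumes p: "p \<in> D"
  shows "pd i X p $ 1 = pd i x p" "pd i X p $ 2 - pd i X p $ 3 = pd i y p"
    "pd i X p $ 2 + pd i X p $ 3 = pd i z p"
  using smooth_differentiable[OF smooth_coord p]
  by (simp_all add: pd_coord[OF p] x_def y_def z_def pd_add pd_diff)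

lemma pd_pd_null_coords:
  assumes p: "p \<in> D"
  shows "pd i (pd j X) p $ 1 = pd i (pd j x) p"
    "pd i (pd j X) p $ 2 - pd i (pd j X) p $ 3 = pd i (pd j y) p"
    "pd i (pd j X) p $ 2 + pd i (pd j X) p $ 3 = pd i (pd j z) p"
proof -
  note d = smooth_differentiable[OF smooth_pd[OF smooth_coord] p]
  have "pd i (pd j y) p = pd i (\<lambda>p. pd j (\<lambda>p. X p $ 2) p - pd j (\<lambda>p. X p $ 3) p) p"
    by (rule pd_cong[OF open_D p]) (simp add: y_def pd_diff smooth_differentiable[OF smooth_coord])
  moreover have "pd i (pd j z) p = pd i (\<lambda>p. pd j (\<lambda>p. X p $ 2) p + pd j (\<lambda>p. X p $ 3) p) p"
    by (rule pd_cong[OF open_D p]) (simp add: z_def pd_add smooth_differentiable[OF smooth_coord])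
  ultimately show "pd i (pd j X) p $ 1 = pd i (pd j x) p"
    "pd i (pd j X) p $ 2 - pd i (pd j X) p $ 3 = pd i (pd j y) p"
    "pd i (pd j X) p $ 2 + pd i (pd j X) p $ 3 = pd i (pd j z) p"
    using d by (simp_all add: pd_pd_coord[OF p] x_def pd_add pd_diff)
qed

lemma x_v_nz: assumes "p \<in> D" shows "pd 2 x p \<noteq> 0"
  using first_form_diag_pos[OF assms, of 2]
  by (auto simp: mink_null pd_null_coords[OF assms] y_v[OF assms])

lemma leaf_along:
  assumes "p \<in> D"
  shows "eventually (\<lambda>s. p + s *\<^sub>R axis 2 1 \<in> D \<and> qa (p + s *\<^sub>R axis 2 1) = qa p
      \<and> qb (p + s *\<^sub>R axis 2 1) = qb p \<and> qc (p + s *\<^sub>R axis 2 1) = qc p) (nhds 0)"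
  using eventually_in_open_along[OF open_D assms, of "axis 2 1"]
proof eventually_elim
  case (elim s)
  have "(p + s *\<^sub>R axis 2 1 :: real^2) $ 1 = p $ 1" by (simp add: axis_def)
  then show ?case using elim assms leafwise_q unfolding leafwise_def by blast
qed

definition "slope = (\<lambda>p. pd 2 z p / pd 2 x p)"

lemma smooth_slope: "smooth_map_on slope D"
  unfolding slope_def by (intro smooth_divide smooth_pd smooth_xyz open_D x_v_nz)

text \<open>The coefficients of the parabola are constant along the leaf. Differentiating its equation along the leaf, twice,
recovers them from derivatives of \<open>X\<close>, and so they are smooth.\<close>

lemma slope_eq: assumes p: "p \<in> D" shows "slope p = 2 * qa p * x p + qb p"
proof -
  have "pd 2 z p = pd 2 (\<lambda>q. qa p * (x q)\<^sup>2 + qb p * x q + qc p) p"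
  proof (rule pd_eq_along)
    show "eventually (\<lambda>s. z (p + s *\<^sub>R axis 2 1) = qa p * (x (p + s *\<^sub>R axis 2 1))\<^sup>2
        + qb p * x (p + s *\<^sub>R axis 2 1) + qc p) (nhds 0)"
      using leaf_along[OF p] by eventually_elim (use parabola x_def z_def in metis)
  qed (use p diff_xyz in \<open>auto intro!: derivative_intros\<close>)
  also have "\<dots> = (2 * qa p * x p + qb p) * pd 2 x p"
    using diff_xyz(1)[OF p] by (simp add: pd_add pd_mult pd_power2 algebra_simps)
  finally show ?thesis using x_v_nz[OF p] by (simp add: slope_def)
qed

lemma qa_eq: assumes p: "p \<in> D" shows "qa p = pd 2 slope p / (2 * pd 2 x p)"
proof -
  have "pd 2 slope p = pd 2 (\<lambda>q. 2 * qa p * x q + qb p) p"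
  proof (rule pd_eq_along)
    show "eventually (\<lambda>s. slope (p + s *\<^sub>R axis 2 1) = 2 * qa p * x (p + s *\<^sub>R axis 2 1) + qb p) (nhds 0)"
      using leaf_along[OF p] by eventually_elim (use slope_eq in metis)
  qed (use p diff_xyz smooth_differentiable[OF smooth_slope p] in \<open>auto intro!: derivative_intros\<close>)
  then show ?thesis using diff_xyz(1)[OF p] x_v_nz[OF p] by (simp add: pd_add pd_mult)
qed

lemma smooth_q: "smooth_map_on qa D" "smooth_map_on qb D" "smooth_map_on qc D"
proof -
  have "smooth_map_on (\<lambda>p. pd 2 slope p / (2 * pd 2 x p)) D"
    by (intro smooth_divide smooth_mult smooth_const smooth_pd smooth_xyz smooth_slope open_D)
       (simp add: x_v_nz)
  then show a: "smooth_map_on qa D"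
    using smooth_cong[OF open_D, of qa "\<lambda>p. pd 2 slope p / (2 * pd 2 x p)"] qa_eq by blast
  have "smooth_map_on (\<lambda>p. slope p - 2 * qa p * x p) D"
    by (intro smooth_diff smooth_mult smooth_const smooth_xyz smooth_slope a open_D)
  moreover have "qb p = slope p - 2 * qa p * x p" if "p \<in> D" for p using slope_eq[OF that] by simp
  ultimately show b: "smooth_map_on qb D"
    using smooth_cong[OF open_D, of qb "\<lambda>p. slope p - 2 * qa p * x p"] by blast
  have "smooth_map_on (\<lambda>p. z p - (qa p * (x p)\<^sup>2 + qb p * x p)) D"
    by (intro smooth_diff smooth_add smooth_mult smooth_power2 smooth_xyz a b open_D)
  moreover have "qc p = z p - (qa p * (x p)\<^sup>2 + qb p * x p)" if "p \<in> D" for p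
    using parabola[OF that] by (simp add: x_def z_def)
  ultimately show "smooth_map_on qc D"
    using smooth_cong[OF open_D, of qc "\<lambda>p. z p - (qa p * (x p)\<^sup>2 + qb p * x p)"] by blast
qed

lemmas diff_q = smooth_differentiable[OF smooth_q(1)] smooth_differentiable[OF smooth_q(2)]
  smooth_differentiable[OF smooth_q(3)]
lemmas diff_pd_q = smooth_differentiable[OF smooth_pd[OF smooth_q(1)]]
  smooth_differentiable[OF smooth_pd[OF smooth_q(2)]] smooth_differentiable[OF smooth_pd[OF smooth_q(3)]]
lemmas qa_v = leafwise_second_pds[OF open_D leafwise_q(1) smooth_q(1)]
lemmas qb_v = leafwise_second_pds[OF open_D leafwise_q(2) smooth_q(2)]
lemmas qc_v = leafwise_second_pds[OF open_D leafwise_q(3) smooth_q(3)]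

text \<open>Derivatives of \<open>z = qa x\<^sup>2 + qb x + qc\<close> with respect to \<open>u\<close> at a fixed value of \<open>x\<close>, and
the derivative of the first of them with respect to \<open>x\<close>.\<close>

definition "z_u = (\<lambda>p. pd 1 qa p * (x p)\<^sup>2 + pd 1 qb p * x p + pd 1 qc p)"
definition "z_ux p = 2 * pd 1 qa p * x p + pd 1 qb p"
definition "z_uu p = pd 1 (pd 1 qa) p * (x p)\<^sup>2 + pd 1 (pd 1 qb) p * x p + pd 1 (pd 1 qc) p"

lemma pd_z:
  assumes p: "p \<in> D"
  shows "pd 1 z p = slope p * pd 1 x p + z_u p" "pd 2 z p = slope p * pd 2 x p"
proof -
  have "pd i z p = pd i (\<lambda>q. qa q * (x q)\<^sup>2 + qb q * x q + qc q) p" for i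
    by (rule pd_cong[OF open_D p]) (use parabola x_def z_def in simp)
  then have "pd i z p = slope p * pd i x p + (pd i qa p * (x p)\<^sup>2 + pd i qb p * x p + pd i qc p)" for i
    using diff_q p diff_xyz
    by (simp add: pd_add pd_mult pd_power2 slope_eq differentiable_mult differentiable_add algebra_simps)
  then show "pd 1 z p = slope p * pd 1 x p + z_u p" "pd 2 z p = slope p * pd 2 x p"
    by (simp_all add: z_u_def qa_v[OF p] qb_v[OF p] qc_v[OF p])
qed

lemma pd_slope:
  assumes p: "p \<in> D"
  shows "pd 1 slope p = 2 * qa p * pd 1 x p + z_ux p" "pd 2 slope p = 2 * qa p * pd 2 x p"
proof -
  have "pd i slope p = pd i (\<lambda>q. 2 * qa q * x q + qb q) p" for i
    by (rule pd_cong[OF open_D p]) (rule slope_eq)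
  then have "pd i slope p = 2 * qa p * pd i x p + (2 * pd i qa p * x p + pd i qb p)" for i
    using diff_q p diff_xyz by (simp add: pd_add pd_mult differentiable_mult)
  then show "pd 1 slope p = 2 * qa p * pd 1 x p + z_ux p" "pd 2 slope p = 2 * qa p * pd 2 x p"
    by (simp_all add: z_ux_def qa_v[OF p] qb_v[OF p])
qed

lemma pd_pd_z:
  assumes p: "p \<in> D"
  shows "pd 2 (pd 2 z) p = 2 * qa p * (pd 2 x p)\<^sup>2 + slope p * pd 2 (pd 2 x) p"
    and "pd 1 (pd 2 z) p = (2 * qa p * pd 1 x p + z_ux p) * pd 2 x p + slope p * pd 1 (pd 2 x) p"
    and "pd 2 (pd 1 z) p = (2 * qa p * pd 1 x p + z_ux p) * pd 2 x p + slope p * pd 2 (pd 1 x) p"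
    and "pd 1 (pd 1 z) p = 2 * qa p * (pd 1 x p)\<^sup>2 + 2 * z_ux p * pd 1 x p + z_uu p + slope p * pd 1 (pd 1 x) p"
proof -
  note d = diff_pd_xyz[OF p] smooth_differentiable[OF smooth_slope p] diff_q[OF p] diff_pd_q[OF p] diff_xyz[OF p]
  have "pd i (pd 2 z) p = pd i (\<lambda>p. slope p * pd 2 x p) p" for i
    by (rule pd_cong[OF open_D p]) (rule pd_z(2))
  then show "pd 2 (pd 2 z) p = 2 * qa p * (pd 2 x p)\<^sup>2 + slope p * pd 2 (pd 2 x) p"
    "pd 1 (pd 2 z) p = (2 * qa p * pd 1 x p + z_ux p) * pd 2 x p + slope p * pd 1 (pd 2 x) p"
    using d by (simp_all add: pd_mult pd_slope[OF p] power2_eq_square algebra_simps)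
  have "pd i (pd 1 z) p = pd i (\<lambda>p. slope p * pd 1 x p + z_u p) p" for i
    by (rule pd_cong[OF open_D p]) (rule pd_z(1))
  then have e: "pd i (pd 1 z) p = slope p * pd i (pd 1 x) p + pd i slope p * pd 1 x p
      + (z_ux p * pd i x p + (pd i (pd 1 qa) p * (x p)\<^sup>2 + pd i (pd 1 qb) p * x p + pd i (pd 1 qc) p))" for i
    using d by (simp add: pd_add pd_mult pd_power2 z_u_def z_ux_def differentiable_mult differentiable_add algebra_simps)
  show "pd 2 (pd 1 z) p = (2 * qa p * pd 1 x p + z_ux p) * pd 2 x p + slope p * pd 2 (pd 1 x) p"
    by (simp add: e pd_slope[OF p] qa_v[OF p] qb_v[OF p] qc_v[OF p] algebra_simps)
  show "pd 1 (pd 1 z) p = 2 * qa p * (pd 1 x p)\<^sup>2 + 2 * z_ux p * pd 1 x p + z_uu p + slope p * pd 1 (pd 1 x) p"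
    by (simp add: e pd_slope[OF p] z_uu_def power2_eq_square algebra_simps)
qed

text \<open>In the coordinates \<open>(x, y, z)\<close> this is \<open>(- y' s / 2, y', - z_u)\<close> with the slope \<open>s\<close>.\<close>

definition "normal_vec p = (vector [- pd 1 y p * slope p / 2, (pd 1 y p - z_u p) / 2, (- z_u p - pd 1 y p) / 2] :: real^3)"

lemma normal_vec_null_coords: "normal_vec p $ 1 = - pd 1 y p * slope p / 2" "normal_vec p $ 2 - normal_vec p $ 3 = pd 1 y p"
  "normal_vec p $ 2 + normal_vec p $ 3 = - z_u p"
  by (simp_all add: normal_vec_def field_simps)

definition "normal_sq p = pd 1 y p * z_u p - (pd 1 y p)\<^sup>2 * (slope p)\<^sup>2 / 4"

context
  fixes p assumes p: "p \<in> D"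
begin

lemma normal_vec_orthogonal: "mink (normal_vec p) (pd 1 X p) = 0" "mink (normal_vec p) (pd 2 X p) = 0"
  by (simp_all add: mink_null normal_vec_null_coords pd_null_coords[OF p] pd_z[OF p] y_v[OF p] algebra_simps)

lemma normal_vec_norm: "- mink (normal_vec p) (normal_vec p) = normal_sq p"
  by (simp add: mink_null normal_vec_null_coords normal_sq_def power2_eq_square algebra_simps)

lemma first_form:
  "mink (pd 2 X p) (pd 2 X p) = (pd 2 x p)\<^sup>2"
  "mink (pd 1 X p) (pd 2 X p) = pd 2 x p * (pd 1 x p + pd 1 y p * slope p / 2)"
  "mink (pd 1 X p) (pd 1 X p) = (pd 1 x p)\<^sup>2 + pd 1 y p * (slope p * pd 1 x p + z_u p)"
  by (simp_all add: mink_null pd_null_coords[OF p] pd_z[OF p] y_v[OF p] power2_eq_square algebra_simps)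

lemma second_form:
  "mink (normal_vec p) (pd 2 (pd 2 X) p) = pd 1 y p * qa p * (pd 2 x p)\<^sup>2"
  "mink (normal_vec p) (pd 1 (pd 2 X) p) = pd 1 y p * pd 2 x p * (qa p * pd 1 x p + z_ux p / 2)"
  "mink (normal_vec p) (pd 2 (pd 1 X) p) = pd 1 y p * pd 2 x p * (qa p * pd 1 x p + z_ux p / 2)"
  "mink (normal_vec p) (pd 1 (pd 1 X) p) = pd 1 y p * (qa p * (pd 1 x p)\<^sup>2 + z_ux p * pd 1 x p + z_uu p / 2)
    - z_u p * pd 1 (pd 1 y) p / 2"
  by (simp_all add: mink_null normal_vec_null_coords pd_pd_null_coords[OF p] pd_pd_z[OF p] y_v[OF p]
      power2_eq_square field_simps)

lemma normal_sq_pos: "normal_sq p > 0"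
proof -
  have "(pd 2 x p)\<^sup>2 * normal_sq p > 0"
    using first_form_det_pos[OF p] unfolding first_form parabola_form_identities(1) normal_sq_def .
  moreover have "(pd 2 x p)\<^sup>2 > 0" using x_v_nz[OF p] by simp
  ultimately show ?thesis using zero_less_mult_pos by blast
qed

lemma y_u_nz: "pd 1 y p \<noteq> 0"
  using normal_sq_pos by (auto simp: normal_sq_def)

text \<open>In terms of \<open>f(x, y) = A x\<^sup>2 + B x + C\<close>, the surface \<open>z = f(x, y)\<close> has \<open>D0 = f\<^sub>y - f\<^sub>x\<^sup>2 / 4\<close>, and
\<open>N1 = f\<^sub>y\<^sub>y - f\<^sub>x f\<^sub>x\<^sub>y + f\<^sub>y f\<^sub>x\<^sub>x\<close> is proportional to \<open>H\<close>. The bracket after \<open>b\<close> is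
\<open>f\<^sub>x\<^sub>x f\<^sub>y\<^sub>y - f\<^sub>x\<^sub>y\<^sup>2\<close>, which is proportional to \<open>K\<close>. Writing it through \<open>N1\<close>, \<open>D0\<close> and the \<open>x\<close>-derivative of \<open>D0\<close> leaves an identity
in which \<open>N1\<close> can be treated as an arbitrary polynomial.\<close>

lemma parabola_identity:
  assumes lw: "a * mean_curvature X G p + b * gauss_curvature X G p = c"
  defines "h \<equiv> pd 1 y p" and "k \<equiv> pd 1 (pd 1 y) p" and "s \<equiv> slope p"
  defines "D0 \<equiv> z_u p / h - s\<^sup>2 / 4" and "f \<equiv> (z_uu p * h - z_u p * k) / h^3"
  defines "N1 \<equiv> f - s * (z_ux p / h) + 2 * qa p * (z_u p / h)"
  shows "a\<^sup>2 * N1\<^sup>2 * D0 = (4 * c * D0\<^sup>2 - b * (2 * qa p * N1 - 4 * (qa p)\<^sup>2 * D0 - (z_ux p / h - qa p * s)\<^sup>2))\<^sup>2"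
    and "D0 > 0"
proof -
  have h: "h \<noteq> 0" using y_u_nz by (simp add: h_def)
  have W: "normal_sq p = h\<^sup>2 * D0"
    using h by (simp add: normal_sq_def D0_def h_def[symmetric] s_def[symmetric] field_simps power2_eq_square)
  then show "D0 > 0" using normal_sq_pos by (simp add: zero_less_mult_iff)
  define N2 where "N2 = 2 * qa p * f - (z_ux p / h)\<^sup>2"
  have H: "h * z_uu p / 2 - z_u p * k / 2 - h\<^sup>2 * s * z_ux p / 2 + h\<^sup>2 * z_u p * qa p = h^3 * N1 / 2"
    using h by (simp add: N1_def f_def field_simps power2_eq_square power3_eq_cube)
  have K: "h * qa p * (h * z_uu p / 2 - z_u p * k / 2) - h\<^sup>2 * (z_ux p)\<^sup>2 / 4 = h^4 * N2 / 4"
    using h by (simp add: N2_def f_def field_simps power2_eq_square power3_eq_cube power4_eq_xxxx)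
  have "a\<^sup>2 * N1\<^sup>2 * D0 = (4 * c * D0\<^sup>2 - b * N2)\<^sup>2"
  proof (rule parabola_scaling[OF h x_v_nz[OF p]])
    show "a\<^sup>2 * ((pd 2 x p)\<^sup>2 * (h^3 * N1 / 2))\<^sup>2 * (h\<^sup>2 * D0)
      = 4 * (c * ((pd 2 x p)\<^sup>2 * (h\<^sup>2 * D0)) * (h\<^sup>2 * D0) - b * ((pd 2 x p)\<^sup>2 * (h^4 * N2 / 4)))\<^sup>2"
      using linear_weingarten_squared[OF p normal_vec_orthogonal lw]
      unfolding normal_vec_norm first_form second_form parabola_form_identities normal_sq_def[symmetric]
      unfolding h_def[symmetric] k_def[symmetric] s_def[symmetric] H K W .
  qed
  moreover have "N2 = 2 * qa p * N1 - 4 * (qa p)\<^sup>2 * D0 - (z_ux p / h - qa p * s)\<^sup>2"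
    by (simp add: N2_def N1_def D0_def power2_eq_square algebra_simps)
  ultimately show "a\<^sup>2 * N1\<^sup>2 * D0 = (4 * c * D0\<^sup>2 - b * (2 * qa p * N1 - 4 * (qa p)\<^sup>2 * D0 - (z_ux p / h - qa p * s)\<^sup>2))\<^sup>2"
    by simp
qed

end

text \<open>The coefficients of \<open>D0\<close> as a quadratic polynomial in \<open>x\<close>. With derivatives with respect to \<open>y\<close>, they are \<open>A' - A\<^sup>2\<close>,
\<open>B' - A B\<close> and \<open>C' - B\<^sup>2 / 4\<close>.\<close>

definition "delta2 p = pd 1 qa p / pd 1 y p - (qa p)\<^sup>2"
definition "delta1 p = pd 1 qb p / pd 1 y p - qa p * qb p"
definition "delta0 p = pd 1 qc p / pd 1 y p - (qb p)\<^sup>2 / 4"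
text \<open>The second derivative with respect to \<open>y\<close> of a function of \<open>u\<close>. It enters the coefficients \<open>mean2\<close>, \<open>mean1\<close>, \<open>mean0\<close> of
\<open>N1\<close>, the polynomial that stands for the mean curvature.\<close>

definition "d2_dy f p = (pd 1 (pd 1 f) p * pd 1 y p - pd 1 f p * pd 1 (pd 1 y) p) / (pd 1 y p)^3"
definition "mean2 p = d2_dy qa p - 2 * qa p * (pd 1 qa p / pd 1 y p)"
definition "mean1 p = d2_dy qb p - 2 * qb p * (pd 1 qa p / pd 1 y p)"
definition "mean0 p = d2_dy qc p - qb p * (pd 1 qb p / pd 1 y p) + 2 * qa p * (pd 1 qc p / pd 1 y p)"

lemma leaf_polynomial_identity:
  assumes p: "p \<in> D" and q: "q \<in> D" "q$1 = p$1"
    and lw: "a * mean_curvature X G q + b * gauss_curvature X G q = c"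
  defines "\<xi> \<equiv> x q"
  shows "a\<^sup>2 * (mean2 p * \<xi>\<^sup>2 + mean1 p * \<xi> + mean0 p)\<^sup>2 * (delta2 p * \<xi>\<^sup>2 + delta1 p * \<xi> + delta0 p)
    = (4 * c * (delta2 p * \<xi>\<^sup>2 + delta1 p * \<xi> + delta0 p)\<^sup>2
      - b * (2 * qa p * (mean2 p * \<xi>\<^sup>2 + mean1 p * \<xi> + mean0 p)
        - 4 * (qa p)\<^sup>2 * (delta2 p * \<xi>\<^sup>2 + delta1 p * \<xi> + delta0 p) - (2 * delta2 p * \<xi> + delta1 p)\<^sup>2))\<^sup>2"
    and "delta2 p * \<xi>\<^sup>2 + delta1 p * \<xi> + delta0 p > 0"
proof -
  have l1: "leafwise D (pd 1 f)" if "leafwise D f" "smooth_map_on f D" for f :: "real^2 \<Rightarrow> real"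
    by (rule leafwise_pd_1[OF open_D that(1) smooth_differentiable[OF that(2)]])
  have l2: "leafwise D (pd 1 (pd 1 f))" if "leafwise D f" "smooth_map_on f D" for f :: "real^2 \<Rightarrow> real"
    by (rule l1[OF l1[OF that] smooth_pd[OF that(2)]])
  have e: "f q = f p" if "leafwise D f" for f :: "real^2 \<Rightarrow> real"
    using that q p unfolding leafwise_def by blast
  note ly = leafwise_y[folded y_def]
  note lf = e[OF leafwise_q(1)] e[OF leafwise_q(2)] e[OF leafwise_q(3)]
    e[OF l1[OF leafwise_q(1) smooth_q(1)]] e[OF l1[OF leafwise_q(2) smooth_q(2)]]
    e[OF l1[OF leafwise_q(3) smooth_q(3)]] e[OF l2[OF leafwise_q(1) smooth_q(1)]]
    e[OF l2[OF leafwise_q(2) smooth_q(2)]] e[OF l2[OF leafwise_q(3) smooth_q(3)]]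
    e[OF l1[OF ly smooth_xyz(2)]] e[OF l2[OF ly smooth_xyz(2)]]
  define A1 B1 C1 where "A1 = pd 1 qa p / pd 1 y p" and "B1 = pd 1 qb p / pd 1 y p" and "C1 = pd 1 qc p / pd 1 y p"
  have z1: "z_u q / pd 1 y q = A1 * \<xi>\<^sup>2 + B1 * \<xi> + C1" "z_ux q / pd 1 y q = 2 * A1 * \<xi> + B1"
    by (simp_all add: z_u_def z_ux_def lf \<xi>_def A1_def B1_def C1_def add_divide_distrib)
  have z2: "(z_uu q * pd 1 y q - z_u q * pd 1 (pd 1 y) q) / (pd 1 y q)^3 = d2_dy qa p * \<xi>\<^sup>2 + d2_dy qb p * \<xi> + d2_dy qc p"
    by (simp add: z_uu_def z_u_def lf \<xi>_def d2_dy_def add_divide_distrib[symmetric] algebra_simps)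
  have sl: "slope q = 2 * qa p * \<xi> + qb p" using slope_eq[OF q(1)] lf by (simp add: \<xi>_def)
  have D0: "A1 * \<xi>\<^sup>2 + B1 * \<xi> + C1 - (2 * qa p * \<xi> + qb p)\<^sup>2 / 4 = delta2 p * \<xi>\<^sup>2 + delta1 p * \<xi> + delta0 p"
    by (simp add: delta2_def delta1_def delta0_def A1_def[symmetric] B1_def[symmetric] C1_def[symmetric]
        power2_eq_square field_simps)
  have N1: "d2_dy qa p * \<xi>\<^sup>2 + d2_dy qb p * \<xi> + d2_dy qc p - (2 * qa p * \<xi> + qb p) * (2 * A1 * \<xi> + B1)
      + 2 * qa p * (A1 * \<xi>\<^sup>2 + B1 * \<xi> + C1) = mean2 p * \<xi>\<^sup>2 + mean1 p * \<xi> + mean0 p"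
    by (simp add: mean2_def mean1_def mean0_def A1_def[symmetric] B1_def[symmetric] C1_def[symmetric]
        power2_eq_square algebra_simps)
  have Dx: "2 * A1 * \<xi> + B1 - qa p * (2 * qa p * \<xi> + qb p) = 2 * delta2 p * \<xi> + delta1 p"
    by (simp add: delta2_def delta1_def A1_def[symmetric] B1_def[symmetric] power2_eq_square algebra_simps)
  show "a\<^sup>2 * (mean2 p * \<xi>\<^sup>2 + mean1 p * \<xi> + mean0 p)\<^sup>2 * (delta2 p * \<xi>\<^sup>2 + delta1 p * \<xi> + delta0 p)
    = (4 * c * (delta2 p * \<xi>\<^sup>2 + delta1 p * \<xi> + delta0 p)\<^sup>2
      - b * (2 * qa p * (mean2 p * \<xi>\<^sup>2 + mean1 p * \<xi> + mean0 p)
        - 4 * (qa p)\<^sup>2 * (delta2 p * \<xi>\<^sup>2 + delta1 p * \<xi> + delta0 p) - (2 * delta2 p * \<xi> + delta1 p)\<^sup>2))\<^sup>2"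
    using parabola_identity(1)[OF q(1) lw] unfolding z1 z2 sl lf(1) D0 N1 Dx .
  show "delta2 p * \<xi>\<^sup>2 + delta1 p * \<xi> + delta0 p > 0"
    using parabola_identity(2)[OF q(1) lw] unfolding z1 sl D0 .
qed

text \<open>Apart from the excluded relations \<open>H = 0\<close> and \<open>K = 0\<close>, the leading coefficient of \<open>D0\<close> vanishes, which is the differential equation
\<open>A' = A\<^sup>2\<close> in \<open>y\<close>.\<close>

lemma curvature_law:
  assumes lw: "\<And>p. p \<in> D \<Longrightarrow> a * mean_curvature X G p + b * gauss_curvature X G p = c"
    and nt: "c \<noteq> 0 \<or> (a \<noteq> 0 \<and> b \<noteq> 0)" and p: "p \<in> D"
  shows "pd 1 qa p = (qa p)\<^sup>2 * pd 1 y p"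
proof -
  define Z where "Z = x ` {q \<in> D. q$1 = p$1}"
  have Z: "infinite Z"
    unfolding Z_def by (rule infinite_on_leaf[OF open_D connected_leaf p diff_xyz(1) x_v_nz[OF p]])
  note id = leaf_polynomial_identity[OF p _ _ lw]
  have "delta2 p = 0"
  proof (rule ccontr)
    assume d: "delta2 p \<noteq> 0"
    \<comment> \<open>Complete the square in \<open>D0\<close>.\<close>
    define \<sigma> where "\<sigma> = delta1 p / (2 * delta2 p)"
    define \<kappa> where "\<kappa> = delta0 p - delta2 p * \<sigma>\<^sup>2"
    have d1: "delta1 p = 2 * delta2 p * \<sigma>" using d by (simp add: \<sigma>_def)
    have D: "delta2 p * (t + \<sigma>)\<^sup>2 + \<kappa> = delta2 p * t\<^sup>2 + delta1 p * t + delta0 p"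
      "2 * delta2 p * (t + \<sigma>) = 2 * delta2 p * t + delta1 p" for t
      unfolding d1 \<kappa>_def by algebra+
    have N: "mean2 p * (t + \<sigma>)\<^sup>2 + (mean1 p - 2 * mean2 p * \<sigma>) * (t + \<sigma>) + (mean2 p * \<sigma>\<^sup>2 - mean1 p * \<sigma> + mean0 p)
        = mean2 p * t\<^sup>2 + mean1 p * t + mean0 p" for t by algebra
    have "infinite ((\<lambda>t. t + \<sigma>) ` Z)" using Z by (simp add: finite_image_iff)
    then have "delta2 p = 0"
    proof (rule lightlike_leading[OF _ qa_nz[OF p] nt])
      fix t' assume "t' \<in> (\<lambda>t. t + \<sigma>) ` Z"
      then obtain q where q: "q \<in> D" "q$1 = p$1" "t' = x q + \<sigma>" by (auto simp: Z_def)
      show "delta2 p * t'\<^sup>2 + \<kappa> > 0" unfolding q(3) D using id(2)[OF q(1,2,1)] .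
      show "a\<^sup>2 * (mean2 p * t'\<^sup>2 + (mean1 p - 2 * mean2 p * \<sigma>) * t' + (mean2 p * \<sigma>\<^sup>2 - mean1 p * \<sigma> + mean0 p))\<^sup>2
          * (delta2 p * t'\<^sup>2 + \<kappa>) = (4 * c * (delta2 p * t'\<^sup>2 + \<kappa>)\<^sup>2
          - b * (2 * qa p * (mean2 p * t'\<^sup>2 + (mean1 p - 2 * mean2 p * \<sigma>) * t' + (mean2 p * \<sigma>\<^sup>2 - mean1 p * \<sigma> + mean0 p))
            - 4 * (qa p)\<^sup>2 * (delta2 p * t'\<^sup>2 + \<kappa>) - (2 * delta2 p * t')\<^sup>2))\<^sup>2"
        unfolding q(3) D N using id(1)[OF q(1,2,1)] .
    qed
    then show False using d by simp
  qed
  then show ?thesis using y_u_nz[OF p] by (simp add: delta2_def field_simps)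
qed

text \<open>The equation \<open>A' = A\<^sup>2\<close> holds on all leaves, so it may be differentiated: \<open>A'' = 2 A\<^sup>3\<close> makes the
leading coefficient of \<open>N1\<close> vanish too. Both polynomials are then linear on every leaf, and the comparison of
coefficients gives \<open>B' = A B\<close>.\<close>

lemma vertex_law:
  assumes lw: "\<And>p. p \<in> D \<Longrightarrow> a * mean_curvature X G p + b * gauss_curvature X G p = c"
    and nt: "c \<noteq> 0 \<or> (a \<noteq> 0 \<and> b \<noteq> 0)" and p: "p \<in> D"
  shows "pd 1 qb p = qa p * qb p * pd 1 y p"
proof -
  define Z where "Z = x ` {q \<in> D. q$1 = p$1}"
  have Z: "infinite Z"
    unfolding Z_def by (rule infinite_on_leaf[OF open_D connected_leaf p diff_xyz(1) x_v_nz[OF p]])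
  note id = leaf_polynomial_identity[OF p _ _ lw]
  have cl: "pd 1 qa q = (qa q)\<^sup>2 * pd 1 y q" if "q \<in> D" for q
    by (rule curvature_law[OF lw nt that])
  note h = y_u_nz[OF p]
  have d2: "delta2 p = 0" using cl[OF p] h by (simp add: delta2_def)
  have "pd 1 (pd 1 qa) p = pd 1 (\<lambda>q. (qa q)\<^sup>2 * pd 1 y q) p"
    by (rule pd_cong[OF open_D p cl])
  also have "\<dots> = (qa p)\<^sup>2 * pd 1 (pd 1 y) p + 2 * qa p * pd 1 qa p * pd 1 y p"
    using diff_q(1)[OF p] diff_pd_xyz(2)[OF p] by (simp add: pd_mult pd_power2 differentiable_power)
  finally have "d2_dy qa p = 2 * (qa p)^3"
    using h cl[OF p] by (simp add: d2_dy_def field_simps power2_eq_square power3_eq_cube)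
  then have n2: "mean2 p = 0" using cl[OF p] h by (simp add: mean2_def power2_eq_square power3_eq_cube)
  have "delta1 p = 0"
  proof (rule ccontr)
    assume d: "delta1 p \<noteq> 0"
    define \<sigma> where "\<sigma> = delta0 p / delta1 p"
    have D: "delta1 p * (t + \<sigma>) = delta1 p * t + delta0 p" for t using d by (simp add: \<sigma>_def field_simps)
    have N: "mean1 p * (t + \<sigma>) + (mean0 p - mean1 p * \<sigma>) = mean1 p * t + mean0 p" for t by (simp add: algebra_simps)
    have "infinite ((\<lambda>t. t + \<sigma>) ` Z)" using Z by (simp add: finite_image_iff)
    then have "delta1 p = 0"
    proof (rule lightlike_linear[OF _ qa_nz[OF p] nt])
      fix t' assume "t' \<in> (\<lambda>t. t + \<sigma>) ` Z"
      then obtain q where q: "q \<in> D" "q$1 = p$1" "t' = x q + \<sigma>" by (auto simp: Z_def)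
      show "a\<^sup>2 * (mean1 p * t' + (mean0 p - mean1 p * \<sigma>))\<^sup>2 * (delta1 p * t') = (4 * c * (delta1 p * t')\<^sup>2
          - b * (2 * qa p * (mean1 p * t' + (mean0 p - mean1 p * \<sigma>)) - 4 * (qa p)\<^sup>2 * (delta1 p * t') - (delta1 p)\<^sup>2))\<^sup>2"
        unfolding q(3) D N using id(1)[OF q(1,2,1)] by (simp add: d2 n2)
    qed
    then show False using d by simp
  qed
  then show ?thesis using h by (simp add: delta1_def field_simps)
qed

text \<open>The equations \<open>A' = A\<^sup>2\<close> and \<open>B' = A B\<close> say that \<open>y + 1 / A\<close> and \<open>B / A\<close> are constant. The constants
give the position of the lightlike axis of revolution.\<close>

lemma revolution_parameters:
  assumes lw: "\<And>p. p \<in> D \<Longrightarrow> a * mean_curvature X G p + b * gauss_curvature X G p = c"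
    and nt: "c \<noteq> 0 \<or> (a \<noteq> 0 \<and> b \<noteq> 0)"
  shows "\<exists>x0 y0. \<forall>p\<in>D. (y p - y0) * qa p = -1 \<and> qb p = - 2 * x0 * qa p"
proof -
  define f g where "f = (\<lambda>p. y p + 1 / qa p)" and "g = (\<lambda>p. qb p / qa p)"
  have sf: "smooth_map_on f D" and sg: "smooth_map_on g D"
    unfolding f_def g_def
    by (intro smooth_add smooth_divide smooth_const smooth_q smooth_xyz open_D; simp add: qa_nz)+
  have "pd i f p = 0 \<and> pd i g p = 0" if p: "p \<in> D" for i p
  proof -
    note d = diff_q[OF p] diff_xyz[OF p] smooth_differentiable[OF sf p] smooth_differentiable[OF sg p]
    have "pd i (\<lambda>p. (f p - y p) * qa p) p = pd i (\<lambda>_. 1) p"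
      by (rule pd_cong[OF open_D p]) (simp add: f_def qa_nz)
    then have 1: "(f p - y p) * pd i qa p + (pd i f p - pd i y p) * qa p = 0"
      using d by (simp add: pd_mult pd_diff)
    have "pd i (\<lambda>p. g p * qa p) p = pd i qb p"
      by (rule pd_cong[OF open_D p]) (simp add: g_def qa_nz)
    then have 2: "g p * pd i qa p + pd i g p * qa p = pd i qb p" using d by (simp add: pd_mult)
    have q: "pd i qa p = (qa p)\<^sup>2 * pd i y p" "pd i qb p = qa p * qb p * pd i y p"
      using exhaust_2[of i] curvature_law[OF lw nt p] vertex_law[OF lw nt p] qa_v[OF p] qb_v[OF p] y_v[OF p]
      by auto
    have "pd i f p * qa p = 0"
      using 1 q(1) qa_nz[OF p] by (simp add: f_def power2_eq_square field_simps)
    moreover have "pd i g p * qa p = 0"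
      using 2 q qa_nz[OF p] by (simp add: g_def power2_eq_square field_simps)
    ultimately show ?thesis using qa_nz[OF p] by simp
  qed
  then have "f p = f q \<and> g p = g q" if "p \<in> D" "q \<in> D" for p q
    using constant_if_pd_zero[OF open_D connected_D smooth_differentiable[OF sf] _ that]
      constant_if_pd_zero[OF open_D connected_D smooth_differentiable[OF sg] _ that] by blast
  then obtain y0 g0 where fg: "\<forall>p\<in>D. f p = y0 \<and> g p = g0" by metis
  have "(y p - y0) * qa p = -1 \<and> qb p = - 2 * (- g0 / 2) * qa p" if p: "p \<in> D" for p
  proof -
    have "y0 = y p + 1 / qa p" "g0 = qb p / qa p" using fg p by (auto simp: f_def g_def)
    then show ?thesis using qa_nz[OF p] by (simp add: field_simps)
  qed
  then show ?thesis by blast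
qed

end

section \<open>Surfaces of revolution\<close>

lemma mink_nondegenerate:
  assumes "\<And>y. mink x y = 0" shows "x = 0"
  using assms[of "axis 1 1"] assms[of "axis 2 1"] assms[of "axis 3 1"]
  by (simp add: mink_def vec_eq_iff forall_3 axis_def)

text \<open>The kernel is orthogonal to everything, and the metric is nondegenerate.\<close>

lemma mink_preserving_bij:
  assumes "linear f" "\<And>x y. mink (f x) (f y) = mink x y"
  shows "bij f"
proof -
  have "x = 0" if "f x = 0" for x
    using assms(2)[of x] that by (intro mink_nondegenerate) (simp add: mink_simps)
  then have "inj f" using assms(1) linear_injective_0 by blast
  then show ?thesis using assms(1) linear_injective_imp_surjective by (auto simp: bij_def)
qed

lemma mink_isometry_inverse:
  assumes "mink_isometry \<phi>"
  shows "\<exists>\<psi>. mink_isometry \<psi> \<and> (\<forall>x. \<psi> (\<phi> x) = x) \<and> (\<forall>x. \<phi> (\<psi> x) = x)"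
proof -
  obtain f b where f: "linear f" "\<And>x y. mink (f x) (f y) = mink x y" "\<phi> = (\<lambda>x. f x + b)"
    using assms unfolding mink_isometry_def by blast
  have bij: "bij f" by (rule mink_preserving_bij[OF f(1,2)])
  obtain g where lg: "linear g" and "g \<circ> f = id"
    using linear_injective_left_inverse[OF f(1)] bij bij_is_inj by blast
  then have gf1: "g (f x) = x" for x by (metis comp_apply id_apply)
  have gf2: "f (g x) = x" for x
  proof -
    obtain y where "x = f y" using bij by (metis bij_pointE)
    then show ?thesis by (simp add: gf1)
  qed
  note gf = gf1 gf2
  have "mink (g x) (g y) = mink x y" for x y
    using f(2)[of "g x" "g y"] by (simp add: gf)
  moreover have "(\<lambda>x. g (x - b)) = (\<lambda>x. g x + - g b)" using lg by (simp add: linear_diff)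
  ultimately have "mink_isometry (\<lambda>x. g (x - b))"
    unfolding mink_isometry_def using lg by (intro exI[of _ g] exI[of _ "- g b"]) simp
  then show ?thesis by (intro exI[of _ "\<lambda>x. g (x - b)"]) (simp add: f(3) gf)
qed

lemma mink_isometry_compose:
  assumes "mink_isometry \<phi>" "mink_isometry \<psi>" shows "mink_isometry (\<lambda>x. \<phi> (\<psi> x))"
proof -
  obtain f b where f: "linear f" "\<And>x y. mink (f x) (f y) = mink x y" "\<phi> = (\<lambda>x. f x + b)"
    using assms(1) unfolding mink_isometry_def by blast
  obtain g c where g: "linear g" "\<And>x y. mink (g x) (g y) = mink x y" "\<psi> = (\<lambda>x. g x + c)"
    using assms(2) unfolding mink_isometry_def by blast
  have "(\<lambda>x. \<phi> (\<psi> x)) = (\<lambda>x. (f \<circ> g) x + (f c + b))" using f g by (simp add: linear_add add.assoc)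
  moreover have "linear (f \<circ> g)" using f(1) g(1) linear_compose by blast
  ultimately show ?thesis unfolding mink_isometry_def using f(2) g(2) by (metis comp_apply)
qed

lemma mink_isometry_continuous: "mink_isometry \<phi> \<Longrightarrow> continuous_on S \<phi>"
  unfolding mink_isometry_def linear_conv_bounded_linear
  using continuous_on_add[OF linear_continuous_on continuous_on_const] by blast

lemma mink_isometry_homeomorphism:
  assumes "mink_isometry \<phi>"
  shows "\<exists>\<psi>. mink_isometry \<psi> \<and> homeomorphism UNIV UNIV \<phi> \<psi>"
proof -
  obtain \<psi> where "mink_isometry \<psi>" "\<forall>x. \<psi> (\<phi> x) = x" "\<forall>x. \<phi> (\<psi> x) = x"
    using mink_isometry_inverse[OF assms] by blast
  then show ?thesis using assms mink_isometry_continuous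
    by (intro exI[of _ \<psi>]) (auto simp: homeomorphism_def image_iff, metis+)
qed

lemma immersion_compose_isometry:
  assumes "mink_isometry \<phi>" "open U" "immersion_on X U"
  shows "immersion_on (\<lambda>p. \<phi> (X p)) U"
proof -
  obtain f b where f: "linear f" "\<And>x y. mink (f x) (f y) = mink x y" "\<phi> = (\<lambda>x. f x + b)"
    using assms(1) unfolding mink_isometry_def by blast
  have bl: "bounded_linear f" using f(1) by (simp add: linear_conv_bounded_linear)
  have sX: "smooth_map_on X U" using assms(3) by (simp add: immersion_on_def)
  have "smooth_map_on (\<lambda>p. f (X p) + b) U"
    by (rule smooth_add[OF assms(2) smooth_linear[OF assms(2) bl sX] smooth_const])
  moreover have "inj (frechet_derivative (\<lambda>p. \<phi> (X p)) (at p))" if p: "p \<in> U" for p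
  proof -
    have "(X has_derivative frechet_derivative X (at p)) (at p)"
      using smooth_differentiable[OF sX p] by (simp add: frechet_derivative_works)
    then have hd: "((\<lambda>p. f (X p) + b) has_derivative (\<lambda>w. f (frechet_derivative X (at p) w) + 0)) (at p)"
      by (intro has_derivative_add has_derivative_const bounded_linear.has_derivative[OF bl])
    then have "frechet_derivative (\<lambda>p. \<phi> (X p)) (at p) = f \<circ> frechet_derivative X (at p)"
      using frechet_derivative_at[OF hd] by (simp add: f(3) comp_def)
    moreover have "inj f" using mink_preserving_bij[OF f(1,2)] bij_is_inj by blast
    ultimately show ?thesis using assms(3) p inj_compose unfolding immersion_on_def by metis
  qed
  ultimately show ?thesis by (simp add: immersion_on_def f(3))
qed

lemma immersion_subset: "immersion_on X D \<Longrightarrow> U \<subseteq> D \<Longrightarrow> immersion_on X U"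
  unfolding immersion_on_def using smooth_subset by blast

text \<open>A projection whose kernel contains no spacelike vector is injective on the tangent planes, so \<open>\<pi> \<circ> X\<close> is
a local homeomorphism by the inverse function theorem and invariance of domain. If \<open>\<pi>\<close> is injective on \<open>S\<close>
near \<open>X p\<close>, a point of \<open>S\<close> that lies over the image of a small neighbourhood \<open>U\<close> must be the point of \<open>X ` U\<close> over it; hence
\<open>X ` U\<close> is open in \<open>S\<close>, and the inverse of \<open>X\<close> factors through \<open>\<pi>\<close>.\<close>

lemma spacelike_surface_local_graph:
  fixes \<pi> :: "real^3 \<Rightarrow> real^2"
  assumes sp: "spacelike_surface X D" and lin: "linear \<pi>"
    and ker: "\<And>k. \<pi> k = 0 \<Longrightarrow> mink k k \<le> 0"
    and S: "X ` D \<subseteq> S" and V: "open V'" and p: "p \<in> D" "X p \<in> V'" and inj: "inj_on \<pi> (S \<inter> V')"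
  shows "\<exists>U V Z. open U \<and> p \<in> U \<and> U \<subseteq> D \<and> open V \<and> X p \<in> V \<and> homeomorphism U (S \<inter> V) X Z"
proof -
  have opD: "open D" and sX: "smooth_map_on X D"
    using sp by (simp_all add: spacelike_surface_def immersion_on_def)
  have bl: "bounded_linear \<pi>" using lin by (simp add: linear_conv_bounded_linear)
  have contX: "continuous_on D X" by (rule smooth_continuous[OF sX])
  define D' where "D' = D \<inter> X -` V'"
  have D': "open D'" "p \<in> D'" unfolding D'_def
    using continuous_open_preimage[OF contX opD V] p by auto
  define f where "f = (\<lambda>q. \<pi> (X q))"
  define f' where "f' = (\<lambda>q w::real^2. w$1 *\<^sub>R \<pi> (pd 1 X q) + w$2 *\<^sub>R \<pi> (pd 2 X q))"
  have df: "(f has_derivative f' q) (at q)" if "q \<in> D'" for q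
  proof -
    have "(f has_derivative (\<lambda>w. \<pi> (w$1 *\<^sub>R pd 1 X q + w$2 *\<^sub>R pd 2 X q))) (at q)"
      unfolding f_def using that smooth_differentiable[OF sX]
      by (intro bounded_linear.has_derivative[OF bl] has_derivative_pd) (auto simp: D'_def)
    then show ?thesis using lin by (simp add: f'_def linear_add linear_scale)
  qed
  have "inj (f' p)"
  proof -
    have "linear (f' p)" using df[OF D'(2)] has_derivative_linear by blast
    moreover have "w = 0" if "f' p w = 0" for w
    proof (rule ccontr)
      assume "w \<noteq> 0"
      let ?k = "w$1 *\<^sub>R pd 1 X p + w$2 *\<^sub>R pd 2 X p"
      have "\<pi> ?k = 0" using that lin by (simp add: f'_def linear_add linear_scale)
      then have "mink ?k ?k \<le> 0" by (rule ker)
      moreover have "mink ?k ?k > 0"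
        using sp \<open>w \<noteq> 0\<close> p frechet_pd[OF smooth_differentiable[OF sX p(1)], of w]
        unfolding spacelike_surface_def by metis
      ultimately show False by simp
    qed
    ultimately show ?thesis using linear_injective_0 by blast
  qed
  then obtain g' where g': "linear g'" "g' \<circ> f' p = id"
    using linear_injective_left_inverse[of "f' p"] df[OF D'(2)] has_derivative_linear by blast
  have on: "\<exists>d>0. \<forall>q. dist p q < d \<longrightarrow> onorm (\<lambda>w. f' q w - f' p w) < e" if "e > 0" for e
  proof -
    have c: "continuous_on D (\<lambda>q. \<pi> (pd i X q))" for i
      by (rule smooth_continuous[OF smooth_linear[OF opD bl smooth_pd[OF sX]]])
    then have ic: "isCont (\<lambda>q. \<pi> (pd i X q)) p" for i
      using opD p(1) continuous_on_eq_continuous_at by blast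
    have "\<exists>d>0. \<forall>q. dist q p < d \<longrightarrow> dist (\<pi> (pd i X q)) (\<pi> (pd i X p)) < e / 3" for i
      by (rule continuous_at_eps_delta[THEN iffD1, rule_format, OF ic]) (use \<open>e > 0\<close> in simp)
    then obtain d where d: "\<And>i. d i > 0" "\<And>i q. dist q p < d i \<Longrightarrow> dist (\<pi> (pd i X q)) (\<pi> (pd i X p)) < e / 3"
      by metis
    have "onorm (\<lambda>w. f' q w - f' p w) < e" if q: "dist p q < min (d 1) (d 2)" for q
    proof -
      have n: "norm (\<pi> (pd i X q) - \<pi> (pd i X p)) < e / 3" if "i = 1 \<or> i = 2" for i
      proof -
        have "dist q p < d i" using q that by (auto simp: dist_commute)
        then show ?thesis using d(2)[of q i] by (simp add: dist_norm)
      qed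
      have "norm (f' q w - f' p w) \<le> (e / 3 + e / 3) * norm w" for w
      proof -
        have "f' q w - f' p w = w$1 *\<^sub>R (\<pi> (pd 1 X q) - \<pi> (pd 1 X p)) + w$2 *\<^sub>R (\<pi> (pd 2 X q) - \<pi> (pd 2 X p))"
          by (simp add: f'_def algebra_simps)
        also have "norm \<dots> \<le> \<bar>w$1\<bar> * norm (\<pi> (pd 1 X q) - \<pi> (pd 1 X p)) + \<bar>w$2\<bar> * norm (\<pi> (pd 2 X q) - \<pi> (pd 2 X p))"
          by (metis norm_triangle_ineq norm_scaleR)
        also have "\<dots> \<le> norm w * (e / 3) + norm w * (e / 3)"
          using n[of 1] n[of 2] component_le_norm_cart[of w 1] component_le_norm_cart[of w 2]
          by (intro add_mono mult_mono) auto
        finally show ?thesis by (simp add: algebra_simps)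
      qed
      then have "onorm (\<lambda>w. f' q w - f' p w) \<le> e / 3 + e / 3" by (rule onorm_le)
      then show ?thesis using \<open>e > 0\<close> by linarith
    qed
    then show ?thesis using d(1) by (intro exI[of _ "min (d 1) (d 2)"]) auto
  qed
  obtain \<rho> where \<rho>: "\<rho> > 0" "ball p \<rho> \<subseteq> D'" "inj_on f (ball p \<rho>)"
    using has_derivative_locally_injective[OF D'(2,1) _ g'(2) df on] g'(1)
    by (auto simp: linear_conv_bounded_linear)
  define U where "U = ball p \<rho>"
  have contf: "continuous_on U f"
    using \<rho>(2) df unfolding U_def
    by (meson continuous_at_imp_continuous_on has_derivative_continuous subsetD)
  have inv: "open (f ` U)"
    by (rule invariance_of_domain[OF contf]) (use \<rho> in \<open>auto simp: U_def\<close>)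
  obtain g where g: "homeomorphism U (f ` U) f g"
    using invariance_of_domain_homeomorphism[of U f] contf \<rho>(3) by (auto simp: U_def)
  define V where "V = V' \<inter> \<pi> -` (f ` U)"
  have cont\<pi>: "continuous_on T \<pi>" for T using bl by (simp add: bounded_linear.linear linear_continuous_on)
  have "open V" unfolding V_def by (intro open_Int V open_vimage inv cont\<pi>)
  have SV: "S \<inter> V = X ` U"
  proof
    show "X ` U \<subseteq> S \<inter> V" using \<rho>(2) S by (auto simp: U_def V_def D'_def f_def)
    show "S \<inter> V \<subseteq> X ` U"
    proof
      fix s assume s: "s \<in> S \<inter> V"
      then obtain q where q: "q \<in> U" "\<pi> s = \<pi> (X q)" by (auto simp: V_def f_def)
      then have "q \<in> D'" using \<rho>(2) by (auto simp: U_def)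
      then have "X q \<in> S \<inter> V'" using S by (auto simp: D'_def)
      then have "s = X q" using inj s q(2) by (auto simp: V_def inj_on_def)
      then show "s \<in> X ` U" using q(1) by simp
    qed
  qed
  have "homeomorphism U (S \<inter> V) X (\<lambda>s. g (\<pi> s))"
  proof (rule homeomorphismI)
    show "continuous_on U X" by (rule continuous_on_subset[OF contX]) (use \<rho>(2) in \<open>auto simp: U_def D'_def\<close>)
    show "continuous_on (S \<inter> V) (\<lambda>s. g (\<pi> s))"
      using g by (intro continuous_on_compose2[OF homeomorphism_cont2[OF g] cont\<pi>]) (auto simp: V_def)
    show "X ` U \<subseteq> S \<inter> V" using SV by simp
    show "(\<lambda>s. g (\<pi> s)) ` (S \<inter> V) \<subseteq> U" using g by (auto simp: V_def homeomorphism_def)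
    show gX: "g (\<pi> (X q)) = q" if "q \<in> U" for q
      using homeomorphism_apply1[OF g that] by (simp add: f_def)
    show "X (g (\<pi> s)) = s" if "s \<in> S \<inter> V" for s
      using that unfolding SV by (auto simp: gX)
  qed
  moreover have "X p \<in> V" using p \<rho>(1) by (auto simp: V_def f_def U_def)
  ultimately show ?thesis using \<open>open V\<close> \<rho> by (intro exI[of _ U] exI[of _ V]) (auto simp: U_def D'_def)
qed

lemma homeomorphism_isometry_image:
  assumes "mink_isometry \<phi>" and hom: "homeomorphism U (S \<inter> V) X Z" and V: "open V"
  shows "\<exists>V' Z'. open V' \<and> (\<forall>x. x \<in> V \<longrightarrow> \<phi> x \<in> V') \<and> homeomorphism U (\<phi> ` S \<inter> V') (\<lambda>p. \<phi> (X p)) Z'"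
proof -
  obtain \<psi> where \<psi>: "mink_isometry \<psi>" "homeomorphism UNIV UNIV \<phi> \<psi>"
    using mink_isometry_homeomorphism[OF assms(1)] by blast
  have inv: "\<psi> (\<phi> x) = x" "\<phi> (\<psi> x) = x" for x
    using \<psi>(2) by (simp_all add: homeomorphism_def)
  have "\<phi> ` S \<inter> \<psi> -` V = \<phi> ` (S \<inter> V)" by (auto simp: inv)
  moreover have "homeomorphism (S \<inter> V) (\<phi> ` (S \<inter> V)) \<phi> \<psi>"
    using homeomorphism_of_subsets[OF \<psi>(2), of "S \<inter> V" "\<phi> ` (S \<inter> V)"] by simp
  ultimately have "homeomorphism U (\<phi> ` S \<inter> \<psi> -` V) (\<phi> \<circ> X) (Z \<circ> \<psi>)"
    using homeomorphism_compose[OF hom] by simp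
  moreover have "open (\<psi> -` V)" by (intro open_vimage V mink_isometry_continuous[OF \<psi>(1)])
  ultimately show ?thesis
    by (intro exI[of _ "\<psi> -` V"] exI[of _ "Z \<circ> \<psi>"]) (auto simp: inv comp_def)
qed

text \<open>The given surface provides charts of \<open>S\<close> around its own points, and the rotations carry
them to all other points of \<open>S\<close>.\<close>

lemma part_of_surface_of_revolutionI:
  fixes \<pi> :: "real^3 \<Rightarrow> real^2"
  assumes sp: "spacelike_surface X D" and lin: "linear \<pi>"
    and ker: "\<And>k. \<pi> k = 0 \<Longrightarrow> mink k k \<le> 0"
    and S: "X ` D \<subseteq> S" and l: "line l"
    and invariant: "\<And>\<phi>. mink_isometry \<phi> \<Longrightarrow> (\<forall>x\<in>l. \<phi> x = x) \<Longrightarrow> \<phi> ` S = S"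
    and transitive: "\<And>s. s \<in> S \<Longrightarrow> \<exists>p\<in>D. \<exists>\<phi>. mink_isometry \<phi> \<and> (\<forall>x\<in>l. \<phi> x = x) \<and> \<phi> (X p) = s"
    and inj: "\<And>p. p \<in> D \<Longrightarrow> \<exists>V. open V \<and> X p \<in> V \<and> inj_on \<pi> (S \<inter> V)"
  shows "part_of_surface_of_revolution (X ` D)"
proof -
  have loc: "\<exists>U V Z. open U \<and> p \<in> U \<and> U \<subseteq> D \<and> open V \<and> X p \<in> V \<and> homeomorphism U (S \<inter> V) X Z"
    if p: "p \<in> D" for p
  proof -
    obtain V where "open V" "X p \<in> V" "inj_on \<pi> (S \<inter> V)" using inj[OF p] by blast
    then show ?thesis using spacelike_surface_local_graph[OF sp lin ker S _ p] by blast
  qed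
  have "regular_surface S"
    unfolding regular_surface_def
  proof
    fix s assume "s \<in> S"
    then obtain p \<phi> where p: "p \<in> D" and \<phi>: "mink_isometry \<phi>" "\<forall>x\<in>l. \<phi> x = x" "\<phi> (X p) = s"
      using transitive by blast
    obtain U V Z where U: "open U" "p \<in> U" "U \<subseteq> D" "open V" "X p \<in> V" "homeomorphism U (S \<inter> V) X Z"
      using loc[OF p] by blast
    obtain V' Z' where V': "open V'" "\<forall>x. x \<in> V \<longrightarrow> \<phi> x \<in> V'"
      "homeomorphism U (\<phi> ` S \<inter> V') (\<lambda>p. \<phi> (X p)) Z'"
      using homeomorphism_isometry_image[OF \<phi>(1) U(6,4)] by blast
    have "immersion_on X U"
      using sp U(3) immersion_subset unfolding spacelike_surface_def by blast
    then have "immersion_on (\<lambda>p. \<phi> (X p)) U" by (rule immersion_compose_isometry[OF \<phi>(1) U(1)])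
    moreover have "s \<in> V'" using V'(2) U(5) \<phi>(3) by blast
    moreover have "\<phi> ` S = S" by (rule invariant[OF \<phi>(1,2)])
    ultimately show "\<exists>U V Y Z. open U \<and> open V \<and> s \<in> V \<and> immersion_on Y U \<and> homeomorphism U (S \<inter> V) Y Z"
      using U(1) V'(1,3) by metis
  qed
  then have "surface_of_revolution S"
    unfolding surface_of_revolution_def using l invariant by blast
  moreover have "openin (top_of_set S) (X ` D)"
  proof (subst openin_subopen, rule ballI)
    fix s assume "s \<in> X ` D"
    then obtain p where p: "p \<in> D" "s = X p" by blast
    obtain U V Z where U: "U \<subseteq> D" "open V" "X p \<in> V" "homeomorphism U (S \<inter> V) X Z"
      using loc[OF p(1)] by blast
    have "openin (top_of_set S) (S \<inter> V)" using U(2) by (simp add: openin_open_Int)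
    moreover have "S \<inter> V \<subseteq> X ` D" using U(1,4) unfolding homeomorphism_def by blast
    ultimately show "\<exists>T. openin (top_of_set S) T \<and> s \<in> T \<and> T \<subseteq> X ` D"
      using U(3) p S by blast
  qed
  ultimately show ?thesis unfolding part_of_surface_of_revolution_def by blast
qed

definition axis_line :: "real^3 \<Rightarrow> real^3 \<Rightarrow> (real^3) set" where
  "axis_line o' d = range (\<lambda>k. o' + k *\<^sub>R d)"

lemma line_axis_line: assumes "d \<noteq> 0" shows "line (axis_line o' d)"
proof -
  have "axis_line o' d = affine hull {o', o' + d}"
  proof (intro set_eqI iffI)
    fix x assume "x \<in> axis_line o' d"
    then obtain k where "x = o' + k *\<^sub>R d" by (auto simp: axis_line_def)
    then have "x = (1 - k) *\<^sub>R o' + k *\<^sub>R (o' + d)" by (simp add: algebra_simps)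
    then show "x \<in> affine hull {o', o' + d}" unfolding affine_hull_2 by force
  next
    fix x assume "x \<in> affine hull {o', o' + d}"
    then obtain u v where uv: "u + v = 1" and x: "x = u *\<^sub>R o' + v *\<^sub>R (o' + d)" unfolding affine_hull_2 by blast
    have "x = (u + v) *\<^sub>R o' + v *\<^sub>R d"
      unfolding x by (simp add: scaleR_left_distrib scaleR_right_distrib add.assoc)
    then have "x = o' + v *\<^sub>R d" using uv by simp
    then show "x \<in> axis_line o' d" unfolding axis_line_def by blast
  qed
  moreover have "aff_dim {o', o' + d} = 1" using assms by (simp add: aff_dim_2)
  ultimately show ?thesis unfolding line_def by (simp add: affine_affine_hull)
qed

text \<open>The two invariants of a point under the isometries that fix the line through \<open>o'\<close> with direction \<open>d\<close> are its products
with \<open>d\<close> and with itself, relative to \<open>o'\<close>. The set of all points with the same invariants as some point of \<open>M\<close> is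
invariant under the full group, including its reflections. Around a spacelike axis, for example, it contains both
branches of every hyperbola.\<close>

definition orbit_surface :: "real^3 \<Rightarrow> real^3 \<Rightarrow> (real^3) set \<Rightarrow> (real^3) set" where
  "orbit_surface o' d M = {s. \<exists>m\<in>M. mink (s - o') d = mink (m - o') d \<and> mink (s - o') (s - o') = mink (m - o') (m - o')}"

lemma orbit_surface_invariant:
  assumes "mink_isometry \<phi>" "\<forall>x\<in>axis_line o' d. \<phi> x = x"
  shows "\<phi> ` orbit_surface o' d M = orbit_surface o' d M"
proof -
  have sub: "\<phi> s \<in> orbit_surface o' d M"
    if "mink_isometry \<phi>" "\<forall>x\<in>axis_line o' d. \<phi> x = x" "s \<in> orbit_surface o' d M" for \<phi> s
  proof -
    obtain f b where f: "linear f" "\<And>x y. mink (f x) (f y) = mink x y" "\<phi> = (\<lambda>x. f x + b)"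
      using \<open>mink_isometry \<phi>\<close> unfolding mink_isometry_def by blast
    have "o' + 0 *\<^sub>R d \<in> axis_line o' d" "o' + 1 *\<^sub>R d \<in> axis_line o' d" unfolding axis_line_def by blast+
    then have "\<phi> (o' + 0 *\<^sub>R d) = o' + 0 *\<^sub>R d" "\<phi> (o' + 1 *\<^sub>R d) = o' + 1 *\<^sub>R d" using that(2) by blast+
    then have "\<phi> o' = o'" "\<phi> (o' + d) = o' + d" by simp_all
    then have fo: "f o' + b = o'" and fd: "f (o' + d) + b = o' + d" using f(3) by simp_all
    have "f d = (f (o' + d) + b) - (f o' + b)" using f(1) by (simp add: linear_add)
    also have "\<dots> = d" unfolding fo fd by simp
    finally have "f d = d" .
    have "\<phi> s - o' = (f s + b) - (f o' + b)" unfolding fo using f(3) by simp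
    then have "\<phi> s - o' = f (s - o')" using f(1) by (simp add: linear_diff)
    then have "mink (\<phi> s - o') d = mink (s - o') d" "mink (\<phi> s - o') (\<phi> s - o') = mink (s - o') (s - o')"
      using f(2)[of "s - o'" d] f(2)[of "s - o'" "s - o'"] \<open>f d = d\<close> by simp_all
    then show ?thesis using that(3) unfolding orbit_surface_def by simp
  qed
  obtain \<psi> where \<psi>: "mink_isometry \<psi>" "\<forall>x. \<psi> (\<phi> x) = x" "\<forall>x. \<phi> (\<psi> x) = x"
    using mink_isometry_inverse[OF assms(1)] by blast
  have "\<forall>x\<in>axis_line o' d. \<psi> x = x" using assms(2) \<psi>(2) by metis
  then have "s \<in> \<phi> ` orbit_surface o' d M" if "s \<in> orbit_surface o' d M" for s
    using sub[OF \<psi>(1) _ that] \<psi>(3) by (metis imageI)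
  then show ?thesis using sub[OF assms] by blast
qed

text \<open>It remains to supply, for each axis type, a linear isometry \<open>f\<close> that carries a point of the surface to a given point with the
same invariants, and a projection that is injective near the points of the surface.\<close>

lemma part_of_orbit_surface:
  fixes \<pi> :: "real^3 \<Rightarrow> real^2"
  assumes sp: "spacelike_surface X D" and lin: "linear \<pi>"
    and ker: "\<And>k. \<pi> k = 0 \<Longrightarrow> mink k k \<le> 0" and d: "d \<noteq> 0"
    and rotation: "\<And>s p. p \<in> D \<Longrightarrow> mink (s - o') d = mink (X p - o') d \<Longrightarrow>
        mink (s - o') (s - o') = mink (X p - o') (X p - o') \<Longrightarrow>
        \<exists>f. linear f \<and> (\<forall>x y. mink (f x) (f y) = mink x y) \<and> f d = d \<and> f (X p - o') = s - o'"
    and inj: "\<And>p. p \<in> D \<Longrightarrow> \<exists>V. open V \<and> X p \<in> V \<and> inj_on \<pi> (orbit_surface o' d (X ` D) \<inter> V)"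
  shows "part_of_surface_of_revolution (X ` D)"
proof (rule part_of_surface_of_revolutionI[OF sp lin ker _ line_axis_line[OF d] orbit_surface_invariant])
  show "X ` D \<subseteq> orbit_surface o' d (X ` D)" by (auto simp: orbit_surface_def)
  fix s assume "s \<in> orbit_surface o' d (X ` D)"
  then obtain p where p: "p \<in> D" "mink (s - o') d = mink (X p - o') d"
    "mink (s - o') (s - o') = mink (X p - o') (X p - o')" by (auto simp: orbit_surface_def)
  obtain f where f: "linear f" "\<forall>x y. mink (f x) (f y) = mink x y" "f d = d" "f (X p - o') = s - o'"
    using rotation[OF p] by blast
  define \<phi> where "\<phi> = (\<lambda>x. f x + (o' - f o'))"
  have "mink_isometry \<phi>" using f(1,2) unfolding mink_isometry_def \<phi>_def by blast
  moreover have "\<phi> x = x" if "x \<in> axis_line o' d" for x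
    using that f(1,3) by (auto simp: axis_line_def \<phi>_def linear_add linear_scale)
  moreover have "\<phi> (X p) = s"
    using f(4) linear_diff[OF f(1), of "X p" o'] by (simp add: \<phi>_def algebra_simps)
  ultimately show "\<exists>p\<in>D. \<exists>\<phi>. mink_isometry \<phi> \<and> (\<forall>x\<in>axis_line o' d. \<phi> x = x) \<and> \<phi> (X p) = s"
    using p(1) by blast
qed (use inj in auto)

lemma vec_3_eqI:
  fixes v w :: "real^3" and kx ky kt :: 3
  assumes d: "kx \<noteq> ky" "kx \<noteq> kt" "ky \<noteq> kt" and e: "v$kx = w$kx" "v$ky = w$ky" "v$kt = w$kt"
  shows "v = w"
proof -
  have "card {kx, ky, kt} = 3" using d by simp
  then have "{kx, ky, kt} = UNIV" by (intro card_subset_eq) auto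
  then have k: "k = kx \<or> k = ky \<or> k = kt" for k by blast
  have "v$k = w$k" for k using k[of k] e by auto
  then show ?thesis by (simp add: vec_eq_iff)
qed

text \<open>Regard \<open>v\<close> and \<open>w\<close> as numbers \<open>x + j y\<close> with \<open>j\<^sup>2 = - \<epsilon>\<close>, complex or split complex. They have the same norm
\<open>x\<^sup>2 + \<epsilon> y\<^sup>2 \<noteq> 0\<close>, so the quotient \<open>w / v = c + j s\<close> has norm \<open>1\<close>, and multiplication by it is a rotation about the \<open>t\<close>-axis.\<close>

lemma conic_rotation_exists:
  fixes \<epsilon> r :: real and kx ky kt :: 3 and v w :: "real^3"
  assumes eps: "\<epsilon>\<^sup>2 = 1"
    and mink_coords: "\<And>A B. mink A B = A$kx * B$kx + \<epsilon> * (A$ky * B$ky) - \<epsilon> * (A$kt * B$kt)"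
    and dist: "kx \<noteq> ky" "kx \<noteq> kt" "ky \<noteq> kt"
    and v: "(v$kx)\<^sup>2 + \<epsilon> * (v$ky)\<^sup>2 = \<epsilon> * r\<^sup>2" and w: "(w$kx)\<^sup>2 + \<epsilon> * (w$ky)\<^sup>2 = \<epsilon> * r\<^sup>2"
    and t: "v$kt = w$kt" and r: "r \<noteq> 0"
  shows "\<exists>f. linear f \<and> (\<forall>x y. mink (f x) (f y) = mink x y) \<and> f (axis kt 1) = axis kt 1 \<and> f v = w"
proof -
  have e0: "\<epsilon> \<noteq> 0" using eps by auto
  define c s where "c = (v$kx * w$kx + \<epsilon> * (v$ky * w$ky)) / (\<epsilon> * r\<^sup>2)"
    and "s = (v$kx * w$ky - w$kx * v$ky) / (\<epsilon> * r\<^sup>2)"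
  define f where "f = (\<lambda>x::real^3. \<chi> k. if k = kx then c * x$kx - \<epsilon> * s * x$ky
      else if k = ky then s * x$kx + c * x$ky else x$kt)"
  have nth: "f x $ kx = c * x$kx - \<epsilon> * s * x$ky" "f x $ ky = s * x$kx + c * x$ky" "f x $ kt = x$kt" for x
    using dist by (simp_all add: f_def)
  note eqI = vec_3_eqI[OF dist]
  have lin: "linear f"
    by (rule linearI; rule eqI) (simp_all add: nth algebra_simps)
  have cs: "c\<^sup>2 + \<epsilon> * s\<^sup>2 = 1"
  proof -
    have "(v$kx * w$kx + \<epsilon> * (v$ky * w$ky))\<^sup>2 + \<epsilon> * (v$kx * w$ky - w$kx * v$ky)\<^sup>2
        = ((v$kx)\<^sup>2 + \<epsilon> * (v$ky)\<^sup>2) * ((w$kx)\<^sup>2 + \<epsilon> * (w$ky)\<^sup>2)" by algebra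
    also have "\<dots> = (\<epsilon> * r\<^sup>2)\<^sup>2" unfolding v w by (simp add: power2_eq_square)
    finally show ?thesis using e0 r by (simp add: c_def s_def power_divide field_simps)
  qed
  have "mink (f x) (f y) = mink x y" for x y
    unfolding mink_coords nth using cs by algebra
  moreover have "f (axis kt 1) = axis kt 1" using dist by (intro eqI) (simp_all add: nth axis_def)
  moreover have "f v = w"
  proof (rule eqI)
    have "(\<epsilon> * r\<^sup>2) * (c * v$kx - \<epsilon> * s * v$ky) = (v$kx * w$kx + \<epsilon> * (v$ky * w$ky)) * v$kx
        - \<epsilon> * (v$kx * w$ky - w$kx * v$ky) * v$ky"
      using e0 r by (simp add: c_def s_def field_simps)
    also have "\<dots> = ((v$kx)\<^sup>2 + \<epsilon> * (v$ky)\<^sup>2) * w$kx" by algebra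
    finally show "f v $ kx = w $ kx" unfolding nth v using e0 r by simp
    have "(\<epsilon> * r\<^sup>2) * (s * v$kx + c * v$ky) = (v$kx * w$ky - w$kx * v$ky) * v$kx
        + (v$kx * w$kx + \<epsilon> * (v$ky * w$ky)) * v$ky"
      using e0 r by (simp add: c_def s_def field_simps)
    also have "\<dots> = ((v$kx)\<^sup>2 + \<epsilon> * (v$ky)\<^sup>2) * w$ky" by algebra
    finally show "f v $ ky = w $ ky" unfolding nth v using e0 r by simp
    show "f v $ kt = w $ kt" using t by (simp add: nth)
  qed
  ultimately show ?thesis using lin by blast
qed

text \<open>In the coordinates \<open>x\<close>, \<open>y = x\<^sub>2 - x\<^sub>3\<close>, \<open>z = x\<^sub>2 + x\<^sub>3\<close>, the rotations about the lightlike axis are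
\<open>x \<mapsto> x + \<tau> y\<close>, \<open>z \<mapsto> z - 2 \<tau> x - \<tau>\<^sup>2 y\<close>. For \<open>y \<noteq> 0\<close>, the angle \<open>\<tau>\<close> is found from the \<open>x\<close>-coordinates, and the equality of
the squares takes care of \<open>z\<close>.\<close>

lemma parabolic_rotation_exists:
  fixes v w :: "real^3"
  assumes y: "v$2 - v$3 = w$2 - w$3" "v$2 - v$3 \<noteq> 0" and n: "mink v v = mink w w"
  shows "\<exists>f. linear f \<and> (\<forall>x y. mink (f x) (f y) = mink x y)
    \<and> f (vector [0, 1, 1]) = vector [0, 1, 1] \<and> f v = w"
proof -
  define \<tau> where "\<tau> = (w$1 - v$1) / (v$2 - v$3)"
  define g where "g = (\<lambda>x::real^3. - \<tau> * x$1 - \<tau>\<^sup>2 * (x$2 - x$3) / 2)"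
  define f where "f = (\<lambda>x::real^3. vector [x$1 + \<tau> * (x$2 - x$3), x$2 + g x, x$3 + g x] :: real^3)"
  have lin: "linear f"
    by (rule linearI) (simp_all add: f_def g_def vec_eq_iff forall_3 field_simps)
  have "mink (f x) (f y) = mink x y" for x y
    by (simp add: f_def g_def mink_def power2_eq_square field_simps)
  moreover have "f (vector [0, 1, 1]) = vector [0, 1, 1]" by (simp add: f_def g_def)
  moreover have "f v = w"
  proof -
    have 1: "\<tau> * (v$2 - v$3) = w$1 - v$1" using y(2) by (simp add: \<tau>_def)
    have "(v$2 - v$3) * (2 * g v) = (v$2 - v$3) * ((w$2 + w$3) - (v$2 + v$3))"
    proof -
      have "(v$2 - v$3) * (2 * g v) = - 2 * (\<tau> * (v$2 - v$3)) * v$1 - (\<tau> * (v$2 - v$3))\<^sup>2"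
        by (simp add: g_def power2_eq_square field_simps)
      also have "\<dots> = (v$1)\<^sup>2 - (w$1)\<^sup>2" unfolding 1 by (simp add: power2_eq_square algebra_simps)
      also have "\<dots> = (w$2 - w$3) * (w$2 + w$3) - (v$2 - v$3) * (v$2 + v$3)"
        using n by (simp add: mink_def power2_eq_square algebra_simps)
      finally show ?thesis unfolding y(1) by (simp add: algebra_simps)
    qed
    then have "2 * g v = (w$2 + w$3) - (v$2 + v$3)" using y(2) by simp
    then have "v$2 + g v = w$2" "v$3 + g v = w$3" using y(1) by linarith+
    then show ?thesis using 1 by (simp add: f_def vec_eq_iff forall_3)
  qed
  ultimately show ?thesis using lin by blast
qed

section \<open>Classification for each causal type\<close>

context conic_leaves begin

text \<open>The axis is the line of centres. For \<open>\<epsilon> = 1\<close>, the radius determines the leaf, so the surface is a graph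
over the \<open>(x, y)\<close>-plane, and the direction of projection is timelike. For \<open>\<epsilon> = -1\<close>, it is \<open>t\<close> that
determines the leaf, and the timelike direction \<open>y\<close> is projected out, separately on the two sides of the axis.\<close>

lemma conic_leaves_revolution:
  assumes c: "\<And>p. p \<in> D \<Longrightarrow> ca p = A \<and> cb p = B"
    and t_u: "\<epsilon> = -1 \<or> (\<forall>p\<in>D. pd 1 rr p \<noteq> 0)" 
  shows "part_of_surface_of_revolution (X ` D)"
proof -
  define o' where "o' = (\<chi> k. if k = kx then A else if k = ky then B else 0)"
  have o': "o' $ kx = A" "o' $ ky = B" "o' $ kt = 0" using distinct_coords by (auto simp: o'_def)
  have inv1: "mink (v - o') (axis kt 1) = - \<epsilon> * v$kt" for v
    using distinct_coords by (simp add: mink_coords o' axis_def)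
  have inv2: "mink (v - o') (v - o') = ((v$kx - A)\<^sup>2 + \<epsilon> * (v$ky - B)\<^sup>2) - \<epsilon> * (v$kt)\<^sup>2" for v
    by (simp add: mink_coords o' power2_eq_square)
  have cn: "(X p $ kx - A)\<^sup>2 + \<epsilon> * (X p $ ky - B)\<^sup>2 = \<epsilon> * (rr p)\<^sup>2" if "p \<in> D" for p
    using conic[OF that] c[OF that] by simp
  have same: "s$kt = t p \<and> (s$kx - A)\<^sup>2 + \<epsilon> * (s$ky - B)\<^sup>2 = \<epsilon> * (rr p)\<^sup>2"
    if "p \<in> D" "mink (s - o') (axis kt 1) = mink (X p - o') (axis kt 1)"
      "mink (s - o') (s - o') = mink (X p - o') (X p - o')" for s p
    using that(2,3) cn[OF that(1)] eps2 unfolding inv1 inv2 by (simp add: t_def)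
  have rotation: "\<exists>f. linear f \<and> (\<forall>x y. mink (f x) (f y) = mink x y) \<and> f (axis kt 1) = axis kt 1 \<and> f (X p - o') = s - o'"
    if "p \<in> D" "mink (s - o') (axis kt 1) = mink (X p - o') (axis kt 1)"
      "mink (s - o') (s - o') = mink (X p - o') (X p - o')" for s p
    by (rule conic_rotation_exists[OF eps2(1) mink_coords distinct_coords, where r = "rr p"])
       (use same[OF that] cn[OF that(1)] rr_nz[OF that(1)] in \<open>simp_all add: o' t_def\<close>)
  have orb: "\<exists>p\<in>D. s$kt = t p \<and> (s$kx - A)\<^sup>2 + \<epsilon> * (s$ky - B)\<^sup>2 = \<epsilon> * (rr p)\<^sup>2"
    if "s \<in> orbit_surface o' (axis kt 1) (X ` D)" for s
    using that same unfolding orbit_surface_def by blast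
  note eqI = vec_3_eqI[OF distinct_coords]
  have axis0: "axis kt (1::real) \<noteq> 0" by (simp add: axis_eq_0_iff)
  note lt = leafwise_t[folded t_def]
  have lw: "f p = f q" if "leafwise D f" "p \<in> D" "q \<in> D" "p$1 = q$1" for f :: "real^2 \<Rightarrow> real" and p q
    using that unfolding leafwise_def by blast
  show ?thesis
  proof (cases "\<epsilon> = -1")
    case False
    then have e1: "\<epsilon> = 1" and r_u: "\<forall>p\<in>D. pd 1 rr p \<noteq> 0" using eps t_u by auto
    define \<pi> where "\<pi> = (\<lambda>v::real^3. vector [v$kx, v$ky] :: real^2)"
    show ?thesis
    proof (rule part_of_orbit_surface[OF spacelike _ _ axis0 rotation])
      show "linear \<pi>" by (rule linearI) (simp_all add: \<pi>_def vec_eq_iff forall_2)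
      fix v :: "real^3" assume "\<pi> v = 0"
      then have "v$kx = 0" "v$ky = 0" by (simp_all add: \<pi>_def vec_eq_iff forall_2)
      then have "mink v v = - (\<epsilon> * (v$kt)\<^sup>2)" unfolding mink_coords by (simp add: power2_eq_square)
      then show "mink v v \<le> 0" unfolding e1 by simp
    next
      fix p assume "p \<in> D"
      have "inj_on \<pi> (orbit_surface o' (axis kt 1) (X ` D))"
      proof (rule inj_onI)
        fix s s' assume "s \<in> orbit_surface o' (axis kt 1) (X ` D)" "s' \<in> orbit_surface o' (axis kt 1) (X ` D)"
          and "\<pi> s = \<pi> s'"
        then obtain q q' where q: "q \<in> D" "s$kt = t q" "(s$kx - A)\<^sup>2 + \<epsilon> * (s$ky - B)\<^sup>2 = \<epsilon> * (rr q)\<^sup>2"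
          "q' \<in> D" "s'$kt = t q'" "(s'$kx - A)\<^sup>2 + \<epsilon> * (s'$ky - B)\<^sup>2 = \<epsilon> * (rr q')\<^sup>2"
          using orb by metis
        have xy: "s$kx = s'$kx" "s$ky = s'$ky" using \<open>\<pi> s = \<pi> s'\<close> by (simp_all add: \<pi>_def vec_eq_iff forall_2)
        have "\<epsilon> * (rr q)\<^sup>2 = \<epsilon> * (rr q')\<^sup>2" by (simp only: q(3)[symmetric] q(6)[symmetric] xy)
        then have "rr q = rr q'" using eps2 rr_pos[OF q(1)] rr_pos[OF q(4)] by (simp add: power2_eq_iff)
        then have "q$1 = q'$1"
          using leafwise_injective[OF open_D connected_params leafwise_c(3)
              smooth_differentiable[OF smooth_centre_radius(3)] _ q(1,4)] r_u by blast
        then have "t q = t q'" by (rule lw[OF lt q(1,4)])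
        then show "s = s'" using xy q(2,5) by (intro eqI) simp_all
      qed
      then show "\<exists>V. open V \<and> X p \<in> V \<and> inj_on \<pi> (orbit_surface o' (axis kt 1) (X ` D) \<inter> V)"
        by (intro exI[of _ UNIV]) simp
    qed
  next
    case True
    define \<pi> where "\<pi> = (\<lambda>v::real^3. vector [v$kx, v$kt] :: real^2)"
    have t_u: "pd 1 t p \<noteq> 0" if "p \<in> D" for p
    proof
      assume "pd 1 t p = 0"
      then have "normal_sq p = \<epsilon> * (radial_speed p)\<^sup>2" unfolding normal_sq_def by simp
      then have "\<epsilon> * (radial_speed p)\<^sup>2 > 0" using normal_sq_pos(1)[OF that] by simp
      moreover have "\<epsilon> < 0" using True by simp
      ultimately show False by (simp add: zero_less_mult_iff)
    qed
    show ?thesis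
    proof (rule part_of_orbit_surface[OF spacelike _ _ axis0 rotation])
      show "linear \<pi>" by (rule linearI) (simp_all add: \<pi>_def vec_eq_iff forall_2)
      fix v :: "real^3" assume "\<pi> v = 0"
      then have "v$kx = 0" "v$kt = 0" by (simp_all add: \<pi>_def vec_eq_iff forall_2)
      then have "mink v v = \<epsilon> * (v$ky)\<^sup>2" unfolding mink_coords by (simp add: power2_eq_square)
      then show "mink v v \<le> 0" unfolding True by simp
    next
      fix p assume p: "p \<in> D"
      \<comment> \<open>The sign of \<open>\<sigma>\<close> selects the branch of the hyperbolas on which \<open>X p\<close> lies.\<close>
      define \<sigma> :: real where "\<sigma> = X p $ ky - B"
      have "\<sigma> \<noteq> 0"
      proof
        assume "\<sigma> = 0"
        then have "(X p $ kx - A)\<^sup>2 = \<epsilon> * (rr p)\<^sup>2" using cn[OF p] by (simp add: \<sigma>_def)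
        moreover have "\<epsilon> * (rr p)\<^sup>2 < 0" using True rr_nz[OF p] by (simp add: mult_less_0_iff)
        ultimately show False using zero_le_power2[of "X p $ kx - A"] by linarith
      qed
      define V where "V = {v::real^3. \<sigma> * (v$ky - B) > 0}"
      have "open V" unfolding V_def by (intro open_Collect_less continuous_intros)
      moreover have "X p \<in> V" using \<open>\<sigma> \<noteq> 0\<close> by (simp add: V_def \<sigma>_def[symmetric])
          (metis not_real_square_gt_zero)
      moreover have "inj_on \<pi> (orbit_surface o' (axis kt 1) (X ` D) \<inter> V)"
      proof (rule inj_onI)
        fix s s' assume sV: "s \<in> orbit_surface o' (axis kt 1) (X ` D) \<inter> V" "s' \<in> orbit_surface o' (axis kt 1) (X ` D) \<inter> V"
          and "\<pi> s = \<pi> s'"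
        then obtain q q' where q: "q \<in> D" "s$kt = t q" "(s$kx - A)\<^sup>2 + \<epsilon> * (s$ky - B)\<^sup>2 = \<epsilon> * (rr q)\<^sup>2"
          "q' \<in> D" "s'$kt = t q'" "(s'$kx - A)\<^sup>2 + \<epsilon> * (s'$ky - B)\<^sup>2 = \<epsilon> * (rr q')\<^sup>2"
          using orb by (metis IntD1)
        have xt: "s$kx = s'$kx" "s$kt = s'$kt" using \<open>\<pi> s = \<pi> s'\<close> by (simp_all add: \<pi>_def vec_eq_iff forall_2)
        then have "t q = t q'" using q by simp
        then have "q$1 = q'$1"
          using leafwise_injective[OF open_D connected_params lt diff_xyt(3) t_u q(1,4)] by blast
        then have "rr q = rr q'" by (rule lw[OF leafwise_c(3) q(1,4)])
        then have "(s$kx - A)\<^sup>2 + \<epsilon> * (s$ky - B)\<^sup>2 = (s'$kx - A)\<^sup>2 + \<epsilon> * (s'$ky - B)\<^sup>2"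
          unfolding q(3) q(6) by simp
        then have "\<epsilon> * (s$ky - B)\<^sup>2 = \<epsilon> * (s'$ky - B)\<^sup>2" unfolding xt(1) by (simp only: add_left_cancel)
        then have "(s$ky - B)\<^sup>2 = (s'$ky - B)\<^sup>2" using eps2 by simp
        then have "s$ky - B = s'$ky - B \<or> s$ky - B = - (s'$ky - B)" by (simp only: power2_eq_iff)
        moreover have "s$ky - B \<noteq> - (s'$ky - B)"
        proof
          assume "s$ky - B = - (s'$ky - B)"
          then have "\<sigma> * (s$ky - B) = - (\<sigma> * (s'$ky - B))" by (metis mult_minus_right)
          moreover have "\<sigma> * (s$ky - B) > 0" "\<sigma> * (s'$ky - B) > 0" using sV by (auto simp: V_def)
          ultimately show False by linarith
        qed
        ultimately show "s = s'" using xt by (intro eqI) simp_all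
      qed
      ultimately show "\<exists>V. open V \<and> X p \<in> V \<and> inj_on \<pi> (orbit_surface o' (axis kt 1) (X ` D) \<inter> V)"
        by blast
    qed
  qed
qed

text \<open>If \<open>c \<noteq> 0\<close>, or if \<open>a\<close>, \<open>b\<close> and all \<open>t'\<close> are nonzero, the centres are fixed and the surface is one of revolution.
If \<open>c = 0\<close> and one of \<open>a\<close>, \<open>b\<close> is zero, the relation itself is \<open>K = 0\<close> or \<open>H = 0\<close>. In the remaining case
some \<open>t'\<close> vanishes, hence all do, and the surface is planar.\<close>

theorem conic_leaves_classification:
  assumes "linear_weingarten X D G"
  shows "part_of_surface_of_revolution (X ` D) \<or>
    (\<forall>p\<in>D. mean_curvature X G p = 0) \<or> (\<forall>p\<in>D. gauss_curvature X G p = 0)"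
proof -
  obtain a b c where ab: "a\<^sup>2 + b\<^sup>2 \<noteq> 0"
    and lw: "\<And>p. p \<in> D \<Longrightarrow> a * mean_curvature X G p + b * gauss_curvature X G p = c"
    using assms unfolding linear_weingarten_def by blast
  have rev: "part_of_surface_of_revolution (X ` D)"
    if st: "\<And>p. p \<in> D \<Longrightarrow> pd 1 ca p = 0 \<and> pd 1 cb p = 0"
  proof -
    obtain A B where "\<forall>p\<in>D. ca p = A \<and> cb p = B" using centre_constant[OF st] by blast
    moreover have "\<epsilon> = -1 \<or> (\<forall>p\<in>D. pd 1 rr p \<noteq> 0)"
    proof (cases "\<epsilon> = -1")
      case False
      then have e: "\<epsilon> > 0" using eps by auto
      have "pd 1 rr p \<noteq> 0" if p: "p \<in> D" for p
      proof
        assume "pd 1 rr p = 0"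
        then have "radial_speed p = 0" using st[OF p] by (simp add: radial_speed_def)
        then have "normal_sq p = - (\<epsilon> * (pd 1 t p)\<^sup>2)" by (simp add: normal_sq_def)
        moreover have "\<epsilon> * (pd 1 t p)\<^sup>2 \<ge> 0" using e by simp
        ultimately show False using normal_sq_pos(1)[OF p] by linarith
      qed
      then show ?thesis by blast
    qed simp
    ultimately show ?thesis by (intro conic_leaves_revolution[of A B]) auto
  qed
  show ?thesis
  proof (cases "c = 0")
    case False
    then show ?thesis using rev centre_stationary[OF lw] by blast
  next
    case c: True
    consider "a = 0" | "b = 0" | "a \<noteq> 0" "b \<noteq> 0" by blast
    then show ?thesis
    proof cases
      case 1
      then show ?thesis using ab lw c by auto
    next
      case 2
      then show ?thesis using ab lw c by auto
    next
      case 3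
      show ?thesis
      proof (cases "\<forall>p\<in>D. pd 1 t p \<noteq> 0")
        case True
        then show ?thesis using rev centre_stationary[OF lw] 3 by blast
      next
        case False
        then obtain p0 where p0: "p0 \<in> D" "pd 1 t p0 = 0" by blast
        have "\<epsilon> = 1"
        proof (rule ccontr)
          assume "\<epsilon> \<noteq> 1"
          then have "\<epsilon> < 0" using eps by auto
          moreover have "normal_sq p0 = \<epsilon> * (radial_speed p0)\<^sup>2" using p0(2) by (simp add: normal_sq_def)
          ultimately have "normal_sq p0 \<le> 0" by (simp add: mult_le_0_iff)
          then show False using normal_sq_pos(1)[OF p0(1)] by linarith
        qed
        then have "\<forall>p\<in>D. pd 1 t p = 0"
          using height_speed_dichotomy[OF _ 3] lw c p0 by blast
        then show ?thesis using gauss_curvature_zero by blast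
      qed
    qed
  qed
qed

end

context parabola_leaves begin

text \<open>With the laws for the coefficients, \<open>(x - x0)\<^sup>2 + (y - y0) z\<close> depends on the leaf only: the leaves are orbits of the rotations
about the lightlike line through \<open>(x0, y0, 0)\<close> in null coordinates. As \<open>y - y0 \<noteq> 0\<close>, a point of the orbit surface is determined by
\<open>x\<close> and \<open>y\<close>, so the projection is along the lightlike direction of \<open>z\<close>.\<close>

theorem parabola_leaves_classification:
  assumes "linear_weingarten X D G"
  shows "part_of_surface_of_revolution (X ` D) \<or>
    (\<forall>p\<in>D. mean_curvature X G p = 0) \<or> (\<forall>p\<in>D. gauss_curvature X G p = 0)"
proof -
  obtain a b c where ab: "a\<^sup>2 + b\<^sup>2 \<noteq> 0"
    and lw: "\<And>p. p \<in> D \<Longrightarrow> a * mean_curvature X G p + b * gauss_curvature X G p = c"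
    using assms unfolding linear_weingarten_def by blast
  have rev: "part_of_surface_of_revolution (X ` D)"
    if nt: "c \<noteq> 0 \<or> (a \<noteq> 0 \<and> b \<noteq> 0)"
  proof -
    obtain x0 y0 where xy: "\<And>p. p \<in> D \<Longrightarrow> (y p - y0) * qa p = -1 \<and> qb p = - 2 * x0 * qa p"
      using revolution_parameters[OF lw nt] by blast
    define o' where "o' = (vector [x0, y0 / 2, - y0 / 2] :: real^3)"
    define d where "d = (vector [0, 1, 1] :: real^3)"
    have "d$2 = 1" by (simp add: d_def)
    then have "d \<noteq> 0" by (metis zero_index zero_neq_one)
    have inv1: "mink (v - o') d = v$2 - v$3 - y0" for v
      by (simp add: mink_def o'_def d_def)
    have inv2: "mink (v - o') (v - o') = (v$1 - x0)\<^sup>2 + (v$2 - v$3 - y0) * (v$2 + v$3)" for v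
      by (simp add: mink_def o'_def power2_eq_square field_simps)
    have nz: "y p - y0 \<noteq> 0" if "p \<in> D" for p using xy[OF that] by auto
    define \<pi> where "\<pi> = (\<lambda>v::real^3. vector [v$1, v$2 - v$3] :: real^2)"
    show ?thesis
    proof (rule part_of_orbit_surface[OF spacelike, of \<pi> d o'])
      show "linear \<pi>" by (rule linearI) (simp_all add: \<pi>_def vec_eq_iff forall_2 algebra_simps)
      show "d \<noteq> 0" by fact
    next
      fix v :: "real^3" assume "\<pi> v = 0"
      then have "v$1 = 0" "v$2 = v$3" by (simp_all add: \<pi>_def vec_eq_iff forall_2)
      then show "mink v v \<le> 0" by (simp add: mink_def)
    next
      fix s p assume p: "p \<in> D" and i: "mink (s - o') d = mink (X p - o') d"
        "mink (s - o') (s - o') = mink (X p - o') (X p - o')"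
      have "s$2 - s$3 = y p" using i(1) unfolding inv1 y_def by simp
      then show "\<exists>f. linear f \<and> (\<forall>x y. mink (f x) (f y) = mink x y) \<and> f d = d \<and> f (X p - o') = s - o'"
        unfolding d_def using nz[OF p] i(2)
        by (intro parabolic_rotation_exists) (simp_all add: o'_def y_def)
    next
      fix p assume "p \<in> D"
      have "inj_on \<pi> (orbit_surface o' d (X ` D))"
      proof (rule inj_onI)
        fix s s' assume s: "s \<in> orbit_surface o' d (X ` D)" "s' \<in> orbit_surface o' d (X ` D)" "\<pi> s = \<pi> s'"
        obtain q where q: "q \<in> D" "mink (s - o') d = mink (X q - o') d"
          "mink (s - o') (s - o') = mink (X q - o') (X q - o')"
          using s(1) by (auto simp: orbit_surface_def)
        obtain q' where q': "q' \<in> D" "mink (s' - o') d = mink (X q' - o') d"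
          "mink (s' - o') (s' - o') = mink (X q' - o') (X q' - o')"
          using s(2) by (auto simp: orbit_surface_def)
        have e: "s$1 = s'$1" "s$2 - s$3 = s'$2 - s'$3"
          using s(3) by (simp_all add: \<pi>_def vec_eq_iff forall_2)
        have yq: "s$2 - s$3 = y q" "s'$2 - s'$3 = y q'" using q(2) q'(2) unfolding inv1 y_def by simp_all
        then have "y q = y q'" using e by simp
        then have q1: "q$1 = q'$1"
          using leafwise_injective[OF open_D connected_params leafwise_y[folded y_def] diff_xyz(2) y_u_nz q(1) q'(1)]
          by blast
        have invar: "mink (X p - o') (X p - o') = x0\<^sup>2 + (y p - y0) * qc p" if "p \<in> D" for p
        proof -
          have "mink (X p - o') (X p - o') = (X p $ 1 - x0)\<^sup>2
              + ((y p - y0) * qa p) * ((X p $ 1)\<^sup>2 - 2 * x0 * X p $ 1) + (y p - y0) * qc p"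
            unfolding inv2 parabola[OF that] y_def[symmetric] using xy[OF that]
            by (simp add: y_def algebra_simps)
          moreover have "(y p - y0) * qa p = -1" using xy[OF that] by blast
          ultimately have "mink (X p - o') (X p - o') = (X p $ 1 - x0)\<^sup>2
              - ((X p $ 1)\<^sup>2 - 2 * x0 * X p $ 1) + (y p - y0) * qc p" by simp
          then show ?thesis by (simp add: power2_eq_square algebra_simps)
        qed
        have "qc q = qc q'" using q1 q(1) q'(1) leafwise_q(3) unfolding leafwise_def by blast
        then have "mink (s - o') (s - o') = mink (s' - o') (s' - o')"
          using q(3) q'(3) invar[OF q(1)] invar[OF q'(1)] \<open>y q = y q'\<close> by simp
        then have "(y q - y0) * (s$2 + s$3) = (y q - y0) * (s'$2 + s'$3)"
          unfolding inv2 using e yq by simp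
        then have "s$2 + s$3 = s'$2 + s'$3" using nz[OF q(1)] by simp
        then have "s$2 = s'$2" "s$3 = s'$3" using e(2) by linarith+
        then show "s = s'" using e(1) by (simp add: vec_eq_iff forall_3)
      qed
      then show "\<exists>V. open V \<and> X p \<in> V \<and> inj_on \<pi> (orbit_surface o' d (X ` D) \<inter> V)"
        by (intro exI[of _ UNIV]) simp
    qed
  qed
  show ?thesis
  proof (cases "c \<noteq> 0 \<or> (a \<noteq> 0 \<and> b \<noteq> 0)")
    case True
    then show ?thesis using rev by blast
  next
    case False
    then show ?thesis using ab lw by auto
  qed
qed

end

section \<open>Circles in parallel planes\<close>

lemma linear_functional_3:
  fixes \<nu> :: "real^3 \<Rightarrow> real"
  assumes "linear \<nu>"
  shows "\<nu> x = x$1 * \<nu> (axis 1 1) + x$2 * \<nu> (axis 2 1) + x$3 * \<nu> (axis 3 1)"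
proof -
  have "x = x$1 *\<^sub>R axis 1 1 + x$2 *\<^sub>R axis 2 1 + x$3 *\<^sub>R axis 3 1"
    by (simp add: vec_eq_iff forall_3 axis_def)
  then have "\<nu> x = \<nu> (x$1 *\<^sub>R axis 1 1 + x$2 *\<^sub>R axis 2 1 + x$3 *\<^sub>R axis 3 1)" by simp
  then show ?thesis using assms by (simp add: linear_add linear_scale)
qed

text \<open>Each of the three normal forms spans its plane affinely, so a functional that is constant on the curve
vanishes on the directions of the plane; a few values of the parameter suffice to see it. The circle of the
spacelike plane comes first.\<close>

lemma functional_constant_on_ellipse:
  fixes \<nu> :: "real^3 \<Rightarrow> real"
  assumes \<nu>: "linear \<nu>" and r: "r > 0"
    and c: "\<And>s. \<nu> (vector [r * cos (s / r), r * sin (s / r), 0]) = k"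
  shows "\<nu> (axis 1 1) = 0" "\<nu> (axis 2 1) = 0"
proof -
  note c' = c[unfolded linear_functional_3[OF \<nu>, of "vector _"]]
  have "r * \<nu> (axis 1 1) = k" using c'[of 0] by simp
  moreover have "- (r * \<nu> (axis 1 1)) = k" using c'[of "pi * r"] r by simp
  ultimately have "r * \<nu> (axis 1 1) = 0" "k = 0" by linarith+
  moreover have "r * \<nu> (axis 2 1) = k" using c'[of "pi / 2 * r"] r by simp
  ultimately show "\<nu> (axis 1 1) = 0" "\<nu> (axis 2 1) = 0" using r by auto
qed

lemma functional_constant_on_hyperbola:
  fixes \<nu> :: "real^3 \<Rightarrow> real"
  assumes \<nu>: "linear \<nu>" and r: "r > 0"
    and c: "\<And>s. \<nu> (vector [0, r * sinh (s / r), r * cosh (s / r)]) = k"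
  shows "\<nu> (axis 2 1) = 0" "\<nu> (axis 3 1) = 0"
proof -
  note c' = c[unfolded linear_functional_3[OF \<nu>, of "vector _"]]
  have 0: "r * \<nu> (axis 3 1) = k" using c'[of 0] by simp
  have 1: "r * sinh 1 * \<nu> (axis 2 1) + r * cosh 1 * \<nu> (axis 3 1) = k" using c'[of r] r by simp
  have 2: "- (r * sinh 1 * \<nu> (axis 2 1)) + r * cosh 1 * \<nu> (axis 3 1) = k"
    using c'[of "- r"] r by simp
  have sh: "sinh (1::real) \<noteq> 0" by simp
  have "r * sinh 1 * \<nu> (axis 2 1) = 0" using 1 2 by linarith
  then show "\<nu> (axis 2 1) = 0" using r sh by simp
  then have "r * cosh 1 * \<nu> (axis 3 1) = r * \<nu> (axis 3 1)" using 0 1 by simp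
  moreover have "cosh (1::real) \<noteq> 1"
  proof
    assume "cosh (1::real) = 1"
    then have "(sinh (1::real))\<^sup>2 = 0" using cosh_square_eq[of "1::real"] by simp
    then show False using sh by simp
  qed
  ultimately show "\<nu> (axis 3 1) = 0" using r by simp
qed

lemma functional_constant_on_parabola:
  fixes \<nu> :: "real^3 \<Rightarrow> real"
  assumes \<nu>: "linear \<nu>" and r: "r > 0"
    and c: "\<And>s. \<nu> (vector [s, r * s\<^sup>2 / 2, r * s\<^sup>2 / 2]) = k"
  shows "\<nu> (axis 1 1) = 0" "\<nu> (axis 2 1) + \<nu> (axis 3 1) = 0"
proof -
  note c' = c[unfolded linear_functional_3[OF \<nu>, of "vector _"]]
  have k: "k = 0" using c'[of 0] by simp
  have 1: "\<nu> (axis 1 1) + r / 2 * (\<nu> (axis 2 1) + \<nu> (axis 3 1)) = 0"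
    using c'[of 1] k by (simp add: algebra_simps)
  have 2: "- \<nu> (axis 1 1) + r / 2 * (\<nu> (axis 2 1) + \<nu> (axis 3 1)) = 0"
    using c'[of "-1"] k by (simp add: algebra_simps)
  show "\<nu> (axis 1 1) = 0" using 1 2 by linarith
  then show "\<nu> (axis 2 1) + \<nu> (axis 3 1) = 0" using 1 r by simp
qed

text \<open>How a plane that contains a circle is placed with respect to the isometry that brings the circle to its normal form: a functional that
defines the plane vanishes on the images of the directions of the normal form.\<close>

lemma circle_constant_functional_cases:
  fixes \<nu> :: "real^3 \<Rightarrow> real"
  assumes K: "is_circle K" and \<nu>: "linear \<nu>" and k: "\<forall>y\<in>K. \<nu> y = k"
  obtains (ellipse) f b r where "linear f" "\<And>x y. mink (f x) (f y) = mink x y" "r > 0"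
      "K = range (\<lambda>s. f (vector [r * cos (s / r), r * sin (s / r), 0]) + b)"
      "\<nu> (f (axis 1 1)) = 0" "\<nu> (f (axis 2 1)) = 0"
  | (hyperbola) f b r where "linear f" "\<And>x y. mink (f x) (f y) = mink x y" "r > 0"
      "K = range (\<lambda>s. f (vector [0, r * sinh (s / r), r * cosh (s / r)]) + b)"
      "\<nu> (f (axis 2 1)) = 0" "\<nu> (f (axis 3 1)) = 0"
  | (parabola) f b r where "linear f" "\<And>x y. mink (f x) (f y) = mink x y" "r > 0"
      "K = range (\<lambda>s. f (vector [s, r * s\<^sup>2 / 2, r * s\<^sup>2 / 2]) + b)"
      "\<nu> (f (axis 1 1)) = 0" "\<nu> (f (axis 2 1)) + \<nu> (f (axis 3 1)) = 0"
proof -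
  obtain \<phi> r where \<phi>: "mink_isometry \<phi>" "r > 0" and
    K: "K = \<phi> ` range (\<lambda>s. vector [r * cos (s / r), r * sin (s / r), 0]) \<or>
     K = \<phi> ` range (\<lambda>s. vector [0, r * sinh (s / r), r * cosh (s / r)]) \<or>
     K = \<phi> ` range (\<lambda>s. vector [s, r * s\<^sup>2 / 2, r * s\<^sup>2 / 2])"
    using assms(1) unfolding is_circle_def by blast
  obtain f b where f: "linear f" "\<And>x y. mink (f x) (f y) = mink x y" "\<phi> = (\<lambda>x. f x + b)"
    using \<phi>(1) unfolding mink_isometry_def by blast
  have lin: "linear (\<lambda>x. \<nu> (f x))" using linear_compose[OF f(1) \<nu>] by (simp add: comp_def)
  have c: "\<nu> (f v) = k - \<nu> b" if "f v + b \<in> K" for v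
    using k that \<nu> linear_add[OF \<nu>, of "f v" b] by (simp add: eq_diff_eq)
  consider (e) "K = range (\<lambda>s. f (vector [r * cos (s / r), r * sin (s / r), 0]) + b)"
    | (h) "K = range (\<lambda>s. f (vector [0, r * sinh (s / r), r * cosh (s / r)]) + b)"
    | (p) "K = range (\<lambda>s. f (vector [s, r * s\<^sup>2 / 2, r * s\<^sup>2 / 2]) + b)"
    using K unfolding f(3) image_image by blast
  then show ?thesis
  proof cases
    case e
    have "\<nu> (f (vector [r * cos (s / r), r * sin (s / r), 0])) = k - \<nu> b" for s by (rule c) (use e in blast)
    note functional_constant_on_ellipse[OF lin \<phi>(2) this]
    then show ?thesis by (rule ellipse[OF f(1,2) \<phi>(2) e])
  next
    case h
    have "\<nu> (f (vector [0, r * sinh (s / r), r * cosh (s / r)])) = k - \<nu> b" for s by (rule c) (use h in blast)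
    note functional_constant_on_hyperbola[OF lin \<phi>(2) this]
    then show ?thesis by (rule hyperbola[OF f(1,2) \<phi>(2) h])
  next
    case p
    have "\<nu> (f (vector [s, r * s\<^sup>2 / 2, r * s\<^sup>2 / 2])) = k - \<nu> b" for s by (rule c) (use p in blast)
    note functional_constant_on_parabola[OF lin \<phi>(2) this]
    then show ?thesis by (rule parabola[OF f(1,2) \<phi>(2) p])
  qed
qed

lemma is_circle_isometry:
  assumes "mink_isometry \<psi>" "is_circle K" shows "is_circle (\<psi> ` K)"
proof -
  obtain \<phi> r where \<phi>: "mink_isometry \<phi>" "r > 0" and
    K: "K = \<phi> ` range (\<lambda>s. vector [r * cos (s / r), r * sin (s / r), 0]) \<or>
     K = \<phi> ` range (\<lambda>s. vector [0, r * sinh (s / r), r * cosh (s / r)]) \<or>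
     K = \<phi> ` range (\<lambda>s. vector [s, r * s\<^sup>2 / 2, r * s\<^sup>2 / 2])"
    using assms(2) unfolding is_circle_def by blast
  define \<eta> where "\<eta> = (\<lambda>x. \<psi> (\<phi> x))"
  have im: "\<psi> ` \<phi> ` A = \<eta> ` A" for A by (simp add: image_image \<eta>_def)
  have "mink_isometry \<eta>" unfolding \<eta>_def by (rule mink_isometry_compose[OF assms(1) \<phi>(1)])
  moreover have "\<psi> ` K = \<eta> ` range (\<lambda>s. vector [r * cos (s / r), r * sin (s / r), 0]) \<or>
     \<psi> ` K = \<eta> ` range (\<lambda>s. vector [0, r * sinh (s / r), r * cosh (s / r)]) \<or>
     \<psi> ` K = \<eta> ` range (\<lambda>s. vector [s, r * s\<^sup>2 / 2, r * s\<^sup>2 / 2])"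
    unfolding im[symmetric] using K by blast
  ultimately show ?thesis using \<phi>(2) unfolding is_circle_def by blast
qed

text \<open>The metric of the plane is positive definite. That excludes the hyperbola and the parabola, whose planes contain
timelike and lightlike vectors.\<close>

lemma circle_in_spacelike_plane:
  assumes "is_circle K" and k: "\<forall>y\<in>K. y$3 = k"
  shows "\<exists>A B r. r > 0 \<and> (\<forall>y\<in>K. (y$1 - A)\<^sup>2 + (y$2 - B)\<^sup>2 = r\<^sup>2)"
proof -
  have \<nu>: "linear (\<lambda>y::real^3. y$3)" by (rule linearI) simp_all
  have lin: "linear (\<lambda>x. f x $ 3)" if "linear f" for f :: "real^3 \<Rightarrow> real^3"
    using linear_compose[OF that \<nu>] by (simp add: comp_def)
  show ?thesis
  proof (cases rule: circle_constant_functional_cases[OF assms(1) \<nu> k, case_names ellipse hyperbola parabola])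
    case (ellipse f b r)
    let ?c = "\<lambda>s. vector [r * cos (s / r), r * sin (s / r), 0] :: real^3"
    have "(f (?c s) $ 1)\<^sup>2 + (f (?c s) $ 2)\<^sup>2 = r\<^sup>2" for s
    proof -
      have "f (?c s) $ 3 = 0" using linear_functional_3[OF lin[OF ellipse(1)], of "?c s"] ellipse(5,6) by simp
      moreover have "mink (f (?c s)) (f (?c s)) = (r * cos (s / r)) * (r * cos (s / r)) + (r * sin (s / r)) * (r * sin (s / r))"
        unfolding ellipse(2) by (simp add: mink_def)
      moreover have "\<dots> = r\<^sup>2 * ((cos (s / r))\<^sup>2 + (sin (s / r))\<^sup>2)"
        by (simp only: power2_eq_square algebra_simps)
      ultimately show ?thesis by (simp add: mink_def power2_eq_square)
    qed
    then show ?thesis using ellipse(3,4) by (intro exI[of _ "b$1"] exI[of _ "b$2"] exI[of _ r]) auto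
  next
    case (hyperbola f b r)
    have "mink (f (axis 3 1)) (f (axis 3 1)) = -1" unfolding hyperbola(2) by (simp add: mink_def axis_def)
    then have "(f (axis 3 1) $ 1)\<^sup>2 + (f (axis 3 1) $ 2)\<^sup>2 = -1" using hyperbola(5,6) by (simp add: mink_def power2_eq_square)
    then have False using sum_power2_ge_zero[of "f (axis 3 1) $ 1" "f (axis 3 1) $ 2"] by linarith
    then show ?thesis ..
  next
    case (parabola f b r)
    let ?n = "vector [0, 1, 1] :: real^3"
    have n3: "f ?n $ 3 = 0" using linear_functional_3[OF lin[OF parabola(1)], of ?n] parabola(5,6) by simp
    have "mink (f ?n) (f ?n) = 0" unfolding parabola(2) by (simp add: mink_def)
    then have "(f ?n $ 1)\<^sup>2 + (f ?n $ 2)\<^sup>2 = 0" using n3 by (simp add: mink_def power2_eq_square)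
    then have "f ?n $ 1 = 0" "f ?n $ 2 = 0" by (simp_all add: sum_power2_eq_zero_iff)
    then have "mink (f ?n) (f (axis 2 1)) = 0" using n3 by (simp add: mink_def)
    then show ?thesis unfolding parabola(2) by (simp add: mink_def axis_def)
  qed
qed

text \<open>A plane of index 1 contains neither two orthogonal spacelike unit vectors (the circle) nor a spacelike
unit vector orthogonal to a lightlike one (the parabola).\<close>

lemma circle_in_timelike_plane:
  assumes "is_circle K" and k: "\<forall>y\<in>K. y$1 = k"
  shows "\<exists>A B r. r > 0 \<and> (\<forall>y\<in>K. (y$2 - A)\<^sup>2 - (y$3 - B)\<^sup>2 = - r\<^sup>2)"
proof -
  have \<nu>: "linear (\<lambda>y::real^3. y$1)" by (rule linearI) simp_all
  have lin: "linear (\<lambda>x. f x $ 1)" if "linear f" for f :: "real^3 \<Rightarrow> real^3"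
    using linear_compose[OF that \<nu>] by (simp add: comp_def)
  show ?thesis
  proof (cases rule: circle_constant_functional_cases[OF assms(1) \<nu> k, case_names ellipse hyperbola parabola])
    case (ellipse f b r)
    define p q where "p = f (axis 1 1)" and "q = f (axis 2 1)"
    have "mink p p = 1" "mink q q = 1" "mink p q = 0"
      unfolding p_def q_def ellipse(2) by (simp_all add: mink_def axis_def)
    then have e: "p$2 * p$2 = 1 + p$3 * p$3" "q$2 * q$2 = 1 + q$3 * q$3" "p$2 * q$2 = p$3 * q$3"
      using ellipse(5,6) by (simp_all add: mink_def p_def q_def)
    have "(p$2 * p$2) * (q$2 * q$2) = (p$2 * q$2)\<^sup>2" by algebra
    also have "\<dots> = (p$3 * p$3) * (q$3 * q$3)" unfolding e(3) by algebra
    finally have "1 + (p$3)\<^sup>2 + (q$3)\<^sup>2 = 0" unfolding e(1,2) by (simp add: power2_eq_square algebra_simps)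
    then have False using sum_power2_ge_zero[of "p$3" "q$3"] by linarith
    then show ?thesis ..
  next
    case (hyperbola f b r)
    let ?c = "\<lambda>s. vector [0, r * sinh (s / r), r * cosh (s / r)] :: real^3"
    have "(f (?c s) $ 2)\<^sup>2 - (f (?c s) $ 3)\<^sup>2 = - r\<^sup>2" for s
    proof -
      have "f (?c s) $ 1 = 0" using linear_functional_3[OF lin[OF hyperbola(1)], of "?c s"] hyperbola(5,6) by simp
      moreover have "mink (f (?c s)) (f (?c s)) = r\<^sup>2 * ((sinh (s / r))\<^sup>2 - (cosh (s / r))\<^sup>2)"
        unfolding hyperbola(2) by (simp add: mink_def power2_eq_square algebra_simps)
      ultimately show ?thesis by (simp add: mink_def power2_eq_square[symmetric] cosh_square_eq)
    qed
    then show ?thesis using hyperbola(3,4) by (intro exI[of _ "b$2"] exI[of _ "b$3"] exI[of _ r]) auto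
  next
    case (parabola f b r)
    let ?n = "vector [0, 1, 1] :: real^3"
    define p q where "p = f (axis 1 1)" and "q = f ?n"
    have q1: "q $ 1 = 0" using linear_functional_3[OF lin[OF parabola(1)], of ?n] parabola(5,6) by (simp add: q_def)
    have p1: "p $ 1 = 0" using parabola(5,6) by (simp add: p_def)
    have "mink p p = 1" "mink q q = 0" "mink p q = 0"
      unfolding p_def q_def parabola(2) by (simp_all add: mink_def axis_def)
    then have e: "p$2 * p$2 = 1 + p$3 * p$3" "q$2 * q$2 = q$3 * q$3" "p$2 * q$2 = p$3 * q$3"
      using p1 q1 by (simp_all add: mink_def)
    have "(p$2 * p$2) * (q$2 * q$2) = (p$2 * q$2)\<^sup>2" by algebra
    also have "\<dots> = (p$3 * p$3) * (q$3 * q$3)" unfolding e(3) by algebra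
    finally have "q$3 = 0" unfolding e(1,2) by (simp add: algebra_simps)
    then have "q$2 = 0" using e(2) by simp
    then have "mink q (f (axis 2 1)) = 0" using q1 \<open>q$3 = 0\<close> by (simp add: mink_def)
    then show ?thesis unfolding q_def parabola(2) by (simp add: mink_def axis_def)
  qed
qed

text \<open>On a degenerate plane, the metric is the square of the first coordinate, so it has no two orthogonal unit vectors
and no timelike vector. For the parabola, \<open>f\<close> maps the lightlike direction into that of the plane and the
first axis to a unit vector, which gives the graph of a quadratic function.\<close>

lemma circle_in_lightlike_plane:
  assumes "is_circle K" and k: "\<forall>y\<in>K. y$2 - y$3 = k"
  shows "\<exists>A B C. A \<noteq> 0 \<and> (\<forall>y\<in>K. y$2 + y$3 = A * (y$1)\<^sup>2 + B * y$1 + C)"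
proof -
  have \<nu>: "linear (\<lambda>y::real^3. y$2 - y$3)" by (rule linearI) (simp_all add: algebra_simps)
  have lin: "linear (\<lambda>x. f x $ 2 - f x $ 3)" if "linear f" for f :: "real^3 \<Rightarrow> real^3"
    using linear_compose[OF that \<nu>] by (simp add: comp_def)
  show ?thesis
  proof (cases rule: circle_constant_functional_cases[OF assms(1) \<nu> k, case_names ellipse hyperbola parabola])
    case (ellipse f b r)
    define p q where "p = f (axis 1 1)" and "q = f (axis 2 1)"
    have "mink p p = 1" "mink q q = 1" "mink p q = 0"
      unfolding p_def q_def ellipse(2) by (simp_all add: mink_def axis_def)
    then have "p$1 * p$1 = 1" "q$1 * q$1 = 1" "p$1 * q$1 = 0"
      using ellipse(5,6) by (simp_all add: mink_def p_def q_def)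
    then show ?thesis by auto
  next
    case (hyperbola f b r)
    have "mink (f (axis 3 1)) (f (axis 3 1)) = -1" unfolding hyperbola(2) by (simp add: mink_def axis_def)
    then have "(f (axis 3 1) $ 1)\<^sup>2 = -1" using hyperbola(5,6) by (simp add: mink_def power2_eq_square)
    then have False using zero_le_power2[of "f (axis 3 1) $ 1"] by linarith
    then show ?thesis ..
  next
    case (parabola f b r)
    let ?c = "\<lambda>s. vector [s, r * s\<^sup>2 / 2, r * s\<^sup>2 / 2] :: real^3"
    let ?n = "vector [0, 1, 1] :: real^3"
    define p q where "p = f (axis 1 1)" and "q = f ?n"
    have q23: "q$2 = q$3" using linear_functional_3[OF lin[OF parabola(1)], of ?n] parabola(5,6) by (simp add: q_def)
    have p23: "p$2 = p$3" using parabola(5,6) by (simp add: p_def)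
    have "mink p p = 1" "mink q q = 0" unfolding p_def q_def parabola(2) by (simp_all add: mink_def axis_def)
    then have p1: "p$1 * p$1 = 1" and q1: "q$1 = 0" using p23 q23 by (simp_all add: mink_def)
    have q2: "q$2 \<noteq> 0"
    proof
      assume "q$2 = 0"
      then have "mink q (f (axis 2 1)) = 0" using q1 q23 by (simp add: mink_def)
      then show False unfolding q_def parabola(2) by (simp add: mink_def axis_def)
    qed
    define A where "A = r * q$2"
    have "(f (?c s) + b)$2 + (f (?c s) + b)$3
        = A * ((f (?c s) + b)$1 - b$1)\<^sup>2 + 2 * p$2 * p$1 * ((f (?c s) + b)$1 - b$1) + b$2 + b$3" for s
    proof -
      have "?c s = s *\<^sub>R axis 1 1 + (r * s\<^sup>2 / 2) *\<^sub>R ?n" by (simp add: vec_eq_iff forall_3 axis_def)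
      then have fc: "f (?c s) = s *\<^sub>R p + (r * s\<^sup>2 / 2) *\<^sub>R q"
        by (simp add: p_def q_def linear_add[OF parabola(1)] linear_scale[OF parabola(1)])
      have "(p$1)\<^sup>2 = 1" using p1 by (simp add: power2_eq_square)
      moreover have "p$1 * (p$1 * t) = t" for t using p1 by (simp add: mult.assoc[symmetric])
      ultimately show ?thesis
        unfolding fc using q1 p23 q23 by (simp add: A_def power_mult_distrib algebra_simps)
    qed
    then have h: "y$2 + y$3 = A * (y$1 - b$1)\<^sup>2 + 2 * p$2 * p$1 * (y$1 - b$1) + b$2 + b$3" if "y \<in> K" for y
      using that parabola(4) by auto
    have "y$2 + y$3 = A * (y$1)\<^sup>2 + (2 * p$2 * p$1 - 2 * A * b$1) * y$1
        + (A * (b$1)\<^sup>2 - 2 * p$2 * p$1 * b$1 + b$2 + b$3)" if "y \<in> K" for y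
      using h[OF that] by (simp add: power2_eq_square algebra_simps)
    moreover have "A \<noteq> 0" using parabola(3) q2 by (simp add: A_def)
    ultimately show ?thesis by blast
  qed
qed

lemma plane_functional:
  assumes "plane P"
  shows "\<exists>n c. n \<noteq> 0 \<and> P = {x. n \<bullet> x = c}"
proof -
  have "affine P" "aff_dim P = DIM(real^3) - 1" using assms by (simp_all add: plane_def)
  then show ?thesis using aff_dim_eq_hyperplane[of P] by (auto simp: hull_same)
qed

text \<open>The isometry is the inverse of the one that brings the circle \<open>C u0\<close> to its normal form. A normal vector \<open>n\<close>
of the plane of \<open>C u0\<close> gives a functional that is constant on every circle of the family, since the planes are parallel. Pulled back, it is a multiple
of \<open>x\<^sub>3\<close>, of \<open>x\<^sub>1\<close> or of \<open>x\<^sub>2 - x\<^sub>3\<close>.\<close>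

lemma circles_in_standard_planes:
  assumes circ: "\<And>u. u \<in> I \<Longrightarrow> is_circle (C u)" and u0: "u0 \<in> I"
    and P: "\<And>u. u \<in> I \<Longrightarrow> plane (P u)" "\<And>u. u \<in> I \<Longrightarrow> C u \<subseteq> P u"
    and par: "\<And>u u'. u \<in> I \<Longrightarrow> u' \<in> I \<Longrightarrow> affine_parallel (P u) (P u')"
  shows "\<exists>\<psi>. mink_isometry \<psi> \<and>
    ((\<forall>u\<in>I. \<exists>k. \<forall>y\<in>\<psi> ` C u. y$3 = k) \<or> (\<forall>u\<in>I. \<exists>k. \<forall>y\<in>\<psi> ` C u. y$1 = k) \<or>
     (\<forall>u\<in>I. \<exists>k. \<forall>y\<in>\<psi> ` C u. y$2 - y$3 = k))"
proof -
  obtain n c where n: "n \<noteq> 0" "P u0 = {x. n \<bullet> x = c}" using plane_functional[OF P(1)[OF u0]] by blast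
  have const: "\<exists>k. \<forall>x\<in>C u. n \<bullet> x = k" if u: "u \<in> I" for u
  proof -
    obtain a where "P u0 = (\<lambda>x. a + x) ` P u" using par[OF u u0] unfolding affine_parallel_def by blast
    then have "n \<bullet> (a + x) = c" if "x \<in> C u" for x using that P(2)[OF u] n(2) by blast
    then have "\<forall>x\<in>C u. n \<bullet> x = c - n \<bullet> a" by (simp add: inner_add_right eq_diff_eq add.commute)
    then show ?thesis by blast
  qed
  have main: "\<exists>\<psi>. mink_isometry \<psi> \<and> (\<forall>u\<in>I. \<exists>k. \<forall>y\<in>\<psi> ` C u. N y = k)"
    if f: "linear f" "\<And>x y. mink (f x) (f y) = mink x y"
      and fac: "\<exists>m. \<forall>x. n \<bullet> f x = m * N x" for f and b :: "real^3" and N :: "real^3 \<Rightarrow> real"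
  proof -
    obtain m where m: "\<And>x. n \<bullet> f x = m * N x" using fac by blast
    have "m \<noteq> 0"
    proof
      assume "m = 0"
      obtain x where "n = f x" using mink_preserving_bij[OF f] by (metis bij_pointE)
      then have "n \<bullet> n = 0" using m[of x] \<open>m = 0\<close> by simp
      then show False using n(1) by simp
    qed
    have iso: "mink_isometry (\<lambda>x. f x + b)" using f unfolding mink_isometry_def by blast
    obtain \<psi> where \<psi>: "mink_isometry \<psi>" "\<forall>x. f (\<psi> x) + b = x" using mink_isometry_inverse[OF iso] by blast
    have "\<exists>k. \<forall>y\<in>\<psi> ` C u. N y = k" if u: "u \<in> I" for u
    proof -
      obtain k where k: "\<And>x. x \<in> C u \<Longrightarrow> n \<bullet> x = k" using const[OF u] by blast
      have "N (\<psi> x) = (k - n \<bullet> b) / m" if "x \<in> C u" for x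
      proof -
        have "n \<bullet> x = n \<bullet> (f (\<psi> x) + b)" using \<psi>(2) by simp
        then show ?thesis using m[of "\<psi> x"] k[OF that] \<open>m \<noteq> 0\<close> by (simp add: inner_add_right field_simps)
      qed
      then show ?thesis by blast
    qed
    then show ?thesis using \<psi>(1) by blast
  qed
  obtain k0 where k0: "\<forall>x\<in>C u0. n \<bullet> x = k0" using const[OF u0] by blast
  have \<nu>: "linear (\<lambda>x. n \<bullet> x)" by (rule linearI) (simp_all add: inner_add_right)
  have lin: "linear (\<lambda>x. n \<bullet> f x)" if "linear f" for f :: "real^3 \<Rightarrow> real^3"
    using linear_compose[OF that \<nu>] by (simp add: comp_def)
  show ?thesis
  proof (cases rule: circle_constant_functional_cases[OF circ[OF u0] \<nu> k0, case_names ellipse hyperbola parabola])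
    case (ellipse f b r)
    have "n \<bullet> f x = (n \<bullet> f (axis 3 1)) * x$3" for x
      using linear_functional_3[OF lin[OF ellipse(1)], of x] ellipse(5,6) by simp
    then show ?thesis using main[OF ellipse(1,2), of "\<lambda>y. y$3"] by blast
  next
    case (hyperbola f b r)
    have "n \<bullet> f x = (n \<bullet> f (axis 1 1)) * x$1" for x
      using linear_functional_3[OF lin[OF hyperbola(1)], of x] hyperbola(5,6) by simp
    then show ?thesis using main[OF hyperbola(1,2), of "\<lambda>y. y$1"] by blast
  next
    case (parabola f b r)
    have "n \<bullet> f (axis 3 1) = - (n \<bullet> f (axis 2 1))" using parabola(6) by linarith
    then have "n \<bullet> f x = (n \<bullet> f (axis 2 1)) * (x$2 - x$3)" for x
      using linear_functional_3[OF lin[OF parabola(1)], of x] parabola(5) by (simp add: algebra_simps)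
    then show ?thesis using main[OF parabola(1,2), of "\<lambda>y. y$2 - y$3"] by blast
  qed
qed

section \<open>Reduction to standard position\<close>

text \<open>Applying the same linear isometry to \<open>X\<close> and to the normal field does not change the matrix of the shape operator.\<close>
lemma isometric_image_of_surface:
  fixes f :: "real^3 \<Rightarrow> real^3" and b :: "real^3"
  assumes f: "linear f" "\<And>x y. mink (f x) (f y) = mink x y"
    and sp: "spacelike_surface X D" and nm: "unit_normal_field X D G"
  defines "X' \<equiv> \<lambda>p. f (X p) + b" and "G' \<equiv> \<lambda>p. f (G p)"
  shows "spacelike_surface X' D" "unit_normal_field X' D G'"
    "\<And>p. p \<in> D \<Longrightarrow> dgauss X' G' p = dgauss X G p"
proof -
  have opD: "open D" and imm: "immersion_on X D" using sp by (simp_all add: spacelike_surface_def)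
  have sX: "smooth_map_on X D" using imm by (simp add: immersion_on_def)
  have sG: "smooth_map_on G D" using nm by (simp add: unit_normal_field_def)
  have bl: "bounded_linear f" using f(1) by (simp add: linear_conv_bounded_linear)
  have inj: "inj f" using mink_preserving_bij[OF f] bij_is_inj by blast
  have dX: "frechet_derivative X' (at p) = (\<lambda>w. f (frechet_derivative X (at p) w))" if "p \<in> D" for p
  proof -
    have "(X has_derivative frechet_derivative X (at p)) (at p)"
      using smooth_differentiable[OF sX that] by (simp add: frechet_derivative_works)
    then have hd: "(X' has_derivative (\<lambda>w. f (frechet_derivative X (at p) w) + 0)) (at p)"
      unfolding X'_def by (intro has_derivative_add has_derivative_const bounded_linear.has_derivative[OF bl])
    show ?thesis using frechet_derivative_at[OF hd] by simp
  qed
  have dG: "frechet_derivative G' (at p) = (\<lambda>w. f (frechet_derivative G (at p) w))" if "p \<in> D" for p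
  proof -
    have "(G has_derivative frechet_derivative G (at p)) (at p)"
      using smooth_differentiable[OF sG that] by (simp add: frechet_derivative_works)
    then have hd: "(G' has_derivative (\<lambda>w. f (frechet_derivative G (at p) w))) (at p)"
      unfolding G'_def by (rule bounded_linear.has_derivative[OF bl])
    show ?thesis using frechet_derivative_at[OF hd] by simp
  qed
  have iso: "mink_isometry (\<lambda>x. f x + b)" using f unfolding mink_isometry_def by blast
  have "immersion_on X' D" unfolding X'_def by (rule immersion_compose_isometry[OF iso opD imm])
  then show "spacelike_surface X' D"
    using sp by (simp add: spacelike_surface_def dX f(2))
  show "unit_normal_field X' D G'"
    using nm smooth_linear[OF opD bl sG] by (simp add: unit_normal_field_def dX f(2) G'_def)
  show "dgauss X' G' p = dgauss X G p" if "p \<in> D" for p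
    unfolding dgauss_def dX[OF that] dG[OF that] using inj by (simp add: inj_eq)
qed

text \<open>The isometries fixing \<open>\<psi> ` l\<close> are the conjugates of those fixing \<open>l\<close>.\<close>

lemma surface_of_revolution_isometry:
  assumes iso: "mink_isometry \<psi>" and S: "surface_of_revolution S"
  shows "surface_of_revolution (\<psi> ` S)"
proof -
  obtain \<eta> where \<eta>: "mink_isometry \<eta>" "\<And>x. \<eta> (\<psi> x) = x" "\<And>x. \<psi> (\<eta> x) = x"
    using mink_isometry_inverse[OF iso] by blast
  obtain l where l: "line l" and inv: "\<And>\<phi>. mink_isometry \<phi> \<Longrightarrow> (\<forall>x\<in>l. \<phi> x = x) \<Longrightarrow> \<phi> ` S = S"
    using S unfolding surface_of_revolution_def by blast
  have "regular_surface (\<psi> ` S)"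
    unfolding regular_surface_def
  proof
    fix s assume "s \<in> \<psi> ` S"
    then obtain p where p: "p \<in> S" "s = \<psi> p" by blast
    obtain U V Y Z where U: "open U" "open V" "p \<in> V" "immersion_on Y U" "homeomorphism U (S \<inter> V) Y Z"
      using S p(1) unfolding surface_of_revolution_def regular_surface_def by blast
    obtain V' Z' where "open V'" "\<forall>x. x \<in> V \<longrightarrow> \<psi> x \<in> V'"
      "homeomorphism U (\<psi> ` S \<inter> V') (\<lambda>p. \<psi> (Y p)) Z'"
      using homeomorphism_isometry_image[OF iso U(5,2)] by blast
    then show "\<exists>U V Y Z. open U \<and> open V \<and> s \<in> V \<and> immersion_on Y U \<and> homeomorphism U (\<psi> ` S \<inter> V) Y Z"
      using U(1,3) p(2) immersion_compose_isometry[OF iso U(1,4)] by blast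
  qed
  moreover have "line (\<psi> ` l)"
  proof -
    obtain f b where f: "linear f" "\<And>x y. mink (f x) (f y) = mink x y" "\<psi> = (\<lambda>x. f x + b)"
      using iso unfolding mink_isometry_def by blast
    have inj: "inj f" using mink_preserving_bij[OF f(1,2)] bij_is_inj by blast
    have im: "\<psi> ` l = (+) b ` (f ` l)" by (simp add: f(3) image_image add.commute)
    have "affine hull (f ` l) = f ` (affine hull l)"
      using affine_hull_linear_image[of f l] f(1) by (simp add: linear_conv_bounded_linear)
    then have "affine (f ` l)" using l by (metis affine_hull_eq line_def)
    then have "affine (\<psi> ` l)" unfolding im using affine_translation[of "f ` l" b] by blast
    moreover have "aff_dim (\<psi> ` l) = aff_dim l"
      unfolding im aff_dim_translation_eq by (rule aff_dim_injective_linear_image[OF f(1) inj])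
    ultimately show ?thesis using l by (simp add: line_def)
  qed
  moreover have "\<phi> ` \<psi> ` S = \<psi> ` S" if \<phi>: "mink_isometry \<phi>" "\<forall>x\<in>\<psi> ` l. \<phi> x = x" for \<phi>
  proof -
    have "mink_isometry (\<lambda>x. \<eta> (\<phi> (\<psi> x)))"
      by (intro mink_isometry_compose[OF \<eta>(1) mink_isometry_compose[OF \<phi>(1) iso]])
    moreover have "\<forall>x\<in>l. \<eta> (\<phi> (\<psi> x)) = x" using \<phi>(2) \<eta>(2) by simp
    ultimately have "(\<lambda>x. \<eta> (\<phi> (\<psi> x))) ` S = S" by (rule inv)
    then have "\<psi> ` (\<lambda>x. \<eta> (\<phi> (\<psi> x))) ` S = \<psi> ` S" by simp
    then show ?thesis by (simp add: image_image \<eta>(3))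
  qed
  ultimately show ?thesis unfolding surface_of_revolution_def by blast
qed

lemma part_of_surface_of_revolution_isometry:
  assumes iso: "mink_isometry \<psi>" and M: "part_of_surface_of_revolution M"
  shows "part_of_surface_of_revolution (\<psi> ` M)"
proof -
  obtain S where S: "surface_of_revolution S" "openin (top_of_set S) M"
    using M unfolding part_of_surface_of_revolution_def by blast
  obtain \<eta> where "homeomorphism UNIV UNIV \<psi> \<eta>" using mink_isometry_homeomorphism[OF iso] by blast
  then have "homeomorphism S (\<psi> ` S) \<psi> \<eta>" by (rule homeomorphism_of_subsets) auto
  then have "openin (top_of_set (\<psi> ` S)) (\<psi> ` M)" by (rule homeomorphism_imp_open_map[OF _ S(2)])
  then show ?thesis
    using surface_of_revolution_isometry[OF iso S(1)] unfolding part_of_surface_of_revolution_def by blast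
qed

lemma standard_position_classification:
  assumes sp: "spacelike_surface X D" and nm: "unit_normal_field X D G" and lw: "linear_weingarten X D G"
    and conn: "connected (leaf_params D)" "\<And>u. connected {v. vector [u, v] \<in> D}"
    and circ: "\<And>u. u \<in> leaf_params D \<Longrightarrow> is_circle (C u)"
    and XC: "\<And>p. p \<in> D \<Longrightarrow> X p \<in> C (p$1)"
    and pos: "(\<forall>u\<in>leaf_params D. \<exists>k. \<forall>y\<in>C u. y$3 = k) \<or> (\<forall>u\<in>leaf_params D. \<exists>k. \<forall>y\<in>C u. y$1 = k) \<or>
     (\<forall>u\<in>leaf_params D. \<exists>k. \<forall>y\<in>C u. y$2 - y$3 = k)"
  shows "part_of_surface_of_revolution (X ` D) \<or>
    (\<forall>p\<in>D. mean_curvature X G p = 0) \<or> (\<forall>p\<in>D. gauss_curvature X G p = 0)"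
proof -
  have lp: "p$1 \<in> leaf_params D" if "p \<in> D" for p
  proof -
    have "vector [p$1, p$2] \<in> D" using that by (simp only: vector_2_nth)
    then show ?thesis unfolding leaf_params_def by blast
  qed
  interpret leaved_surface X G D
    by unfold_locales (rule sp, rule nm, rule conn, rule conn)
  consider (spacelike) "\<forall>u\<in>leaf_params D. \<exists>k. \<forall>y\<in>C u. y$3 = k"
    | (timelike) "\<forall>u\<in>leaf_params D. \<exists>k. \<forall>y\<in>C u. y$1 = k"
    | (lightlike) "\<forall>u\<in>leaf_params D. \<exists>k. \<forall>y\<in>C u. y$2 - y$3 = k"
    using pos by blast
  then show ?thesis
  proof cases
    case spacelike
    then obtain k where k: "\<And>u y. u \<in> leaf_params D \<Longrightarrow> y \<in> C u \<Longrightarrow> y$3 = k u" by metis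
    have "\<forall>u\<in>leaf_params D. \<exists>A B r. r > 0 \<and> (\<forall>y\<in>C u. (y$1 - A)\<^sup>2 + (y$2 - B)\<^sup>2 = r\<^sup>2)"
      using circle_in_spacelike_plane[OF circ] k by blast
    then obtain A B r where c: "\<And>u. u \<in> leaf_params D \<Longrightarrow> r u > 0"
      "\<And>u y. u \<in> leaf_params D \<Longrightarrow> y \<in> C u \<Longrightarrow> (y$1 - A u)\<^sup>2 + (y$2 - B u)\<^sup>2 = (r u)\<^sup>2"
      by metis
    interpret conic_leaves X G D 1 1 2 3 "\<lambda>p. A (p$1)" "\<lambda>p. B (p$1)" "\<lambda>p. r (p$1)"
    proof unfold_locales
      show "leafwise D (\<lambda>p. X p $ 3)" unfolding leafwise_def using k[OF lp XC] by metis
      show "(X p $ 1 - A (p $ 1))\<^sup>2 + 1 * (X p $ 2 - B (p $ 1))\<^sup>2 = 1 * (r (p $ 1))\<^sup>2" if "p \<in> D" for p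
        using c(2)[OF lp[OF that] XC[OF that]] by simp
    qed (auto simp: mink_def leafwise_def c(1) lp)
    show ?thesis by (rule conic_leaves_classification[OF lw])
  next
    case timelike
    then obtain k where k: "\<And>u y. u \<in> leaf_params D \<Longrightarrow> y \<in> C u \<Longrightarrow> y$1 = k u" by metis
    have "\<forall>u\<in>leaf_params D. \<exists>A B r. r > 0 \<and> (\<forall>y\<in>C u. (y$2 - A)\<^sup>2 - (y$3 - B)\<^sup>2 = - r\<^sup>2)"
      using circle_in_timelike_plane[OF circ] k by blast
    then obtain A B r where c: "\<And>u. u \<in> leaf_params D \<Longrightarrow> r u > 0"
      "\<And>u y. u \<in> leaf_params D \<Longrightarrow> y \<in> C u \<Longrightarrow> (y$2 - A u)\<^sup>2 - (y$3 - B u)\<^sup>2 = - (r u)\<^sup>2"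
      by metis
    interpret conic_leaves X G D "-1" 2 3 1 "\<lambda>p. A (p$1)" "\<lambda>p. B (p$1)" "\<lambda>p. r (p$1)"
    proof unfold_locales
      show "leafwise D (\<lambda>p. X p $ 1)" unfolding leafwise_def using k[OF lp XC] by metis
      show "(X p $ 2 - A (p $ 1))\<^sup>2 + - 1 * (X p $ 3 - B (p $ 1))\<^sup>2 = - 1 * (r (p $ 1))\<^sup>2" if "p \<in> D" for p
        using c(2)[OF lp[OF that] XC[OF that]] by simp
    qed (auto simp: mink_def leafwise_def c(1) lp)
    show ?thesis by (rule conic_leaves_classification[OF lw])
  next
    case lightlike
    then obtain k where k: "\<And>u y. u \<in> leaf_params D \<Longrightarrow> y \<in> C u \<Longrightarrow> y$2 - y$3 = k u" by metis
    have "\<forall>u\<in>leaf_params D. \<exists>A B E. A \<noteq> 0 \<and> (\<forall>y\<in>C u. y$2 + y$3 = A * (y$1)\<^sup>2 + B * y$1 + E)"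
      using circle_in_lightlike_plane[OF circ] k by blast
    then obtain A B E where c: "\<And>u. u \<in> leaf_params D \<Longrightarrow> A u \<noteq> 0"
      "\<And>u y. u \<in> leaf_params D \<Longrightarrow> y \<in> C u \<Longrightarrow> y$2 + y$3 = A u * (y$1)\<^sup>2 + B u * y$1 + E u"
      by metis
    interpret parabola_leaves X G D "\<lambda>p. A (p$1)" "\<lambda>p. B (p$1)" "\<lambda>p. E (p$1)"
    proof unfold_locales
      show "leafwise D (\<lambda>p. X p $ 2 - X p $ 3)" unfolding leafwise_def using k[OF lp XC] by metis
      show "X p $ 2 + X p $ 3 = A (p $ 1) * (X p $ 1)\<^sup>2 + B (p $ 1) * X p $ 1 + E (p $ 1)" if "p \<in> D" for p
        using c(2)[OF lp[OF that] XC[OF that]] .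
    qed (auto simp: leafwise_def c(1) lp)
    show ?thesis by (rule parabola_leaves_classification[OF lw])
  qed
qed

theorem theorem1p1:
  fixes X G :: "real^2 \<Rightarrow> real^3" and D :: "(real^2) set" and C :: "real \<Rightarrow> (real^3) set"
  assumes "spacelike_surface X D"
    and "foliated_by_circles X D C"
    and "in_parallel_planes D C"
    and "unit_normal_field X D G"
    and "linear_weingarten X D G"
  shows "part_of_surface_of_revolution (X ` D) \<or>
    (\<forall>p\<in>D. mean_curvature X G p = 0) \<or>
    (\<forall>p\<in>D. gauss_curvature X G p = 0)"
proof (cases "D = {}")
  case True
  then show ?thesis by simp
next
  case False
  then obtain p0 where p0: "p0 \<in> D" by blast
  note fol = assms(2)[unfolded foliated_by_circles_def]
  have lp: "p$1 \<in> leaf_params D" if "p \<in> D" for p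
  proof -
    have "vector [p$1, p$2] \<in> D" using that by (simp only: vector_2_nth)
    then show ?thesis unfolding leaf_params_def by blast
  qed
  have XC: "X p \<in> C (p$1)" if "p \<in> D" for p
  proof -
    have "vector [p$1, p$2] \<in> D" using that by (simp only: vector_2_nth)
    then have "X (vector [p$1, p$2]) \<in> C (p$1)" using fol by blast
    then show ?thesis by (simp only: vector_2_nth)
  qed
  obtain P where P: "\<And>u. u \<in> leaf_params D \<Longrightarrow> plane (P u)" "\<And>u. u \<in> leaf_params D \<Longrightarrow> C u \<subseteq> P u"
    "\<And>u u'. u \<in> leaf_params D \<Longrightarrow> u' \<in> leaf_params D \<Longrightarrow> affine_parallel (P u) (P u')"
    using assms(3) unfolding in_parallel_planes_def by blast
  have circ: "\<And>u. u \<in> leaf_params D \<Longrightarrow> is_circle (C u)" using fol by blast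
  obtain \<psi> where \<psi>: "mink_isometry \<psi>" and pos:
    "(\<forall>u\<in>leaf_params D. \<exists>k. \<forall>y\<in>\<psi> ` C u. y$3 = k) \<or> (\<forall>u\<in>leaf_params D. \<exists>k. \<forall>y\<in>\<psi> ` C u. y$1 = k) \<or>
     (\<forall>u\<in>leaf_params D. \<exists>k. \<forall>y\<in>\<psi> ` C u. y$2 - y$3 = k)"
    using circles_in_standard_planes[where I = "leaf_params D" and C = C and P = P, OF circ lp[OF p0] P]
    by blast
  obtain f b where f: "linear f" "\<And>x y. mink (f x) (f y) = mink x y" "\<psi> = (\<lambda>x. f x + b)"
    using \<psi> unfolding mink_isometry_def by blast
  define X' G' where "X' = (\<lambda>p. f (X p) + b)" and "G' = (\<lambda>p. f (G p))"
  have X': "X' = (\<lambda>p. \<psi> (X p))" by (simp add: X'_def f(3))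
  note img = isometric_image_of_surface[OF f(1,2) assms(1,4), where b = b, folded X'_def G'_def]
  have cur: "mean_curvature X' G' p = mean_curvature X G p" "gauss_curvature X' G' p = gauss_curvature X G p"
    if "p \<in> D" for p
    using img(3)[OF that] by (simp_all add: mean_curvature_def gauss_curvature_def)
  have "part_of_surface_of_revolution (X' ` D) \<or>
    (\<forall>p\<in>D. mean_curvature X' G' p = 0) \<or> (\<forall>p\<in>D. gauss_curvature X' G' p = 0)"
  proof (rule standard_position_classification[OF img(1,2), where C = "\<lambda>u. \<psi> ` C u"])
    show "linear_weingarten X' D G'" using assms(5) cur by (simp add: linear_weingarten_def)
    show "is_circle (\<psi> ` C u)" if "u \<in> leaf_params D" for u by (rule is_circle_isometry[OF \<psi> circ[OF that]])
    show "X' p \<in> \<psi> ` C (p$1)" if "p \<in> D" for p using XC[OF that] by (simp add: X')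
  qed (use fol pos in auto)
  moreover have "part_of_surface_of_revolution (X ` D)" if "part_of_surface_of_revolution (X' ` D)"
  proof -
    obtain \<eta> where \<eta>: "mink_isometry \<eta>" "\<And>x. \<eta> (\<psi> x) = x" using mink_isometry_inverse[OF \<psi>] by blast
    have "\<eta> ` X' ` D = X ` D" by (simp add: X' image_image \<eta>(2))
    then show ?thesis using part_of_surface_of_revolution_isometry[OF \<eta>(1) that] by simp
  qed
  ultimately show ?thesis using cur by auto
qed

end
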